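(* Let $\varepsilon>0$ be fixed. For every sequence of finite graphs $G=G(k)$ with minimum degree at least $k$ and every $p=p(k)\ge\frac{(1+\varepsilon)\log k}{k}$, the random subgraph $G_p$ asymptotically almost surely contains a path of length $k$.
   Context: For a graph $G$ and $p\in[0,1]$, $G_p$ denotes the random subgraph of $G$ on the same vertex set obtained by keeping each edge of $G$ independently with probability $p$. The graph $G$ and $p$ are sequences indexed by $k\to\infty$, and "asymptotically almost surely" means with probability tending to $1$ as $k\to\infty$. $\log$ is the natural logarithm; the length of a path is its number of edges. *)

theory Defs
  imports "HOL-Probability.Probability"
begin

record 'a ugraph =
  verts :: "'a set"
  edges :: "'a set set"

text \<open>
  Finite simple undirected graphs. As usual, a graph has at least one vertex; without this
  convention the minimum degree of the empty graph would be unspecified.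
\<close>

definition finite_graph :: "'a ugraph \<Rightarrow> bool" where
  "finite_graph G \<longleftrightarrow>
     finite (verts G) \<and> verts G \<noteq> {} \<and> (\<forall>e\<in>edges G. e \<subseteq> verts G \<and> card e = 2)"

definition degree :: "'a ugraph \<Rightarrow> 'a \<Rightarrow> nat" where
  "degree G v = card {e \<in> edges G. v \<in> e}"

definition min_degree :: "'a ugraph \<Rightarrow> nat" where
  "min_degree G = Min (degree G ` verts G)"

text \<open>A path is given by the list of its (distinct) vertices, so its length is one less than
  the length of that list.\<close>

definition is_path :: "'a ugraph \<Rightarrow> 'a list \<Rightarrow> bool" where
  "is_path G vs \<longleftrightarrow> vs \<noteq> [] \<and> set vs \<subseteq> verts G \<and> distinct vs \<and>
     successively (\<lambda>u v. {u, v} \<in> edges G) vs"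

definition path_length :: "'a list \<Rightarrow> nat" where
  "path_length vs = length vs - 1"

definition has_path_of_length :: "'a ugraph \<Rightarrow> nat \<Rightarrow> bool" where
  "has_path_of_length G l \<longleftrightarrow> (\<exists>vs. is_path G vs \<and> path_length vs = l)"

text \<open>The product distribution assigns to each edge an independent coin that is
  \<^term>\<open>True\<close> (the edge is kept) with probability \<open>p\<close>; outside the edge set the value is
  \<^term>\<open>False\<close> by default.\<close>

definition random_subgraph :: "'a ugraph \<Rightarrow> real \<Rightarrow> 'a ugraph pmf" where
  "random_subgraph G p =
     map_pmf (\<lambda>X. G\<lparr>edges := {e \<in> edges G. X e}\<rparr>)
       (Pi_pmf (edges G) False (\<lambda>_. bernoulli_pmf p))"

definition asymptotically_almost_surely :: "(nat \<Rightarrow> 'b pmf) \<Rightarrow> (nat \<Rightarrow> 'b \<Rightarrow> bool) \<Rightarrow> bool" where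
  "asymptotically_almost_surely M P \<longleftrightarrow>
     (\<lambda>k. measure_pmf.prob (M k) {x. P k x}) \<longlonglongrightarrow> 1"

end

theory Submission
  imports Defs "HOL-Real_Asymp.Real_Asymp"
begin

text \<open>
  Call a set \<open>W\<close> of at most \<open>k\<close> vertices a near-clique if each of its vertices has at least
  \<open>(1 - \<gamma>) k\<close> neighbours in \<open>W\<close>.

  If \<open>G\<close> has a near-clique, add to it the vertices adjacent to almost all of it. If this gives
  \<open>k + 1\<close> vertices, these span a Hamilton cycle of \<open>G\<^sub>p\<close>. Otherwise the enlarged set \<open>Z\<close> still spans a
  Hamilton cycle, each vertex of \<open>Z\<close> has a neighbour outside, and \<open>G - Z\<close> has minimum degree linear
  in \<open>k\<close>; so some edge of \<open>G\<^sub>p\<close> leaves \<open>Z\<close> to a vertex from which \<open>G\<^sub>p - Z\<close> contains a path on the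
  \<open>k + 1 - |Z|\<close> missing vertices.

  If \<open>G\<close> has no near-clique, expose \<open>G\<^sub>p\<close> in two rounds. Depth-first search in the first round gives
  a path on more than \<open>k\<close> vertices, or a path \<open>P\<close> and a dead vertex \<open>d\<close> that is adjacent in \<open>G\<close> to
  almost \<open>k\<close> vertices of \<open>P\<close>. In the second round, \<open>d\<close> is joined to vertices near both ends of
  \<open>P\<close>, so that almost all of \<open>P\<close> can be traversed by a path ending at any prescribed inner vertex. As
  \<open>P\<close> contains no near-clique, many inner vertices have neighbours off \<open>P\<close>, and the path is continued
  there: inside a subgraph of linear minimum degree, or, if many outside vertices are adjacent to
  almost all of \<open>P\<close>, by trading a short segment of \<open>P\<close> for a path that alternates between this
  segment and those vertices.
\<close>

section \<open>Random subsets of a finite set\<close>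

text \<open>Depth-first search from a single vertex \<open>y\<close> handles at most
  \<open>t + s\<close> vertices, both linear in \<open>k\<close>; its error depends on
  \<open>k\<close> alone, and every asymptotic lemma quantifies over the graph inside the filter, so
  that the threshold for \<open>k\<close> is uniform. Union bounds over vertices and vertex sets are
  confined to parts with at most \<open>k + 1\<close> vertices, where the Hamilton cycle is built.

  For the search and the rerouting a density \<open>\<rho> * ln k / k\<close> with any constant
  \<open>\<rho> > 0\<close> is enough: each failure there requires at least linearly many absent
  edges and so has probability at most a negative power of \<open>k\<close>. The factor
  \<open>1 + \<epsilon>\<close> is spent only on the minimum degree that a Hamilton cycle demands.

  Paths are found with a prescribed last vertex, because the pieces are glued together at that
  vertex.\<close>

definition random_subset :: "'e set \<Rightarrow> real \<Rightarrow> 'e set pmf" where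
  "random_subset E p = map_pmf (\<lambda>X. {e \<in> E. X e}) (Pi_pmf E False (\<lambda>_. bernoulli_pmf p))"

definition sprob :: "'e set \<Rightarrow> real \<Rightarrow> ('e set \<Rightarrow> bool) \<Rightarrow> real" where
  "sprob E p Q = measure_pmf.prob (random_subset E p) {F. Q F}"

lemma random_subset_empty [simp]: "random_subset {} p = return_pmf {}"
  by (simp add: random_subset_def)

lemma random_subset_insert:
  assumes "finite E" "e \<notin> E"
  shows "random_subset (insert e E) p =
    bind_pmf (bernoulli_pmf p) (\<lambda>b. map_pmf (\<lambda>F. if b then insert e F else F) (random_subset E p))"
proof -
  have *: "{x \<in> insert e E. (f(e := y)) x} = (if y then insert e {x \<in> E. f x} else {x \<in> E. f x})"
    for f :: "'a \<Rightarrow> bool" and y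
    using assms by (auto split: if_splits)
  show ?thesis
    unfolding random_subset_def Pi_pmf_insert'[OF assms]
    by (simp only: map_bind_pmf map_return_pmf *) (simp add: map_pmf_def bind_assoc_pmf bind_return_pmf)
qed

lemma set_random_subset: "finite E \<Longrightarrow> F \<in> set_pmf (random_subset E p) \<Longrightarrow> F \<subseteq> E"
  by (auto simp: random_subset_def)

lemma prob_bind_pmf:
  "measure_pmf.prob (bind_pmf M f) A = measure_pmf.expectation M (\<lambda>x. measure_pmf.prob (f x) A)"
proof -
  have "ennreal (measure_pmf.prob (bind_pmf M f) A) = (\<integral>\<^sup>+x. ennreal (measure_pmf.prob (f x) A) \<partial>M)"
    by (simp add: measure_pmf.emeasure_eq_measure[symmetric] emeasure_bind_pmf)
  also have "\<dots> = ennreal (measure_pmf.expectation M (\<lambda>x. measure_pmf.prob (f x) A))"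
    by (rule nn_integral_eq_integral)
      (auto intro!: measure_pmf.integrable_const_bound[where B = 1])
  finally show ?thesis
    by (subst (asm) ennreal_inj) (auto intro!: integral_nonneg)
qed

lemma sprob_empty [simp]: "sprob {} p Q = (if Q {} then 1 else 0)"
  by (simp add: sprob_def indicator_def)

lemma sprob_insert:
  assumes "finite E" "e \<notin> E" "p \<in> {0..1}"
  shows "sprob (insert e E) p Q = p * sprob E p (\<lambda>F. Q (insert e F)) + (1 - p) * sprob E p Q"
  using assms
  by (simp add: sprob_def random_subset_insert prob_bind_pmf measure_map_pmf vimage_def mult.commute)

lemma sprob_nonneg [simp]: "0 \<le> sprob E p Q"
  by (simp add: sprob_def)

lemma sprob_le_1 [simp]: "sprob E p Q \<le> 1"
  by (simp add: sprob_def)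

lemma sprob_mono:
  assumes "finite E" "\<And>F. F \<subseteq> E \<Longrightarrow> Q F \<Longrightarrow> Q' F"
  shows "sprob E p Q \<le> sprob E p Q'"
  unfolding sprob_def
  using assms set_random_subset[OF assms(1)]
  by (intro measure_pmf.finite_measure_mono_AE) (auto simp: AE_measure_pmf_iff)

lemma sprob_cong:
  assumes "finite E" "\<And>F. F \<subseteq> E \<Longrightarrow> Q F \<longleftrightarrow> Q' F"
  shows "sprob E p Q = sprob E p Q'"
  by (intro antisym sprob_mono assms(1)) (use assms(2) in auto)

lemma sprob_True [simp]: "sprob E p (\<lambda>_. True) = 1"
  by (simp add: sprob_def)

lemma sprob_False [simp]: "sprob E p (\<lambda>_. False) = 0"
  by (simp add: sprob_def)

lemma sprob_not: "sprob E p (\<lambda>F. \<not> Q F) = 1 - sprob E p Q"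
  using measure_pmf.prob_compl[of "{F. Q F}" "random_subset E p"]
  by (simp add: sprob_def Compl_eq_Diff_UNIV[symmetric] Collect_neg_eq)

lemma sprob_disj_le: "sprob E p (\<lambda>F. Q F \<or> Q' F) \<le> sprob E p Q + sprob E p Q'"
  unfolding sprob_def Collect_disj_eq by (rule measure_Un_le) auto

lemma sprob_conj_ge: "sprob E p (\<lambda>F. Q F \<and> Q' F) \<ge> sprob E p Q + sprob E p Q' - 1"
  using sprob_disj_le[of E p "\<lambda>F. \<not> Q F" "\<lambda>F. \<not> Q' F"] sprob_not[of E p "\<lambda>F. Q F \<and> Q' F"]
  by (simp add: sprob_not)

lemma sprob_Ex_le:
  assumes "finite I"
  shows "sprob E p (\<lambda>F. \<exists>i\<in>I. Q i F) \<le> (\<Sum>i\<in>I. sprob E p (Q i))"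
proof -
  have "{F. \<exists>i\<in>I. Q i F} = (\<Union>i\<in>I. {F. Q i F})" by auto
  then show ?thesis
    unfolding sprob_def by (simp add: assms measure_pmf.finite_measure_subadditive_finite)
qed

lemma sprob_Ex_le_const:
  assumes "finite I" "\<And>i. i \<in> I \<Longrightarrow> sprob E p (Q i) \<le> c"
  shows "sprob E p (\<lambda>F. \<exists>i\<in>I. Q i F) \<le> real (card I) * c"
  using sprob_Ex_le[OF assms(1), of E p Q] sum_bounded_above[of I "\<lambda>i. sprob E p (Q i)" c] assms(2)
  by simp

lemma sprob_subset_avoid:
  assumes "finite E" "p \<in> {0..1}" "A \<subseteq> E" "B \<subseteq> E" "A \<inter> B = {}"
  shows "sprob E p (\<lambda>F. A \<subseteq> F \<and> B \<inter> F = {}) = p ^ card A * (1 - p) ^ card B"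
  using assms
proof (induction E arbitrary: A B rule: finite_induct)
  case (insert e E)
  have "A \<subseteq> insert e F \<and> B \<inter> insert e F = {} \<longleftrightarrow> e \<notin> B \<and> A - {e} \<subseteq> F \<and> B \<inter> F = {}" for F
    by auto
  then have step: "sprob (insert e E) p (\<lambda>F. A \<subseteq> F \<and> B \<inter> F = {}) =
     p * sprob E p (\<lambda>F. e \<notin> B \<and> A - {e} \<subseteq> F \<and> B \<inter> F = {}) + (1 - p) * sprob E p (\<lambda>F. A \<subseteq> F \<and> B \<inter> F = {})"
    by (simp only: sprob_insert[OF insert.hyps insert.prems(1)])
  have IH: "sprob E p (\<lambda>F. A' \<subseteq> F \<and> B' \<inter> F = {}) = p ^ card A' * (1 - p) ^ card B'"
    if "A' \<subseteq> E" "B' \<subseteq> E" "A' \<inter> B' = {}" for A' B'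
    using insert.IH[OF insert.prems(1) that] .
  have fin: "finite A" "finite B" using insert.prems insert.hyps(1) by (auto intro: finite_subset)
  consider "e \<in> A" "e \<notin> B" | "e \<in> B" "e \<notin> A" | "e \<notin> A" "e \<notin> B" using insert.prems by blast
  then show ?case
  proof cases
    case 1
    have "sprob E p (\<lambda>F. A \<subseteq> F \<and> B \<inter> F = {}) = sprob E p (\<lambda>_. False)"
      by (rule sprob_cong[OF insert(1)]) (use 1 insert.hyps in auto)
    moreover have "sprob E p (\<lambda>F. A - {e} \<subseteq> F \<and> B \<inter> F = {}) = p ^ card (A - {e}) * (1 - p) ^ card B"
      by (rule IH) (use 1 insert.prems in auto)
    moreover have "card A = Suc (card (A - {e}))"
      using card.remove[OF fin(1) 1(1)] .
    ultimately show ?thesis using 1 by (simp add: step del: card_Diff_singleton card_Diff_insert)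
  next
    case 2
    have "sprob E p (\<lambda>F. A \<subseteq> F \<and> B \<inter> F = {}) = sprob E p (\<lambda>F. A \<subseteq> F \<and> (B - {e}) \<inter> F = {})"
      by (rule sprob_cong[OF insert(1)]) (use 2 insert.hyps in auto)
    moreover have "sprob E p (\<lambda>F. A \<subseteq> F \<and> (B - {e}) \<inter> F = {}) = p ^ card A * (1 - p) ^ card (B - {e})"
      by (rule IH) (use 2 insert.prems in auto)
    moreover have "card B = Suc (card (B - {e}))"
      using card.remove[OF fin(2) 2(1)] .
    ultimately show ?thesis using 2 by (simp add: step del: card_Diff_singleton card_Diff_insert)
  next
    case 3
    have "sprob E p (\<lambda>F. A \<subseteq> F \<and> B \<inter> F = {}) = p ^ card A * (1 - p) ^ card B"
      by (rule IH) (use 3 insert.prems in auto)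
    moreover have "A - {e} = A" using 3 by simp
    ultimately show ?thesis using 3 by (simp add: step algebra_simps)
  qed
qed auto

lemma sprob_avoid:
  assumes "finite E" "p \<in> {0..1}" "B \<subseteq> E"
  shows "sprob E p (\<lambda>F. B \<inter> F = {}) = (1 - p) ^ card B"
  using sprob_subset_avoid[OF assms(1,2), of "{}" B] assms by simp

section \<open>Independence, two-round exposure and coupling\<close>

lemma random_subset_Un:
  assumes "finite A" "finite B" "A \<inter> B = {}"
  shows "random_subset (A \<union> B) p =
    bind_pmf (random_subset A p) (\<lambda>F. map_pmf (\<lambda>F'. F \<union> F') (random_subset B p))"
  using assms
proof (induction A rule: finite_induct)
  case empty
  have "(\<union>) {} = (id :: 'a set \<Rightarrow> 'a set)" by auto
  then show ?case by (simp add: bind_return_pmf)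
next
  case (insert e A)
  have "random_subset (insert e A \<union> B) p = bind_pmf (bernoulli_pmf p) (\<lambda>b. map_pmf (\<lambda>F. if b then insert e F else F)
     (bind_pmf (random_subset A p) (\<lambda>F. map_pmf (\<lambda>F'. F \<union> F') (random_subset B p))))"
    using insert by (simp add: random_subset_insert)
  also have "\<dots> = bind_pmf (random_subset (insert e A) p) (\<lambda>F. map_pmf (\<lambda>F'. F \<union> F') (random_subset B p))"
    using insert
    by (simp add: random_subset_insert map_pmf_def bind_assoc_pmf bind_return_pmf)
       (auto intro!: bind_pmf_cong)
  finally show ?case .
qed

text \<open>An edge is absent from the union of two independent rounds iff both of its coins fail,
  which has probability \<open>(1 - a) * (1 - b)\<close>. This is how a density is split into
  rounds, the second of which is still fresh when the outcome of the first is fixed.\<close>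

lemma random_subset_sprinkle:
  assumes "finite E" "a \<in> {0..1}" "b \<in> {0..1}"
  shows "random_subset E (1 - (1 - a) * (1 - b)) =
    bind_pmf (random_subset E a) (\<lambda>F. map_pmf (\<lambda>F'. F \<union> F') (random_subset E b))"
  using assms(1)
proof (induction E rule: finite_induct)
  case empty
  have "(\<union>) {} = (id :: 'a set \<Rightarrow> 'a set)" by auto
  then show ?case by (simp add: bind_return_pmf)
next
  case (insert e E)
  have c: "1 - (1 - a) * (1 - b) \<in> {0..1}"
    using assms by (auto simp: mult_le_one)
  have bern: "bernoulli_pmf (1 - (1 - a) * (1 - b)) =
     bind_pmf (bernoulli_pmf a) (\<lambda>x. map_pmf (\<lambda>y. x \<or> y) (bernoulli_pmf b))"
  proof (rule pmf_eqI)
    fix i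
    have [simp]: "Collect ((\<or>) False) = {True}" "Collect ((\<or>) True) = UNIV" "Collect Not = {False}"
      by auto
    show "pmf (bernoulli_pmf (1 - (1 - a) * (1 - b))) i =
         pmf (bind_pmf (bernoulli_pmf a) (\<lambda>x. map_pmf (\<lambda>y. x \<or> y) (bernoulli_pmf b))) i"
      using assms c by (cases i) (simp_all add: pmf_bind pmf_map measure_pmf_single vimage_def algebra_simps)
  qed
  have "random_subset (insert e E) (1 - (1 - a) * (1 - b)) =
    bind_pmf (bernoulli_pmf a) (\<lambda>x. bind_pmf (bernoulli_pmf b) (\<lambda>y.
     bind_pmf (random_subset E a) (\<lambda>F. map_pmf (\<lambda>F'. if x \<or> y then insert e (F \<union> F') else F \<union> F') (random_subset E b))))"
    using insert
    by (simp add: random_subset_insert bern map_pmf_def bind_assoc_pmf bind_return_pmf)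
  \<comment> \<open>The second-round coin of \<open>e\<close> is moved past the first round on
    \<open>E\<close>; the draws are then grouped by round and no longer by edge.\<close>
  also have "\<dots> = bind_pmf (bernoulli_pmf a) (\<lambda>x. 
     bind_pmf (random_subset E a) (\<lambda>F. bind_pmf (bernoulli_pmf b) (\<lambda>y. map_pmf (\<lambda>F'. if x \<or> y then insert e (F \<union> F') else F \<union> F') (random_subset E b))))"
    by (subst bind_commute_pmf) simp
  also have "\<dots> = bind_pmf (random_subset (insert e E) a) (\<lambda>F. map_pmf (\<lambda>F'. F \<union> F') (random_subset (insert e E) b))"
    using insert
    by (simp add: random_subset_insert map_pmf_def bind_assoc_pmf bind_return_pmf)
      (intro bind_pmf_cong refl, auto)
  finally show ?case .
qed

text \<open>The inner probability is at least \<open>1 - e\<close> on \<open>Q\<close> and at least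
  \<open>0\<close> elsewhere, hence never below the indicator of \<open>Q\<close> minus
  \<open>e\<close>; this is integrated.\<close>

lemma prob_bind_ge:
  assumes "measure_pmf.prob M {x. Q x} \<ge> 1 - d"
    and "\<And>x. x \<in> set_pmf M \<Longrightarrow> Q x \<Longrightarrow> measure_pmf.prob (f x) A \<ge> 1 - e" "e \<ge> 0"
  shows "measure_pmf.prob (bind_pmf M f) A \<ge> 1 - d - e"
proof -
  have "1 - d - e \<le> measure_pmf.prob M {x. Q x} - e" using assms(1) by simp
  also have "\<dots> = measure_pmf.expectation M (\<lambda>x. indicator {x. Q x} x - e)"
    by (subst Bochner_Integration.integral_diff)
      (auto intro!: measure_pmf.integrable_const_bound[where B = 1] simp: indicator_def)
  also have "\<dots> \<le> measure_pmf.expectation M (\<lambda>x. measure_pmf.prob (f x) A)"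
  proof (rule integral_mono_AE)
    show "integrable M (\<lambda>x. indicator {x. Q x} x - e)"
      by (rule Bochner_Integration.integrable_diff) (auto intro!: measure_pmf.integrable_const_bound[where B = 1] simp: indicator_def)
    show "integrable M (\<lambda>x. measure_pmf.prob (f x) A)"
      by (auto intro!: measure_pmf.integrable_const_bound[where B = 1])
    show "AE x in M. indicator {x. Q x} x - e \<le> measure_pmf.prob (f x) A"
      using assms(2,3) by (auto simp: AE_measure_pmf_iff indicator_def intro: order_trans[of "-e" 0])
  qed
  finally show ?thesis by (simp add: prob_bind_pmf)
qed

lemma sprob_sprinkle_ge:
  assumes "finite E" "a \<in> {0..1}" "b \<in> {0..1}" "e \<ge> 0" "sprob E a Q1 \<ge> 1 - d"
    and "\<And>F. F \<subseteq> E \<Longrightarrow> Q1 F \<Longrightarrow> sprob E b (\<lambda>F'. Q (F \<union> F')) \<ge> 1 - e"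
  shows "sprob E (1 - (1 - a) * (1 - b)) Q \<ge> 1 - d - e"
  unfolding sprob_def random_subset_sprinkle[OF assms(1-3)]
  by (rule prob_bind_ge[where Q = Q1])
    (use assms set_random_subset[OF assms(1)] in \<open>auto simp: sprob_def measure_map_pmf vimage_def\<close>)

lemma sprob_Un_ge:
  assumes "finite A" "finite B" "A \<inter> B = {}" "e \<ge> 0" "sprob A p Q1 \<ge> 1 - d"
    and "\<And>F. F \<subseteq> A \<Longrightarrow> Q1 F \<Longrightarrow> sprob B p (\<lambda>F'. Q (F \<union> F')) \<ge> 1 - e"
  shows "sprob (A \<union> B) p Q \<ge> 1 - d - e"
  unfolding sprob_def random_subset_Un[OF assms(1-3)]
  by (rule prob_bind_ge[where Q = Q1])
    (use assms set_random_subset[OF assms(1)] in \<open>auto simp: sprob_def measure_map_pmf vimage_def\<close>)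

lemma sprob_restrict:
  assumes "finite E" "A \<subseteq> E"
  shows "sprob E p (\<lambda>F. Q (F \<inter> A)) = sprob A p Q"
proof -
  define B where "B = E - A"
  have E: "E = A \<union> B" "A \<inter> B = {}" "finite A" "finite B"
    using assms by (auto simp: B_def intro: finite_subset)
  have "map_pmf (\<lambda>F. F \<inter> A) (random_subset (A \<union> B) p) = 
     bind_pmf (random_subset A p) (\<lambda>F. bind_pmf (random_subset B p) (\<lambda>F'. return_pmf F))"
    unfolding random_subset_Un[OF E(3,4,2)] map_bind_pmf pmf.map_comp
    unfolding map_pmf_def
  proof (intro bind_pmf_cong refl)
    fix F F' assume "F \<in> set_pmf (random_subset A p)" "F' \<in> set_pmf (random_subset B p)"
    then have "F \<subseteq> A" "F' \<subseteq> B" using E set_random_subset by blast+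
    then have "(F \<union> F') \<inter> A = F" using E(2) by blast
    then show "return_pmf (((\<lambda>F. F \<inter> A) \<circ> (\<union>) F) F') = return_pmf F" by simp
  qed
  then have *: "map_pmf (\<lambda>F. F \<inter> A) (random_subset E p) = random_subset A p"
    by (simp add: E bind_return_pmf')
  show ?thesis
    unfolding sprob_def *[symmetric] by (simp add: measure_map_pmf vimage_def)
qed

text \<open>Coupling by sprinkling: a further round of density \<open>b\<close>, chosen so that the
  union has density \<open>p'\<close>, can only help an increasing event. The formula for
  \<open>b\<close> divides by \<open>1 - p\<close>, hence the separate case
  \<open>p = 1\<close>.\<close>

lemma sprob_mono_p:
  assumes "finite E" "0 \<le> p" "p \<le> p'" "p' \<le> 1"
    and "\<And>F F'. Q F \<Longrightarrow> F \<subseteq> F' \<Longrightarrow> F' \<subseteq> E \<Longrightarrow> Q F'"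
  shows "sprob E p Q \<le> sprob E p' Q"
proof (cases "p = 1")
  case False
  define b where "b = 1 - (1 - p') / (1 - p)"
  have b: "b \<in> {0..1}" "p' = 1 - (1 - p) * (1 - b)"
    using assms False by (auto simp: b_def field_simps)
  have "sprob E (1 - (1 - p) * (1 - b)) Q \<ge> 1 - (1 - sprob E p Q) - 0"
  proof (rule sprob_sprinkle_ge)
    fix F assume "F \<subseteq> E" "Q F"
    then have "sprob E b (\<lambda>F'. Q (F \<union> F')) = sprob E b (\<lambda>_. True)"
      by (intro sprob_cong assms) (auto intro: assms(5))
    then show "sprob E b (\<lambda>F'. Q (F \<union> F')) \<ge> 1 - 0" by simp
  qed (use assms b in auto)
  then show ?thesis using b by simp
qed (use assms in auto)

text \<open>Chernoff bound for the lower tail with a free parameter: the right-hand side is the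
  expectation of \<open>x ^ card F\<close>, and \<open>x ^ r \<le> x ^ card F\<close> whenever
  \<open>card F \<le> r\<close>. Induction on \<open>E\<close>, conditioning on one edge, takes the
  place of integration.\<close>

lemma sprob_card_le:
  assumes "finite E" "p \<in> {0..1}" "x > 0" "x \<le> 1"
  shows "sprob E p (\<lambda>F. card F \<le> r) * x ^ r \<le> (1 - p + p * x) ^ card E"
  using assms(1)
proof (induction E arbitrary: r rule: finite_induct)
  case empty
  then show ?case using assms by (simp add: power_le_one)
next
  case (insert e E)
  have [simp]: "sprob E p (\<lambda>F. card (insert e F) \<le> r) = (if r = 0 then 0 else sprob E p (\<lambda>F. card F \<le> r - 1))"
  proof -
    have "card (insert e F) = Suc (card F)" if "F \<subseteq> E" for F
      using that insert.hyps finite_subset by (subst card_insert_disjoint) blast+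
    then have "sprob E p (\<lambda>F. card (insert e F) \<le> r) = sprob E p (\<lambda>F. Suc (card F) \<le> r)"
      by (intro sprob_cong insert.hyps) simp
    also have "\<dots> = (if r = 0 then 0 else sprob E p (\<lambda>F. card F \<le> r - 1))"
      by (cases r) simp_all
    finally show ?thesis .
  qed
  have "sprob (insert e E) p (\<lambda>F. card F \<le> r) * x ^ r =
    p * ((if r = 0 then 0 else sprob E p (\<lambda>F. card F \<le> r - 1)) * x ^ r) + (1 - p) * (sprob E p (\<lambda>F. card F \<le> r) * x ^ r)"
    using insert.hyps assms by (simp add: sprob_insert algebra_simps)
  also have "\<dots> \<le> p * (x * (1 - p + p * x) ^ card E) + (1 - p) * (1 - p + p * x) ^ card E"
  proof (intro add_mono mult_left_mono insert.IH)
    show "(if r = 0 then 0 else sprob E p (\<lambda>F. card F \<le> r - 1)) * x ^ r \<le> x * (1 - p + p * x) ^ card E"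
    proof (cases r)
      case 0
      then show ?thesis using assms by simp
    next
      case (Suc s)
      have "x * (sprob E p (\<lambda>F. card F \<le> s) * x ^ s) \<le> x * (1 - p + p * x) ^ card E"
        by (intro mult_left_mono insert.IH) (use assms in auto)
      then show ?thesis using Suc by (simp add: algebra_simps)
    qed
  qed (use assms in auto)
  also have "\<dots> = (1 - p + p * x) ^ card (insert e E)"
    using insert.hyps by (simp add: algebra_simps)
  finally show ?case .
qed

text \<open>The same exponential moment, now with \<open>x \<ge> 1\<close>, for the upper tail. The
  truncated difference \<open>r - 1\<close> is harmless at \<open>r = 0\<close>, where both events
  are certain.\<close>

lemma sprob_card_ge:
  assumes "finite E" "p \<in> {0..1}" "x \<ge> 1"
  shows "sprob E p (\<lambda>F. card F \<ge> r) * x ^ r \<le> (1 - p + p * x) ^ card E"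
  using assms(1)
proof (induction E arbitrary: r rule: finite_induct)
  case empty
  then show ?case by (cases r) auto
next
  case (insert e E)
  have [simp]: "sprob E p (\<lambda>F. card (insert e F) \<ge> r) = sprob E p (\<lambda>F. card F \<ge> r - 1)"
  proof -
    have "card (insert e F) = Suc (card F)" if "F \<subseteq> E" for F
      using that insert.hyps finite_subset by (subst card_insert_disjoint) blast+
    then show ?thesis
      by (intro sprob_cong insert.hyps) auto
  qed
  have "sprob (insert e E) p (\<lambda>F. card F \<ge> r) * x ^ r =
    p * (sprob E p (\<lambda>F. card F \<ge> r - 1) * x ^ r) + (1 - p) * (sprob E p (\<lambda>F. card F \<ge> r) * x ^ r)"
    using insert.hyps assms by (simp add: sprob_insert algebra_simps)
  also have "\<dots> \<le> p * (x * (1 - p + p * x) ^ card E) + (1 - p) * (1 - p + p * x) ^ card E"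
  proof (intro add_mono mult_left_mono insert.IH)
    show "sprob E p (\<lambda>F. card F \<ge> r - 1) * x ^ r \<le> x * (1 - p + p * x) ^ card E"
    proof (cases r)
      case 0
      have "1 * 1 \<le> x * (1 - p + p * x) ^ card E"
      proof (rule mult_mono)
        have "p * 1 \<le> p * x" using assms by (intro mult_left_mono) auto
        then show "1 \<le> (1 - p + p * x) ^ card E" by (intro one_le_power) simp
      qed (use assms in auto)
      then show ?thesis using 0 by simp
    next
      case (Suc s)
      have "x * (sprob E p (\<lambda>F. card F \<ge> s) * x ^ s) \<le> x * (1 - p + p * x) ^ card E"
        by (intro mult_left_mono insert.IH) (use assms in auto)
      then show ?thesis using Suc by (simp add: algebra_simps)
    qed
  qed (use assms in auto)
  also have "\<dots> = (1 - p + p * x) ^ card (insert e E)"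
    using insert.hyps by (simp add: algebra_simps)
  finally show ?case .
qed

text \<open>Markov's inequality for the number of bad indices, whose expectation is at most
  \<open>card Z * c\<close>. The events \<open>Q z\<close> may depend on each other in any way;
  later they concern paths in one and the same random graph.\<close>

lemma sprob_many_bad:
  assumes "finite E" "finite Z" "Z \<noteq> {}" "\<And>z. z \<in> Z \<Longrightarrow> sprob E p (Q z) \<le> c"
  shows "sprob E p (\<lambda>F. 2 * card {z \<in> Z. Q z F} \<ge> card Z) \<le> 2 * c"
proof -
  let ?M = "random_subset E p"
  have int: "integrable ?M (\<lambda>F. indicator {F. Q z F} F :: real)" for z
    by (auto intro!: measure_pmf.integrable_const_bound[where B = 1] simp: indicator_def)
  have "real (card Z) * sprob E p (\<lambda>F. 2 * card {z \<in> Z. Q z F} \<ge> card Z) =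
      measure_pmf.expectation ?M (\<lambda>F. real (card Z) * indicator {F. 2 * card {z \<in> Z. Q z F} \<ge> card Z} F)"
    by (simp add: sprob_def)
  also have "\<dots> \<le> measure_pmf.expectation ?M (\<lambda>F. 2 * (\<Sum>z\<in>Z. indicator {F. Q z F} F))"
  proof (rule integral_mono)
    show "integrable ?M (\<lambda>F. real (card Z) * indicator {F. 2 * card {z \<in> Z. Q z F} \<ge> card Z} F)"
      by (auto intro!: measure_pmf.integrable_const_bound[where B = "card Z"] simp: indicator_def)
    show "integrable ?M (\<lambda>F. 2 * (\<Sum>z\<in>Z. indicator {F. Q z F} F :: real))"
      by (intro integrable_mult_right Bochner_Integration.integrable_sum int)
    fix F
    have "(\<Sum>z\<in>Z. indicator {F. Q z F} F :: real) = card {z \<in> Z. Q z F}"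
      by (simp add: indicator_def sum.If_cases assms Int_def)
    then show "real (card Z) * indicator {F. 2 * card {z \<in> Z. Q z F} \<ge> card Z} F \<le> 2 * (\<Sum>z\<in>Z. indicator {F. Q z F} F)"
      by (auto simp: indicator_def)
  qed
  also have "\<dots> = 2 * (\<Sum>z\<in>Z. sprob E p (Q z))"
    by (simp add: int sprob_def Bochner_Integration.integral_sum)
  also have "\<dots> \<le> 2 * (card Z * c)"
    using sum_bounded_above[of Z "\<lambda>z. sprob E p (Q z)" c] assms by simp
  finally have "real (card Z) * sprob E p (\<lambda>F. 2 * card {z \<in> Z. Q z F} \<ge> card Z) \<le> real (card Z) * (2 * c)"
    by simp
  moreover have "card Z > 0" using assms by (simp add: card_gt_0_iff)
  ultimately show ?thesis by (simp add: mult_le_cancel_left)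
qed

section \<open>Depth-first search in a random subgraph\<close>

definition simple_graph :: "'a set \<Rightarrow> 'a set set \<Rightarrow> bool" where
  "simple_graph V E \<longleftrightarrow> finite V \<and> (\<forall>e\<in>E. e \<subseteq> V \<and> card e = 2)"

definition nbrs :: "'a set set \<Rightarrow> 'a \<Rightarrow> 'a set" where
  "nbrs E v = {u. {v, u} \<in> E}"

definition lpath :: "'a set set \<Rightarrow> 'a list \<Rightarrow> bool" where
  "lpath F vs \<longleftrightarrow> distinct vs \<and> successively (\<lambda>u v. {u, v} \<in> F) vs"

definition cut :: "'a set set \<Rightarrow> 'a set \<Rightarrow> 'a set \<Rightarrow> 'a set set" where
  "cut E A B = {e \<in> E. \<exists>a\<in>A. \<exists>b\<in>B. e = {a, b}}"

lemma simple_graph_finite: "simple_graph V E \<Longrightarrow> finite V" "simple_graph V E \<Longrightarrow> finite E"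
proof -
  show "finite V" if "simple_graph V E" using that by (simp add: simple_graph_def)
  show "finite E" if "simple_graph V E"
    by (rule finite_subset[of _ "Pow V"]) (use that in \<open>auto simp: simple_graph_def\<close>)
qed

lemma simple_graph_subset: "simple_graph V E \<Longrightarrow> F \<subseteq> E \<Longrightarrow> simple_graph V F"
  by (auto simp: simple_graph_def)

lemma nbrs_subset: "simple_graph V E \<Longrightarrow> nbrs E v \<subseteq> V"
  by (auto simp: simple_graph_def nbrs_def)

lemma nbrs_irrefl: "simple_graph V E \<Longrightarrow> v \<notin> nbrs E v"
  by (auto simp: simple_graph_def nbrs_def dest: bspec)

lemma finite_nbrs: "simple_graph V E \<Longrightarrow> finite (nbrs E v)"
  using nbrs_subset simple_graph_finite(1) finite_subset by metis

lemma nbrs_mono: "E \<subseteq> F \<Longrightarrow> nbrs E v \<subseteq> nbrs F v"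
  by (auto simp: nbrs_def)

lemma lpath_mono: "lpath F vs \<Longrightarrow> F \<subseteq> F' \<Longrightarrow> lpath F' vs"
  unfolding lpath_def by (auto elim: successively_mono)

lemma lpath_Nil [simp]: "lpath F []"
  by (simp add: lpath_def)

lemma lpath_single [simp]: "lpath F [x]"
  by (simp add: lpath_def)

lemma lpath_Cons: "lpath F (x # xs) \<longleftrightarrow> x \<notin> set xs \<and> lpath F xs \<and> (xs \<noteq> [] \<longrightarrow> {x, hd xs} \<in> F)"
  by (cases xs) (auto simp: lpath_def)

lemma lpath_append:
  "lpath F (xs @ ys) \<longleftrightarrow> lpath F xs \<and> lpath F ys \<and> set xs \<inter> set ys = {} \<and>
     (xs \<noteq> [] \<longrightarrow> ys \<noteq> [] \<longrightarrow> {last xs, hd ys} \<in> F)"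
  by (auto simp: lpath_def successively_append_iff)

lemma lpath_rev [simp]: "lpath F (rev xs) \<longleftrightarrow> lpath F xs"
  by (simp add: lpath_def insert_commute)

lemma card_cut:
  assumes "simple_graph V E" "finite A" "A \<inter> B = {}"
  shows "card (cut E A B) = (\<Sum>a\<in>A. card (nbrs E a \<inter> B))"
proof -
  have "inj_on (\<lambda>(a, b). {a, b}) (SIGMA a:A. nbrs E a \<inter> B)"
    using assms(3) by (auto simp: inj_on_def doubleton_eq_iff)
  moreover have "(\<lambda>(a, b). {a, b}) ` (SIGMA a:A. nbrs E a \<inter> B) = cut E A B"
    by (force simp: cut_def nbrs_def)
  ultimately have "card (cut E A B) = card (SIGMA a:A. nbrs E a \<inter> B)"
    by (metis card_image)
  also have "\<dots> = (\<Sum>a\<in>A. card (nbrs E a \<inter> B))"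
    by (rule card_SigmaI) (use assms finite_nbrs[OF assms(1)] in auto)
  finally show ?thesis .
qed

text \<open>The outcomes at which the search, started at \<open>y\<close>, may stop. In the second
  one the cut is taken in the host graph \<open>E\<close>: every edge from a dead to an unseen
  vertex has been queried and rejected, so \<open>B\<close> or more such edges would be
  \<open>B\<close> rejected queries, which is unlikely. The stack \<open>P\<close> may have become
  empty.\<close>

definition dfs_good :: "'a set \<Rightarrow> 'a set set \<Rightarrow> 'a \<Rightarrow> nat \<Rightarrow> nat \<Rightarrow> nat \<Rightarrow> 'a set set \<Rightarrow> bool" where
  "dfs_good V E y s t B F \<longleftrightarrow>
     (\<exists>P. lpath F P \<and> P \<noteq> [] \<and> last P = y \<and> set P \<subseteq> V \<and> s \<le> length P) \<or>
     (\<exists>P D. lpath F P \<and> (P \<noteq> [] \<longrightarrow> last P = y) \<and> set P \<subseteq> V \<and> D \<subseteq> V \<and> D \<inter> set P = {} \<and>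
        card D = t \<and> length P < s \<and> card (cut E D (V - D - set P)) < B)"

text \<open>\<open>P\<close> is the stack, \<open>D\<close> the set of dead vertices, \<open>A\<close> and \<open>N\<close> are the edges queried with positive
  and negative answer. A state with \<open>a\<close> positive and \<open>b\<close> negative answers is
  \<open>2 ^ a * ((1 - p) / (1 - p / 2)) ^ b\<close> times as likely under \<open>p\<close> as under \<open>p / 2\<close>, and
  \<open>1 - p \<le> (1 - p / 2)\<^sup>2\<close>; hence the weight \<open>2 ^ a * q ^ b\<close>.\<close>

lemma dfs_state_bound:
  fixes V :: "'a set"
  assumes G: "simple_graph V E" and p: "p \<in> {0..1}" and q: "q = 1 - p / 2"
    and dm: "\<And>v. v \<in> V \<Longrightarrow> dm \<le> card (nbrs E v)" and "2 * q ^ (dm - t) \<le> 1" and s: "1 \<le> s"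
    and M: "2 ^ (t + s) * q ^ B \<le> M" "q ^ (dm - t) \<le> M"
    and "A \<subseteq> E" "N \<subseteq> E" "A \<inter> N = {}"
    and "lpath A P" "P \<noteq> [] \<longrightarrow> last P = y" "set P \<subseteq> V" "D \<subseteq> V" "D \<inter> set P = {}" "D \<union> set P \<noteq> {}"
    and "\<And>e. e \<in> A \<Longrightarrow> e \<subseteq> D \<union> set P"
    and "cut E D (V - D - set P) \<subseteq> N"
    and "card A < card D + length P" "card D \<le> t" "length P \<le> s"
  shows "sprob (E - A - N) p (\<lambda>F. \<not> dfs_good V E y s t B (A \<union> F)) * 2 ^ card A * q ^ card N \<le> M"
  using assms(9-)
\<comment> \<open>A query uses up one edge and pushes at most one vertex, a pop shortens the stack;
  the factor \<open>2\<close> makes the measure decrease in either case.\<close>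
proof (induction "2 * card (E - A - N) + length P" arbitrary: A N P D rule: less_induct)
  case less
  note prems = less.prems
  have q01: "q \<ge> 1/2" "q \<le> 1" "q > 0" using p by (auto simp: q)
  have fin: "finite V" "finite E" "finite D" "finite A" "finite N"
    using simple_graph_finite[OF G] prems finite_subset by metis+
  have M0: "M \<ge> 0" using M(2) q01 by (meson order_trans zero_le_power less_imp_le)
  consider (long) "length P = s" | (full) "length P < s" "card D = t"
    | (empty) "length P < s" "card D < t" "P = []" | (step) "length P < s" "card D < t" "P \<noteq> []"
    using prems by linarith
  then show ?case
  proof cases
    case long
    have "dfs_good V E y s t B (A \<union> F)" for F
      unfolding dfs_good_def
      by (rule disjI1, rule exI[of _ P]) (use long s prems lpath_mono[of A P "A \<union> F"] in auto)
    then show ?thesis using M0 by simp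
  next
    case full
    show ?thesis
    proof (cases "card (cut E D (V - D - set P)) < B")
      case True
      have "dfs_good V E y s t B (A \<union> F)" for F
        unfolding dfs_good_def
        by (rule disjI2, rule exI[of _ P], rule exI[of _ D])
          (use full s prems True lpath_mono[of A P "A \<union> F"] in auto)
      then show ?thesis using M0 by simp
    next
      case False
      \<comment> \<open>All edges of the cut were rejected, so \<open>N\<close> is large, while
        \<open>A\<close> is small because each positive answer discovers a new vertex.\<close>
      then have "B \<le> card N"
        using prems(11) card_mono[OF fin(5) prems(11)] by linarith
      then have qq: "q ^ card N \<le> q ^ B" using q01 by (intro power_decreasing) auto
      have "card A \<le> t + s" using prems full by linarith
      then have "(2::real) ^ card A \<le> 2 ^ (t + s)" by (intro power_increasing) auto
      then have "sprob (E - A - N) p (\<lambda>F. \<not> dfs_good V E y s t B (A \<union> F)) * 2 ^ card A * q ^ card N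
         \<le> 1 * 2 ^ (t + s) * q ^ B"
        by (intro mult_mono qq) (use q01 in auto)
      then show ?thesis using M(1) by simp
    qed
  next
    case empty
    have Dne: "D \<noteq> {}" using prems empty by simp
    \<comment> \<open>The stack is empty: the \<open>m\<close> dead vertices were found with at most
      \<open>m - 1\<close> positive answers, and each of them has at least \<open>dm - t\<close>
      rejected edges leaving \<open>D\<close>. The weight is at most
      \<open>(2 * q ^ (dm - t)) ^ (m - 1) * q ^ (dm - t)\<close>, where the bracket is at most
      \<open>1\<close>.\<close>
    define m where "m = card D"
    have m1: "m \<ge> 1" using Dne fin by (simp add: m_def Suc_le_eq card_gt_0_iff)
    have "dm - t \<le> card (nbrs E d \<inter> (V - D))" if "d \<in> D" for d
    proof -
      have "nbrs E d \<subseteq> (nbrs E d \<inter> (V - D)) \<union> D"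
        using nbrs_subset[OF G] by auto
      then have "card (nbrs E d) \<le> card (nbrs E d \<inter> (V - D)) + card D"
        using fin by (meson card_Un_le card_mono finite_Diff finite_Int finite_UnI order_trans)
      then show ?thesis using dm[of d] that prems empty by auto
    qed
    then have "m * (dm - t) \<le> (\<Sum>d\<in>D. card (nbrs E d \<inter> (V - D)))"
      unfolding m_def using sum_bounded_below[of D "dm - t" "\<lambda>d. card (nbrs E d \<inter> (V - D))"] by simp
    also have "\<dots> = card (cut E D (V - D))"
      by (rule card_cut[OF G, symmetric]) (use fin in auto)
    also have "\<dots> \<le> card N" using prems empty fin by (intro card_mono) auto
    finally have "q ^ card N \<le> q ^ (m * (dm - t))" using q01 by (intro power_decreasing) auto
    moreover have "(2::real) ^ card A \<le> 2 ^ (m - 1)"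
      using prems empty by (intro power_increasing) (auto simp: m_def)
    ultimately have "sprob (E - A - N) p (\<lambda>F. \<not> dfs_good V E y s t B (A \<union> F)) * 2 ^ card A * q ^ card N
         \<le> 1 * 2 ^ (m - 1) * q ^ (m * (dm - t))"
      by (intro mult_mono) (use q01 in auto)
    also have "\<dots> = (2 * q ^ (dm - t)) ^ (m - 1) * q ^ (dm - t)"
    proof -
      obtain m' where m': "m = Suc m'" using m1 by (cases m) auto
      show ?thesis by (simp add: m' power_mult_distrib power_mult[symmetric] power_add mult.commute)
    qed
    also have "\<dots> \<le> 1 * q ^ (dm - t)"
      by (intro mult_right_mono power_le_one) (use assms(5) q01 in auto)
    finally show ?thesis using M(2) by simp
  next
    case step
    then obtain u P' where P: "P = u # P'" by (cases P) auto
    show ?thesis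
    proof (cases "\<exists>w \<in> V - D - set P. {u, w} \<in> E - A - N")
      case True
      then obtain w where w: "w \<in> V" "w \<notin> D" "w \<notin> set P" "{u, w} \<in> E - A - N" by blast
      define e where "e = {u, w}"
      define R where "R = E - A - N - {e}"
      have R: "E - A - N = insert e R" "e \<notin> R" "finite R" "E - insert e A - N = R" "E - A - insert e N = R"
        using w fin by (auto simp: R_def e_def)
      have cR: "card (E - A - N) = Suc (card R)" using R by simp
      have e: "e \<in> E" "e \<notin> A" "e \<notin> N" using w by (auto simp: e_def)
      have 1: "sprob (E - insert e A - N) p (\<lambda>F. \<not> dfs_good V E y s t B (insert e A \<union> F)) * 2 ^ card (insert e A) * q ^ card N \<le> M"
      proof (rule less.hyps[of "insert e A" N "w # P" D])
        show "2 * card (E - insert e A - N) + length (w # P) < 2 * card (E - A - N) + length P"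
          using R cR by simp
        show "lpath (insert e A) (w # P)"
          using prems(4) w lpath_mono[of A P "insert e A"]
          by (auto simp: lpath_Cons P e_def insert_commute)
        show "cut E D (V - D - set (w # P)) \<subseteq> N"
          using prems(11) by (auto simp: cut_def)
        show "f \<subseteq> D \<union> set (w # P)" if "f \<in> insert e A" for f
          using that prems(10)[of f] by (auto simp: e_def P)
        show "card (insert e A) < card D + length (w # P)" using e fin prems(12) by simp
      qed (use prems w step e P in auto)
      have 2: "sprob (E - A - insert e N) p (\<lambda>F. \<not> dfs_good V E y s t B (A \<union> F)) * 2 ^ card A * q ^ card (insert e N) \<le> M"
        by (rule less.hyps[of A "insert e N" P D])
          (use prems w step e P R cR in auto)
      have eq: "sprob (E - A - N) p (\<lambda>F. \<not> dfs_good V E y s t B (A \<union> F)) =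
         p * sprob R p (\<lambda>F. \<not> dfs_good V E y s t B (insert e A \<union> F)) +
         (1 - p) * sprob R p (\<lambda>F. \<not> dfs_good V E y s t B (A \<union> F))"
        unfolding R(1) by (subst sprob_insert[OF R(3,2) p]) simp
      have "sprob (E - A - N) p (\<lambda>F. \<not> dfs_good V E y s t B (A \<union> F)) * 2 ^ card A * q ^ card N =
         p / 2 * (sprob (E - insert e A - N) p (\<lambda>F. \<not> dfs_good V E y s t B (insert e A \<union> F)) * 2 ^ card (insert e A) * q ^ card N) +
         (1 - p) / q * (sprob (E - A - insert e N) p (\<lambda>F. \<not> dfs_good V E y s t B (A \<union> F)) * 2 ^ card A * q ^ card (insert e N))"
      proof -
        have alg: "(p * x + (1 - p) * x') * a * c = p / 2 * (x * (2 * a) * c) + (1 - p) / q * (x' * a * (q * c))"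
          for x x' a c :: real
          using q01 by (simp add: field_simps)
        show ?thesis
          using e fin by (simp only: eq R(4,5) card_insert_disjoint not_False_eq_True power_Suc alg)
      qed
      also have "\<dots> \<le> p / 2 * M + (1 - p) / q * M"
        by (intro add_mono mult_left_mono 1 2) (use p q01 in auto)
      also have "\<dots> = (p / 2 + (1 - p) / q) * M" by (simp add: algebra_simps)
      also have "\<dots> \<le> 1 * M"
      proof (rule mult_right_mono)
        have "1 - p \<le> (1 - p / 2) * q" by (simp add: q field_simps power2_eq_square)
        then have "(1 - p) / q \<le> 1 - p / 2" using q01 by (simp add: divide_le_eq)
        then show "p / 2 + (1 - p) / q \<le> 1" by simp
      qed (rule M0)
      finally show ?thesis by simp
    next
      case False
      \<comment> \<open>The top \<open>u\<close> has no query left and is declared dead. Its edges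
        to unseen vertices cannot be positive, since edges of \<open>A\<close> stay inside
        \<open>D \<union> set P\<close>; so they all lie in \<open>N\<close>.\<close>
      show ?thesis
      proof (rule less.hyps[of A N P' "insert u D"])
        show "lpath A P'" using prems(4) by (simp add: P lpath_Cons)
        show "cut E (insert u D) (V - insert u D - set P') \<subseteq> N"
        proof
          fix f assume "f \<in> cut E (insert u D) (V - insert u D - set P')"
          then obtain a b where ab: "f = {a, b}" "f \<in> E" "a \<in> insert u D" "b \<in> V - D - set P"
            by (auto simp: cut_def P)
          have "f \<notin> A" using prems(10)[of f] ab by auto
          then show "f \<in> N" using ab prems(11) False by (auto simp: cut_def)
        qed
        show "insert u D \<inter> set P' = {}" using prems(4,8) by (auto simp: P lpath_Cons)
        have "u \<notin> D" using prems(8) P by auto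
        then show "card A < card (insert u D) + length P'" "card (insert u D) \<le> t"
          using prems(12) step fin by (auto simp: P)
      qed (use prems P in auto)
    qed
  qed
qed

definition dead_end :: "'a set \<Rightarrow> 'a set set \<Rightarrow> 'a \<Rightarrow> nat \<Rightarrow> real \<Rightarrow> 'a set set \<Rightarrow> bool" where
  "dead_end V E y s r F \<longleftrightarrow> (\<exists>P d. lpath F P \<and> (P \<noteq> [] \<longrightarrow> last P = y) \<and> set P \<subseteq> V \<and> length P < s \<and>
     d \<in> V \<and> d \<notin> set P \<and> r \<le> real (card (nbrs E d \<inter> set P)))"

definition long_path :: "'a set \<Rightarrow> 'a \<Rightarrow> nat \<Rightarrow> 'a set set \<Rightarrow> bool" where
  "long_path V y s F \<longleftrightarrow> (\<exists>P. lpath F P \<and> P \<noteq> [] \<and> last P = y \<and> set P \<subseteq> V \<and> s \<le> length P)"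

lemma dead_end_mono: "dead_end V E y s r F \<Longrightarrow> r' \<le> r \<Longrightarrow> dead_end V E y s r' F"
  unfolding dead_end_def by (blast intro: order_trans)

text \<open>Averaging over the \<open>t\<close> dead vertices: if together they send fewer than
  \<open>t * b\<close> edges to unseen vertices, some \<open>d\<close> sends fewer than
  \<open>b\<close>. At most \<open>t\<close> neighbours of \<open>d\<close> are dead, so the other
  \<open>dm - t - b\<close> or more lie on \<open>P\<close>.\<close>

lemma sprob_dfs:
  fixes V :: "'a set"
  assumes G: "simple_graph V E" and p: "p \<in> {0..1}" and q: "q = 1 - p / 2"
    and dm: "\<And>v. v \<in> V \<Longrightarrow> dm \<le> card (nbrs E v)" and q2: "2 * q ^ (dm - t) \<le> 1" and s: "1 \<le> s" and t: "1 \<le> t"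
    and M: "2 ^ (t + s) * q ^ (t * b) \<le> M" "q ^ (dm - t) \<le> M" and y: "y \<in> V"
  shows "sprob E p (\<lambda>F. long_path V y s F \<or> dead_end V E y s (real dm - real t - real b) F) \<ge> 1 - M"
proof -
  have "sprob (E - {} - {}) p (\<lambda>F. \<not> dfs_good V E y s t (t * b) ({} \<union> F)) * 2 ^ card ({} :: 'a set set) * q ^ card ({} :: 'a set set) \<le> M"
    by (rule dfs_state_bound[where P = "[y]" and D = "{}" and A = "{}" and N = "{}" and dm = dm])
      (use G p q dm q2 s M y in \<open>auto simp: cut_def\<close>)
  then have "sprob E p (dfs_good V E y s t (t * b)) \<ge> 1 - M"
    by (simp add: sprob_not)
  also have "sprob E p (dfs_good V E y s t (t * b)) \<le>
     sprob E p (\<lambda>F. long_path V y s F \<or> dead_end V E y s (real dm - real t - real b) F)"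
  proof (rule sprob_mono[OF simple_graph_finite(2)[OF G]])
    fix F assume "dfs_good V E y s t (t * b) F"
    moreover have "dead_end V E y s (real dm - real t - real b) F"
      if *: "lpath F P" "P \<noteq> [] \<longrightarrow> last P = y" "set P \<subseteq> V" "D \<subseteq> V" "D \<inter> set P = {}" "card D = t"
         "length P < s" "card (cut E D (V - D - set P)) < t * b" for P D
    proof -
      have finD: "finite D" using * G simple_graph_finite(1) finite_subset by metis
      have "\<exists>d\<in>D. card (nbrs E d \<inter> (V - D - set P)) < b"
      proof (rule ccontr)
        assume "\<not> ?thesis"
        then have "card D * b \<le> (\<Sum>d\<in>D. card (nbrs E d \<inter> (V - D - set P)))"
          using sum_bounded_below[of D b "\<lambda>d. card (nbrs E d \<inter> (V - D - set P))"] by (simp add: not_less)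
        also have "\<dots> = card (cut E D (V - D - set P))"
          by (rule card_cut[OF G, symmetric]) (use finD in auto)
        finally show False using * by simp
      qed
      then obtain d where d: "d \<in> D" "card (nbrs E d \<inter> (V - D - set P)) < b" by blast
      have "nbrs E d \<subseteq> (nbrs E d \<inter> set P) \<union> (D \<union> (nbrs E d \<inter> (V - D - set P)))"
        using nbrs_subset[OF G] by auto
      then have "card (nbrs E d) \<le> card ((nbrs E d \<inter> set P) \<union> (D \<union> (nbrs E d \<inter> (V - D - set P))))"
        using finite_nbrs[OF G] finD by (intro card_mono) auto
      also have "\<dots> \<le> card (nbrs E d \<inter> set P) + (card D + card (nbrs E d \<inter> (V - D - set P)))"
        by (meson card_Un_le add_left_mono order_trans)
      finally have "dm \<le> card (nbrs E d \<inter> set P) + t + b"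
        using dm[of d] d * by auto
      then have "real dm - real t - real b \<le> real (card (nbrs E d \<inter> set P))" by linarith
      then show ?thesis unfolding dead_end_def using * d by blast
    qed
    ultimately show "long_path V y s F \<or> dead_end V E y s (real dm - real t - real b) F"
      unfolding dfs_good_def long_path_def by blast
  qed
  finally show ?thesis .
qed

lemma one_minus_power_le_exp:
  assumes "p \<in> {0..1::real}" "real n \<ge> x" 
  shows "(1 - p) ^ n \<le> exp (- p * x)"
proof -
  have "(1 - p) ^ n \<le> exp (- p) ^ n"
    using assms exp_ge_add_one_self[of "-p"] by (intro power_mono) auto
  also have "\<dots> = exp (- p * real n)" by (simp add: exp_of_nat_mult[symmetric] mult.commute)
  also have "\<dots> \<le> exp (- p * x)"
    using assms by (auto intro: mult_left_mono)
  finally show ?thesis .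
qed

lemma exp_density_le:
  fixes p \<rho> x y :: real
  assumes "0 < k" "\<rho> * ln (real k) / real k \<le> p" "p \<in> {0..1}" "0 \<le> x" "x * real k \<le> y"
  shows "exp (- p * y) \<le> exp (- (\<rho> * x) * ln (real k))"
proof -
  have "\<rho> * ln (real k) \<le> p * real k" using assms by (simp add: field_simps)
  then have "x * (\<rho> * ln (real k)) \<le> x * (p * real k)" using assms by (intro mult_left_mono) auto
  also have "\<dots> = p * (x * real k)" by simp
  also have "\<dots> \<le> p * y" using assms by (intro mult_left_mono) auto
  finally show ?thesis by (simp add: algebra_simps)
qed

lemma card_le_cover3:
  assumes "A \<subseteq> B \<union> (C \<union> D)" "finite B" "finite C" "finite D"
  shows "real (card A) \<le> real (card B) + real (card C) + real (card D)"
proof -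
  have "card A \<le> card (B \<union> (C \<union> D))" using assms by (intro card_mono) auto
  also have "\<dots> \<le> card B + (card C + card D)" by (meson card_Un_le add_left_mono order_trans)
  finally show ?thesis by linarith
qed

text \<open>Both \<open>t\<close> and \<open>b\<close> are taken as about
  \<open>\<delta> * k\<close>. At most \<open>t + s \<le> 3 * k\<close> positive answers contribute
  a factor \<open>2\<close> each, against at least \<open>(\<delta> * k)^2\<close> rejected edges;
  the product is \<open>exp (O(k) - c * k * ln k)\<close>. An emptied stack costs only
  \<open>q ^ (dm - t)\<close>, which is at most a negative power of \<open>k\<close>.\<close>

lemma eventually_dfs:
  fixes \<rho> \<kappa> \<delta> e :: real
  assumes pos: "\<rho> > 0" "0 < \<delta>" "4 * \<delta> \<le> \<kappa>" "\<kappa> \<le> 1" "e > 0"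
  shows "\<forall>\<^sub>F k in sequentially. \<forall>(V :: 'a set) E p y s. simple_graph V E \<longrightarrow>
     (\<forall>v\<in>V. \<kappa> * real k \<le> real (card (nbrs E v))) \<longrightarrow> p \<in> {0..1} \<longrightarrow> \<rho> * ln (real k) / real k \<le> p \<longrightarrow>
     y \<in> V \<longrightarrow> 1 \<le> s \<longrightarrow> real s \<le> 2 * real k \<longrightarrow>
     sprob E p (\<lambda>F. long_path V y s F \<or> dead_end V E y s (\<kappa> * real k - 3 * \<delta> * real k) F) \<ge> 1 - e"
proof -
  have "((\<lambda>k. exp (3 * real k * ln 2 - \<rho> * \<delta>^2 / 2 * (real k * ln (real k)))) \<longlongrightarrow> 0) sequentially"
    using pos by real_asymp
  then have ev1: "\<forall>\<^sub>F k in sequentially. exp (3 * real k * ln 2 - \<rho> * \<delta>^2 / 2 * (real k * ln (real k))) < e"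
    using pos by (auto simp: order_tendsto_iff)
  have "((\<lambda>k. exp (- (\<rho> * \<kappa> / 4) * ln (real k))) \<longlongrightarrow> 0) sequentially"
    using pos by real_asymp
  then have ev2: "\<forall>\<^sub>F k in sequentially. exp (- (\<rho> * \<kappa> / 4) * ln (real k)) < min e (1/2)"
    by (rule order_tendstoD) (use pos in auto)
  have ev3: "\<forall>\<^sub>F k in sequentially. \<delta> * real k \<ge> 2"
    using pos by real_asymp
  show ?thesis
    using ev1 ev2 ev3 eventually_gt_at_top[of 1]
  proof eventually_elim
    case (elim k)
    show ?case
    proof (intro allI impI)
      fix V :: "'a set" and E p y s
      assume a: "simple_graph V E" "\<forall>v\<in>V. \<kappa> * real k \<le> real (card (nbrs E v))" "p \<in> {0..1}" 
        "\<rho> * ln (real k) / real k \<le> p" "y \<in> V" "1 \<le> s" "real s \<le> 2 * real k"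
      define q where "q = 1 - p / 2"
      define t where "t = nat \<lceil>\<delta> * real k\<rceil>"
      define dm where "dm = nat \<lceil>\<kappa> * real k\<rceil>"
      have k: "real k > 1" using elim by simp
      have t: "real t \<ge> \<delta> * real k" "real t \<le> \<delta> * real k + 1" "t \<ge> 1"
        using elim(3) by (auto simp: t_def) linarith+
      have dmk: "real dm \<ge> \<kappa> * real k" by (simp add: dm_def) linarith
      have pk: "p * real k \<ge> \<rho> * ln (real k)" using a(4) k by (simp add: field_simps)
      have dkk: "4 * \<delta> * real k \<le> \<kappa> * real k" using pos k by (intro mult_right_mono) auto
      have tdm: "real (dm - t) \<ge> \<kappa> * real k / 2"
      proof -
        have "t \<le> dm" using t dmk dkk elim(3) by linarith
        then show ?thesis using t dmk dkk elim(3) by (simp add: of_nat_diff)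
      qed
      have qd: "q ^ (dm - t) \<le> exp (- (\<rho> * \<kappa> / 4) * ln (real k))"
      proof -
        have "q ^ (dm - t) \<le> exp (- (p / 2) * (\<kappa> * real k / 2))"
          unfolding q_def by (rule one_minus_power_le_exp) (use a tdm in auto)
        also have "\<dots> = exp (- p * (\<kappa> / 4 * real k))" by (simp add: field_simps)
        also have "\<dots> \<le> exp (- (\<rho> * (\<kappa> / 4)) * ln (real k))"
          by (rule exp_density_le[OF _ a(4,3)]) (use k pos in auto)
        finally show ?thesis by simp
      qed
      have tk: "real t \<le> real k"
      proof -
        have "\<delta> * real k \<le> real k * (1/4)" using pos k by (simp add: mult.commute)
        then show ?thesis using t elim(3) by linarith
      qed
      have "2 ^ (t + s) * q ^ (t * t) \<le> exp (3 * real k * ln 2) * exp (- (p / 2) * (\<delta>^2 * real k ^ 2))"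
      proof (rule mult_mono)
        have "(2::real) ^ (t + s) = exp (real (t + s) * ln 2)"
          by (subst exp_of_nat_mult) simp
        also have "\<dots> \<le> exp (3 * real k * ln 2)"
          using tk a by (auto intro!: mult_right_mono)
        finally show "2 ^ (t + s) \<le> exp (3 * real k * ln 2)" .
        show "q ^ (t * t) \<le> exp (- (p / 2) * (\<delta>^2 * real k ^ 2))"
          unfolding q_def
        proof (rule one_minus_power_le_exp)
          have "(\<delta> * real k) * (\<delta> * real k) \<le> real t * real t"
            using t pos by (intro mult_mono) auto
          then show "\<delta>^2 * real k ^ 2 \<le> real (t * t)" by (simp add: power2_eq_square algebra_simps)
        qed (use a in auto)
      qed (use a in \<open>auto simp: q_def\<close>)
      also have "\<dots> = exp (3 * real k * ln 2 - \<delta>^2 * real k / 2 * (p * real k))"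
        by (simp add: exp_add[symmetric] field_simps power2_eq_square)
      also have "\<dots> \<le> exp (3 * real k * ln 2 - \<delta>^2 * real k / 2 * (\<rho> * ln (real k)))"
        using pk by (auto intro!: mult_left_mono)
      also have "\<dots> = exp (3 * real k * ln 2 - \<rho> * \<delta>^2 / 2 * (real k * ln (real k)))"
        by (simp add: field_simps)
      finally have M1: "2 ^ (t + s) * q ^ (t * t) \<le> e" using elim(1) by linarith
      have "1 - e \<le> sprob E p (\<lambda>F. long_path V y s F \<or> dead_end V E y s (real dm - real t - real t) F)"
      proof (rule sprob_dfs[OF a(1,3) q_def])
        show "dm \<le> card (nbrs E v)" if "v \<in> V" for v
          using a(2) that by (auto simp: dm_def)
      qed (use qd elim t a M1 in auto)
      also have "\<dots> \<le> sprob E p (\<lambda>F. long_path V y s F \<or> dead_end V E y s (\<kappa> * real k - 3 * \<delta> * real k) F)"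
      proof (rule sprob_mono)
        fix F
        \<comment> \<open>Rounding up \<open>t\<close> costs \<open>1\<close> each time it is
          subtracted; the third \<open>\<delta> * real k\<close>, which is at least
          \<open>2\<close>, absorbs this.\<close>
        have "\<kappa> * real k - 3 * \<delta> * real k \<le> real dm - real t - real t"
          using dmk t elim(3) by linarith
        then show "long_path V y s F \<or> dead_end V E y s (real dm - real t - real t) F \<Longrightarrow>
           long_path V y s F \<or> dead_end V E y s (\<kappa> * real k - 3 * \<delta> * real k) F"
          by (auto dest: dead_end_mono)
      qed (use simple_graph_finite a in auto)
      finally show "sprob E p (\<lambda>F. long_path V y s F \<or> dead_end V E y s (\<kappa> * real k - 3 * \<delta> * real k) F) \<ge> 1 - e" .
    qed
  qed
qed

text \<open>With \<open>\<delta> = \<kappa> / 16\<close> a dead end would need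
  \<open>13 / 16 * \<kappa> * k\<close> neighbours of \<open>d\<close> on a path with fewer than
  \<open>\<kappa> * k / 4\<close> vertices, so only the long path remains.\<close>

lemma eventually_long_path:
  fixes \<rho> \<kappa> e :: real
  assumes pos: "\<rho> > 0" "0 < \<kappa>" "\<kappa> \<le> 1" "e > 0"
  shows "\<forall>\<^sub>F k in sequentially. \<forall>(V :: 'a set) E p y s. simple_graph V E \<longrightarrow>
     (\<forall>v\<in>V. \<kappa> * real k \<le> real (card (nbrs E v))) \<longrightarrow> p \<in> {0..1} \<longrightarrow> \<rho> * ln (real k) / real k \<le> p \<longrightarrow>
     y \<in> V \<longrightarrow> 1 \<le> s \<longrightarrow> real s \<le> \<kappa> * real k / 4 \<longrightarrow>
     sprob E p (long_path V y s) \<ge> 1 - e"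
proof -
  have "\<forall>\<^sub>F k in sequentially. \<forall>(V :: 'a set) E p y s. simple_graph V E \<longrightarrow>
     (\<forall>v\<in>V. \<kappa> * real k \<le> real (card (nbrs E v))) \<longrightarrow> p \<in> {0..1} \<longrightarrow> \<rho> * ln (real k) / real k \<le> p \<longrightarrow>
     y \<in> V \<longrightarrow> 1 \<le> s \<longrightarrow> real s \<le> 2 * real k \<longrightarrow>
     sprob E p (\<lambda>F. long_path V y s F \<or> dead_end V E y s (\<kappa> * real k - 3 * (\<kappa> / 16) * real k) F) \<ge> 1 - e"
    by (rule eventually_dfs) (use pos in auto)
  then show ?thesis using eventually_gt_at_top[of 0]
  proof eventually_elim
    case (elim k)
    show ?case
    proof (intro allI impI)
      fix V :: "'a set" and E p y s
      assume a: "simple_graph V E" "\<forall>v\<in>V. \<kappa> * real k \<le> real (card (nbrs E v))" "p \<in> {0..1}"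
        "\<rho> * ln (real k) / real k \<le> p" "y \<in> V" "1 \<le> s" "real s \<le> \<kappa> * real k / 4"
      have kk: "\<kappa> * real k > 0" "\<kappa> * real k \<le> real k" using pos elim(2) by auto
      then have s2: "real s \<le> 2 * real k" using a(7) by linarith
      have "\<not> dead_end V E y s (\<kappa> * real k - 3 * (\<kappa> / 16) * real k) F" for F
      proof
        assume "dead_end V E y s (\<kappa> * real k - 3 * (\<kappa> / 16) * real k) F"
        then obtain P d where P: "length P < s"
           "\<kappa> * real k - 3 * (\<kappa> / 16) * real k \<le> real (card (nbrs E d \<inter> set P))"
          unfolding dead_end_def by blast
        have "card (nbrs E d \<inter> set P) \<le> length P"
          by (meson List.finite_set card_length card_mono inf.cobounded2 order_trans)
        then have "\<kappa> * real k - 3 * (\<kappa> / 16) * real k \<le> \<kappa> * real k / 4" using P a(7) by linarith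
        then show False using kk by simp
      qed
      moreover have "sprob E p (\<lambda>F. long_path V y s F \<or> dead_end V E y s (\<kappa> * real k - 3 * (\<kappa> / 16) * real k) F) \<ge> 1 - e"
        using elim(1) a s2 by blast
      ultimately show "sprob E p (long_path V y s) \<ge> 1 - e" by simp
    qed
  qed
qed

text \<open>Granting the extra vertex only to the class of the head is what carries the
  induction.\<close>

lemma alternating_count:
  assumes "successively (\<lambda>u v. u \<in> A \<longleftrightarrow> v \<notin> A) P"
  shows "2 * length (filter (\<lambda>x. x \<in> A) P) \<le> length P + (if P \<noteq> [] \<and> hd P \<in> A then 1 else 0) \<and>
         2 * length (filter (\<lambda>x. x \<notin> A) P) \<le> length P + (if P \<noteq> [] \<and> hd P \<notin> A then 1 else 0)"
  using assms
proof (induction P)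
  case (Cons x P)
  then show ?case by (cases P) (auto split: if_splits)
qed auto

text \<open>The neighbours of \<open>d\<close> lie in one class, hence on every second vertex of
  \<open>P\<close>: at most about \<open>9 / 10 * \<kappa> * k\<close> of them, while a dead end
  with \<open>\<delta> = \<kappa> / 60\<close> needs \<open>19 / 20 * \<kappa> * k\<close>. The path
  can thus be nearly twice as long as the minimum degree, and this factor pays for a dropped segment
  when a path is rerouted.\<close>

lemma eventually_long_path_bipartite:
  fixes \<rho> \<kappa> e :: real
  assumes pos: "\<rho> > 0" "0 < \<kappa>" "\<kappa> \<le> 1" "e > 0"
  shows "\<forall>\<^sub>F k in sequentially. \<forall>(V :: 'a set) E A p y s. simple_graph V E \<longrightarrow>
     (\<forall>u v. {u, v} \<in> E \<longrightarrow> (u \<in> A \<longleftrightarrow> v \<notin> A)) \<longrightarrow>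
     (\<forall>v\<in>V. \<kappa> * real k \<le> real (card (nbrs E v))) \<longrightarrow> p \<in> {0..1} \<longrightarrow> \<rho> * ln (real k) / real k \<le> p \<longrightarrow>
     y \<in> V \<longrightarrow> 1 \<le> s \<longrightarrow> real s \<le> 9 / 5 * \<kappa> * real k \<longrightarrow>
     sprob E p (long_path V y s) \<ge> 1 - e"
proof -
  have "\<forall>\<^sub>F k in sequentially. \<forall>(V :: 'a set) E p y s. simple_graph V E \<longrightarrow>
     (\<forall>v\<in>V. \<kappa> * real k \<le> real (card (nbrs E v))) \<longrightarrow> p \<in> {0..1} \<longrightarrow> \<rho> * ln (real k) / real k \<le> p \<longrightarrow>
     y \<in> V \<longrightarrow> 1 \<le> s \<longrightarrow> real s \<le> 2 * real k \<longrightarrow>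
     sprob E p (\<lambda>F. long_path V y s F \<or> dead_end V E y s (\<kappa> * real k - 3 * (\<kappa> / 60) * real k) F) \<ge> 1 - e"
    by (rule eventually_dfs) (use pos in auto)
  moreover have "\<forall>\<^sub>F k in sequentially. \<kappa> * real k \<ge> 11"
    using pos by real_asymp
  ultimately show ?thesis
  proof eventually_elim
    case (elim k)
    show ?case
    proof (intro allI impI)
      fix V :: "'a set" and E A p y s
      assume a: "simple_graph V E" "\<forall>v\<in>V. \<kappa> * real k \<le> real (card (nbrs E v))" "p \<in> {0..1}"
        "\<rho> * ln (real k) / real k \<le> p" "y \<in> V" "1 \<le> s" "real s \<le> 9 / 5 * \<kappa> * real k"
        and bip: "\<forall>u v. {u, v} \<in> E \<longrightarrow> (u \<in> A \<longleftrightarrow> v \<notin> A)"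
      have "\<kappa> * real k \<le> real k" using pos mult_right_mono[of \<kappa> 1 "real k"] by simp
      then have s2: "real s \<le> 2 * real k" using a(7) by linarith
      have nd: "\<not> dead_end V E y s (\<kappa> * real k - 3 * (\<kappa> / 60) * real k) F" if FE: "F \<subseteq> E" for F
      proof
        assume "dead_end V E y s (\<kappa> * real k - 3 * (\<kappa> / 60) * real k) F"
        then obtain P d where P: "length P < s" "lpath F P"
           "\<kappa> * real k - 3 * (\<kappa> / 60) * real k \<le> real (card (nbrs E d \<inter> set P))"
          unfolding dead_end_def by blast
        have "successively (\<lambda>u v. u \<in> A \<longleftrightarrow> v \<notin> A) P"
          by (rule successively_mono[of "\<lambda>u v. {u, v} \<in> F"]) (use P(2) FE bip in \<open>auto simp: lpath_def\<close>)
        note alt = alternating_count[OF this]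
        have "card (nbrs E d \<inter> set P) \<le> length (filter (\<lambda>x. x \<in> A) P) \<or> card (nbrs E d \<inter> set P) \<le> length (filter (\<lambda>x. x \<notin> A) P)"
        proof (cases "d \<in> A")
          case True
          then have "nbrs E d \<inter> set P \<subseteq> set (filter (\<lambda>x. x \<notin> A) P)" using bip by (auto simp: nbrs_def)
          then have "card (nbrs E d \<inter> set P) \<le> card (set (filter (\<lambda>x. x \<notin> A) P))" by (intro card_mono) auto
          then show ?thesis using card_length[of "filter (\<lambda>x. x \<notin> A) P"] by linarith
        next
          case False
          then have "nbrs E d \<inter> set P \<subseteq> set (filter (\<lambda>x. x \<in> A) P)" using bip by (auto simp: nbrs_def)
          then have "card (nbrs E d \<inter> set P) \<le> card (set (filter (\<lambda>x. x \<in> A) P))" by (intro card_mono) auto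
          then show ?thesis using card_length[of "filter (\<lambda>x. x \<in> A) P"] by linarith
        qed
        then have "2 * card (nbrs E d \<inter> set P) \<le> length P + 1" using alt by (auto split: if_splits)
        then have "2 * (\<kappa> * real k - 3 * (\<kappa> / 60) * real k) \<le> 9 / 5 * (\<kappa> * real k) + 1"
          using P a(7) by (simp add: mult.assoc)
        then show False using elim(2) by simp
      qed
      have "1 - e \<le> sprob E p (\<lambda>F. long_path V y s F \<or> dead_end V E y s (\<kappa> * real k - 3 * (\<kappa> / 60) * real k) F)"
        using elim(1) a s2 by blast
      also have "\<dots> \<le> sprob E p (long_path V y s)"
        by (rule sprob_mono) (use nd simple_graph_finite a in auto)
      finally show "sprob E p (long_path V y s) \<ge> 1 - e" .
    qed
  qed
qed

text \<open>By Markov, except with probability \<open>2 * c\<close>, more than half of the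
  \<open>z\<close> have a long path from \<open>f z\<close> inside \<open>Y\<close>. The edges
  \<open>{z, f z}\<close> cross into \<open>Y\<close>, so they are distinct even if \<open>f\<close>
  is not injective, and they are independent of \<open>EY\<close>; that all good ones are absent has
  probability at most \<open>exp (- p * card Z / 2)\<close>.\<close>

lemma sprob_exit:
  assumes fin: "finite E" "finite Z" "Z \<noteq> {}" and p: "p \<in> {0..1}"
    and f: "\<And>z. z \<in> Z \<Longrightarrow> z \<notin> Y \<and> f z \<in> Y \<and> {z, f z} \<in> E"
    and EY: "EY \<subseteq> E" "\<And>e. e \<in> EY \<Longrightarrow> e \<subseteq> Y"
    and good: "\<And>z. z \<in> Z \<Longrightarrow> sprob EY p (long_path Y (f z) s) \<ge> 1 - c"
  shows "sprob E p (\<lambda>F. \<exists>z\<in>Z. {z, f z} \<in> F \<and> long_path Y (f z) s F) \<ge> 1 - 2 * c - exp (- p * (real (card Z) / 2))"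
proof -
  define h where "h z = {z, f z}" for z
  have finY: "finite EY" using fin EY(1) finite_subset by blast
  have inj: "inj_on h Z" using f by (auto simp: inj_on_def h_def doubleton_eq_iff)
  have disj: "EY \<inter> h ` Z = {}" using f EY(2) by (auto simp: h_def)
  define Q where "Q F \<longleftrightarrow> (\<exists>z\<in>Z. h z \<in> F \<and> long_path Y (f z) s F)" for F
  have lp_mono: "long_path Y y s F \<Longrightarrow> F \<subseteq> F' \<Longrightarrow> long_path Y y s F'" for y F F'
    unfolding long_path_def using lpath_mono by blast
  have "sprob EY p (\<lambda>F. \<not> card Z \<le> 2 * card {z \<in> Z. \<not> long_path Y (f z) s F}) \<ge> 1 - 2 * c"
    using sprob_many_bad[OF finY fin(2,3), of p "\<lambda>z F. \<not> long_path Y (f z) s F" c] good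
    by (simp add: sprob_not) (smt (verit))
  then have "sprob (EY \<union> h ` Z) p Q \<ge> 1 - 2 * c - exp (- p * (real (card Z) / 2))"
  proof (rule sprob_Un_ge[OF finY _ disj, rotated 2])
    fix F assume F: "F \<subseteq> EY" "\<not> card Z \<le> 2 * card {z \<in> Z. \<not> long_path Y (f z) s F}"
    define Zg where "Zg = {z \<in> Z. long_path Y (f z) s F}"
    have "card Z = card Zg + card {z \<in> Z. \<not> long_path Y (f z) s F}"
      unfolding Zg_def using fin by (subst card_Un_disjoint[symmetric]) (auto intro: arg_cong[where f = card])
    then have cZ: "real (card Zg) \<ge> real (card Z) / 2" using F(2) by simp
    have "card (h ` Zg) = card Zg"
      by (rule card_image) (use inj in \<open>auto simp: Zg_def inj_on_def\<close>)
    moreover have "h ` Zg \<subseteq> h ` Z" by (auto simp: Zg_def)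
    ultimately have "sprob (h ` Z) p (\<lambda>F'. h ` Zg \<inter> F' = {}) \<le> exp (- p * (real (card Z) / 2))"
      using sprob_avoid[of "h ` Z" p "h ` Zg"] fin p one_minus_power_le_exp[OF p cZ] by simp
    moreover have "sprob (h ` Z) p (\<lambda>F'. \<not> h ` Zg \<inter> F' = {}) \<le> sprob (h ` Z) p (\<lambda>F'. Q (F \<union> F'))"
      by (rule sprob_mono) (use fin in \<open>auto simp: Q_def Zg_def intro: lp_mono[of _ F]\<close>)
    ultimately show "1 - exp (- p * (real (card Z) / 2)) \<le> sprob (h ` Z) p (\<lambda>F'. Q (F \<union> F'))"
      by (simp add: sprob_not)
  qed (use fin in auto)
  also have "sprob (EY \<union> h ` Z) p Q = sprob E p (\<lambda>F. Q (F \<inter> (EY \<union> h ` Z)))"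
    by (rule sprob_restrict[symmetric]) (use fin EY f in \<open>auto simp: h_def\<close>)
  also have "\<dots> \<le> sprob E p (\<lambda>F. \<exists>z\<in>Z. {z, f z} \<in> F \<and> long_path Y (f z) s F)"
    by (rule sprob_mono[OF fin(1)]) (auto simp: Q_def h_def intro: lp_mono)
  finally show ?thesis .
qed

section \<open>Rotations and boosters\<close>

text \<open>With its edges as a set, a path is an inclusion; a path of \<open>A \<union> B\<close>
  can then be split into its edges from \<open>A\<close> and those from \<open>B\<close>.\<close>

fun pedges :: "'a list \<Rightarrow> 'a set set" where
  "pedges (x # y # ys) = insert {x, y} (pedges (y # ys))"
| "pedges _ = {}"

lemma pedges_append:
  "pedges (xs @ ys) = pedges xs \<union> pedges ys \<union> (if xs \<noteq> [] \<and> ys \<noteq> [] then {{last xs, hd ys}} else {})"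
proof (induction xs rule: pedges.induct)
  case ("2_2" v)
  then show ?case by (cases ys) auto
qed auto

lemma pedges_rev [simp]: "pedges (rev xs) = pedges xs"
proof (induction xs rule: pedges.induct)
  case (1 x y ys)
  have "rev (x # y # ys) = rev (y # ys) @ [x]" by simp
  then have "pedges (rev (x # y # ys)) = insert {last (rev (y # ys)), x} (pedges (rev (y # ys)))"
    by (simp only: pedges_append) simp
  also have "\<dots> = insert {y, x} (pedges (y # ys))"
    using "1.IH" by (simp add: last_rev)
  finally show ?case by (simp add: insert_commute)
qed auto

lemma lpath_iff_pedges: "lpath F xs \<longleftrightarrow> distinct xs \<and> pedges xs \<subseteq> F"
proof -
  have "successively (\<lambda>u v. {u, v} \<in> F) xs \<longleftrightarrow> pedges xs \<subseteq> F"
    by (induction xs rule: pedges.induct) auto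
  then show ?thesis by (simp add: lpath_def)
qed

lemma pedges_subset_set: "e \<in> pedges xs \<Longrightarrow> e \<subseteq> set xs"
  by (induction xs rule: pedges.induct) auto

lemma card_pedges: "card (pedges xs) \<le> length xs - 1"
proof (induction xs rule: pedges.induct)
  case (1 x y ys)
  then show ?case using card_insert_le_m1[of "length (y # ys)" "pedges (y # ys)" "{x, y}"] by simp
qed auto

lemma pedges_nbrs: "distinct xs \<Longrightarrow> \<exists>a b. {y. {x, y} \<in> pedges xs} \<subseteq> {a, b}"
proof (induction xs rule: pedges.induct)
  case (1 u v ys)
  consider "x = u" | "x = v" "x \<noteq> u" | "x \<noteq> u" "x \<noteq> v" by blast
  then show ?case
  proof cases
    case 1
    then have "{y. {x, y} \<in> pedges (u # v # ys)} \<subseteq> {v, v}"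
      using "1.prems" pedges_subset_set[of _ "v # ys"] by (fastforce simp: doubleton_eq_iff)
    then show ?thesis by blast
  next
    case 2
    have "{y. {v, y} \<in> pedges (v # ys)} \<subseteq> {hd ys}"
      using "1.prems" pedges_subset_set[of _ ys]
      by (cases ys) (fastforce simp: doubleton_eq_iff)+
    then have "{y. {x, y} \<in> pedges (u # v # ys)} \<subseteq> {u, hd ys}"
      using 2 by (auto simp: doubleton_eq_iff)
    then show ?thesis by blast
  next
    case 3
    then have "{y. {x, y} \<in> pedges (u # v # ys)} = {y. {x, y} \<in> pedges (v # ys)}"
      by (auto simp: doubleton_eq_iff)
    then show ?thesis using "1.IH" "1.prems" by simp
  qed
qed auto

text \<open>Posa rotations that keep the last vertex: the edge from the head to \<open>y\<close> is
  added, the edge from \<open>last as\<close> to \<open>y\<close> is removed, and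
  \<open>last as\<close> becomes the new head.\<close>

inductive_set rots :: "'a set set \<Rightarrow> 'a list \<Rightarrow> 'a list set" for E P where
  base: "P \<in> rots E P"
| step: "as @ y # bs \<in> rots E P \<Longrightarrow> as \<noteq> [] \<Longrightarrow> {hd as, y} \<in> E \<Longrightarrow> rev as @ y # bs \<in> rots E P"

lemma rots_path:
  assumes "Q \<in> rots E P" "lpath E P"
  shows "lpath E Q \<and> set Q = set P \<and> length Q = length P \<and> last Q = last P"
  using assms
  by (induction rule: rots.induct) (auto simp: lpath_append last_rev)

definition rot_ends :: "'a set set \<Rightarrow> 'a list \<Rightarrow> 'a set" where
  "rot_ends E P = hd ` rots E P"

lemma rot_ends_subset:
  assumes "lpath E P" "P \<noteq> []"
  shows "rot_ends E P \<subseteq> set P"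
  using rots_path[OF _ assms(1)] assms(2) hd_in_set
  unfolding rot_ends_def by (metis image_subsetI length_0_conv)

text \<open>A rotation only changes edges that meet the set of end points.\<close>

lemma rots_edges_unchanged:
  assumes "Q \<in> rots E P" "y \<notin> rot_ends E P" "\<forall>x\<in>rot_ends E P. {x, y} \<notin> pedges P" "y \<in> e"
  shows "e \<in> pedges Q \<longleftrightarrow> e \<in> pedges P"
  using assms
proof (induction arbitrary: e rule: rots.induct)
  case (step as z bs)
  have hd: "hd as \<in> rot_ends E P"
    unfolding rot_ends_def using step.hyps by (intro image_eqI[of _ _ "as @ z # bs"]) auto
  have last: "last as \<in> rot_ends E P"
    unfolding rot_ends_def using rots.step[OF step.hyps] step.hyps
    by (intro image_eqI[of _ _ "rev as @ z # bs"]) (auto simp: hd_rev)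
  have "y \<noteq> z"
  proof
    assume "y = z"
    then have "{last as, y} \<in> pedges P"
      using step.IH[of "{last as, y}"] step.prems step.hyps by (auto simp: pedges_append)
    then show False using step.prems last by blast
  qed
  then have "e \<noteq> {last as, z}" "e \<noteq> {hd as, z}" using hd last step.prems by auto
  then show ?case
    using step.IH[OF step.prems] step.hyps by (auto simp: pedges_append last_rev)
qed auto

text \<open>Rotating a path with head \<open>x\<close> at \<open>y\<close> makes the predecessor of
  \<open>y\<close> an end point. If no end point were next to \<open>y\<close> on \<open>P\<close>,
  the edges at \<open>y\<close> would never have changed, and this predecessor would be next to
  \<open>y\<close> on \<open>P\<close> after all.\<close>

lemma rot_ends_nbr:
  assumes "lpath E P" "x \<in> rot_ends E P" "y \<in> nbrs E x" "y \<in> set P" "y \<notin> rot_ends E P"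
  shows "\<exists>x'\<in>rot_ends E P. {x', y} \<in> pedges P"
proof (rule ccontr)
  assume contr: "\<not> ?thesis"
  obtain Q where Q: "Q \<in> rots E P" "hd Q = x" using assms(2) by (auto simp: rot_ends_def)
  have "y \<in> set Q" using rots_path[OF Q(1) assms(1)] assms by simp
  then obtain as bs where s: "Q = as @ y # bs" by (meson split_list)
  have "as \<noteq> []" using s Q assms(2,5) by auto
  then have Q': "rev as @ y # bs \<in> rots E P"
    using rots.step[of as y bs E P] Q s assms(3) by (auto simp: nbrs_def)
  have "last as \<in> rot_ends E P"
    unfolding rot_ends_def using Q' \<open>as \<noteq> []\<close>
    by (intro image_eqI[of _ _ "rev as @ y # bs"]) (auto simp: hd_rev)
  moreover have "{last as, y} \<in> pedges Q" using s \<open>as \<noteq> []\<close> by (simp add: pedges_append)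
  then have "{last as, y} \<in> pedges P"
    using rots_edges_unchanged[OF Q(1) assms(5), of "{last as, y}"] contr by blast
  ultimately show False using contr by blast
qed

section \<open>Longest paths, Posa's lemma and boosters\<close>

definition longest :: "'a set \<Rightarrow> 'a set set \<Rightarrow> 'a list \<Rightarrow> bool" where
  "longest Z E P \<longleftrightarrow> lpath E P \<and> set P \<subseteq> Z \<and> (\<forall>Q. lpath E Q \<longrightarrow> set Q \<subseteq> Z \<longrightarrow> length Q \<le> length P)"

text \<open>The factor \<open>2\<close> is matched to the at most two neighbours that a vertex has
  on a path.\<close>

definition expands :: "'a set \<Rightarrow> 'a set set \<Rightarrow> nat \<Rightarrow> bool" where
  "expands Z E c \<longleftrightarrow> (\<forall>S\<subseteq>Z. S \<noteq> {} \<longrightarrow> card S \<le> c \<longrightarrow> 2 * card S < card ((\<Union>x\<in>S. nbrs E x) - S))"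

text \<open>Connectedness is expressed by cuts: a union bound over vertex sets delivers it in this
  form, and a path leaves a cycle through such a cut.\<close>

definition graph_connected :: "'a set \<Rightarrow> 'a set set \<Rightarrow> bool" where
  "graph_connected Z E \<longleftrightarrow> (\<forall>S\<subseteq>Z. S \<noteq> {} \<longrightarrow> S \<noteq> Z \<longrightarrow> cut E S (Z - S) \<noteq> {})"

lemma longest_exists:
  assumes "finite Z"
  obtains P where "longest Z E P"
proof -
  have "\<exists>P. (lpath E P \<and> set P \<subseteq> Z) \<and> (\<forall>Q. lpath E Q \<and> set Q \<subseteq> Z \<longrightarrow> length Q \<le> length P)"
  proof (rule ex_has_greatest_nat[of _ "[]" _ "card Z + 1"])
    show "\<forall>Q. lpath E Q \<and> set Q \<subseteq> Z \<longrightarrow> length Q < card Z + 1"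
      using assms by (metis card_mono distinct_card lpath_def less_Suc_eq_le Suc_eq_plus1)
  qed simp
  then show ?thesis using that by (auto simp: longest_def)
qed

lemma longest_nonempty:
  assumes "longest Z E P" "Z \<noteq> {}"
  shows "P \<noteq> []"
proof -
  obtain z where "z \<in> Z" using assms(2) by blast
  then have "length [z] \<le> length P" using assms(1) unfolding longest_def by (metis lpath_single empty_set list.simps(15) empty_subsetI insert_subset)
  then show ?thesis by auto
qed

text \<open>Let \<open>S\<close> be the set of end points. Since \<open>P\<close> is longest, all
  neighbours of \<open>S\<close> lie on \<open>P\<close>, and those outside \<open>S\<close> are
  next to \<open>S\<close> along \<open>P\<close>; there are at most \<open>2 * card S\<close> of
  them. If \<open>S\<close> had at most \<open>c\<close> elements, this would contradict
  expansion.\<close>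

lemma posa:
  assumes G: "simple_graph Z E" and P: "longest Z E P" "P \<noteq> []" and exp: "expands Z E c"
  shows "c < card (rot_ends E P)"
proof (rule ccontr)
  assume "\<not> ?thesis"
  define S where "S = rot_ends E P"
  have lp: "lpath E P" "set P \<subseteq> Z" using P by (auto simp: longest_def)
  have S: "S \<subseteq> set P" unfolding S_def by (rule rot_ends_subset[OF lp(1) P(2)])
  have finS: "finite S" using S finite_subset by blast
  have Sne: "S \<noteq> {}" using rots.base[of P E] by (auto simp: S_def rot_ends_def)
  have sub: "(\<Union>x\<in>S. nbrs E x) - S \<subseteq> (\<Union>x\<in>S. {y. {x, y} \<in> pedges P})"
  proof
    fix y assume "y \<in> (\<Union>x\<in>S. nbrs E x) - S"
    then obtain x where x: "x \<in> S" "y \<in> nbrs E x" "y \<notin> S" by blast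
    obtain Q where Q: "Q \<in> rots E P" "hd Q = x" using x(1) by (auto simp: S_def rot_ends_def)
    note rp = rots_path[OF Q(1) lp(1)]
    have "y \<in> set P"
    proof (rule ccontr)
      assume "y \<notin> set P"
      then have "lpath E (y # Q)" "set (y # Q) \<subseteq> Z"
        using rp Q(2) x(2) lp(2) nbrs_subset[OF G, of x]
        by (auto simp: lpath_Cons nbrs_def insert_commute)
      then show False using P(1) rp unfolding longest_def by fastforce
    qed
    then show "y \<in> (\<Union>x\<in>S. {y. {x, y} \<in> pedges P})"
      using rot_ends_nbr[OF lp(1), of x y] x unfolding S_def by blast
  qed
  have two: "finite {y. {x, y} \<in> pedges P} \<and> card {y. {x, y} \<in> pedges P} \<le> 2" for x
  proof -
    obtain a b where "{y. {x, y} \<in> pedges P} \<subseteq> {a, b}"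
      using pedges_nbrs lp(1) unfolding lpath_def by metis
    moreover have "card {a, b} \<le> 2" by (simp add: card_insert_if)
    ultimately show ?thesis by (meson card_mono finite.emptyI finite.insertI finite_subset order_trans)
  qed
  have "card ((\<Union>x\<in>S. nbrs E x) - S) \<le> card (\<Union>x\<in>S. {y. {x, y} \<in> pedges P})"
    by (rule card_mono[OF _ sub]) (use two finS in auto)
  also have "\<dots> \<le> (\<Sum>x\<in>S. card {y. {x, y} \<in> pedges P})" by (rule card_UN_le[OF finS])
  also have "\<dots> \<le> 2 * card S"
    using sum_bounded_above[of S "\<lambda>x. card {y. {x, y} \<in> pedges P}" 2] two by simp
  finally have "card ((\<Union>x\<in>S. nbrs E x) - S) \<le> 2 * card S" .
  moreover have "S \<subseteq> Z" "card S \<le> c" using S lp(2) \<open>\<not> c < _\<close> by (auto simp: S_def)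
  then have "2 * card S < card ((\<Union>x\<in>S. nbrs E x) - S)"
    using exp Sne unfolding expands_def by simp
  ultimately show False by simp
qed

definition ham_cycle :: "'a set \<Rightarrow> 'a set set \<Rightarrow> bool" where
  "ham_cycle Z F \<longleftrightarrow> (\<exists>Q. lpath F Q \<and> set Q = Z \<and> 3 \<le> length Q \<and> {last Q, hd Q} \<in> F)"

definition boosters :: "'a set \<Rightarrow> 'a set set \<Rightarrow> 'a set set \<Rightarrow> 'a set set" where
  "boosters Z E H = {e \<in> E. ham_cycle Z (insert e H) \<or>
     (\<exists>Q. lpath (insert e H) Q \<and> set Q \<subseteq> Z \<and> (\<forall>P. lpath H P \<longrightarrow> set P \<subseteq> Z \<longrightarrow> length P < length Q))}"

text \<open>The new edge turns \<open>Q\<close> into a cycle. If this does not span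
  \<open>Z\<close>, connectedness gives an edge leaving it, and opening the cycle there yields a
  path with one more vertex.\<close>

lemma close_cycle:
  assumes conn: "graph_connected Z H" and Q: "longest Z H Q" "3 \<le> length Q" and e: "{last Q, hd Q} \<in> E"
  shows "{last Q, hd Q} \<in> boosters Z E H"
proof (cases "set Q = Z")
  case True
  then have "ham_cycle Z (insert {last Q, hd Q} H)"
    unfolding ham_cycle_def using Q by (intro exI[of _ Q]) (auto simp: longest_def intro: lpath_mono)
  then show ?thesis using e by (simp add: boosters_def)
next
  case False
  have lp: "lpath H Q" "set Q \<subseteq> Z" using Q by (auto simp: longest_def)
  have "set Q \<noteq> {}" using Q(2) by auto
  then have "cut H (set Q) (Z - set Q) \<noteq> {}" using conn False lp unfolding graph_connected_def by blast
  then obtain a b where ab: "a \<in> set Q" "b \<in> Z" "b \<notin> set Q" "{a, b} \<in> H" unfolding cut_def by blast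
  obtain as bs where s: "Q = as @ a # bs" using ab(1) by (meson split_list)
  define R where "R = b # (a # bs) @ as"
  have "lpath (insert {last Q, hd Q} H) Q" using lp lpath_mono[of H Q] by blast
  then have "lpath (insert {last Q, hd Q} H) R"
    using ab unfolding R_def s by (auto simp: lpath_append lpath_Cons insert_commute)
  moreover have "set R \<subseteq> Z" using ab lp by (auto simp: R_def s)
  moreover have "\<forall>P. lpath H P \<longrightarrow> set P \<subseteq> Z \<longrightarrow> length P < length R"
    using Q(1) unfolding longest_def by (auto simp: R_def s less_Suc_eq_le)
  ultimately show ?thesis using e unfolding boosters_def by blast
qed

text \<open>Posa's lemma is applied twice: there are more than \<open>c\<close> end points
  \<open>x\<close>, and fixing one of them gives more than \<open>c\<close> opposite end points, of
  which all but \<open>g\<close> are adjacent to \<open>x\<close> in \<open>E\<close>. Each such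
  pair closes a longest path. An edge \<open>e\<close> is counted at most
  \<open>card (e \<times> e) = 4\<close> times.\<close>

lemma card_boosters:
  assumes G: "simple_graph Z H" "simple_graph Z E" and ne: "Z \<noteq> {}" and exp: "expands Z H c" and conn: "graph_connected Z H"
    and c: "2 \<le> c" and dense: "\<And>x. x \<in> Z \<Longrightarrow> card (Z - nbrs E x) \<le> g"
  shows "(c - g) * c \<le> 4 * card (boosters Z E H)"
proof -
  have finZ: "finite Z" and finE: "finite E" using simple_graph_finite G by auto
  obtain P where P: "longest Z H P" using longest_exists[OF finZ] .
  have Pne: "P \<noteq> []" using longest_nonempty[OF P ne] .
  have lp: "lpath H P" "set P \<subseteq> Z" using P by (auto simp: longest_def)
  define S where "S = rot_ends H P"
  have S: "c < card S" "S \<subseteq> set P" "finite S"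
    using posa[OF G(1) P Pne exp] rot_ends_subset[OF lp(1) Pne] finite_subset
    unfolding S_def by auto
  have len3: "3 \<le> length P"
    using S c card_mono[OF _ S(2)] card_length[of P] by simp
  have "\<forall>x\<in>S. \<exists>Q. longest Z H Q \<and> last Q = x \<and> length Q = length P"
  proof
    fix x assume "x \<in> S"
    then obtain Q where Q: "Q \<in> rots H P" "hd Q = x" by (auto simp: S_def rot_ends_def)
    note rp = rots_path[OF Q(1) lp(1)]
    \<comment> \<open>Reversal makes \<open>x\<close> the fixed end, so that rotations of
      \<open>R x\<close> move the other end.\<close>
    have "longest Z H (rev Q)" using P rp unfolding longest_def by simp
    moreover have "last (rev Q) = x" using Q rp Pne by (metis last_rev length_0_conv)
    ultimately show "\<exists>Q. longest Z H Q \<and> last Q = x \<and> length Q = length P" using rp by (metis length_rev)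
  qed
  then obtain R where R: "\<And>x. x \<in> S \<Longrightarrow> longest Z H (R x) \<and> last (R x) = x \<and> length (R x) = length P"
    by metis
  define T where "T x = rot_ends H (R x) \<inter> nbrs E x" for x
  have Rne: "R x \<noteq> []" if "x \<in> S" for x using R[OF that] Pne by auto
  have TZ: "rot_ends H (R x) \<subseteq> Z" if "x \<in> S" for x
    using rot_ends_subset[of H "R x"] R[OF that] Rne[OF that] unfolding longest_def by blast
  have cT: "c - g \<le> card (T x)" if "x \<in> S" for x
  proof -
    have xZ: "x \<in> Z" using that S lp by blast
    have fin: "finite (rot_ends H (R x))" using TZ[OF that] finZ finite_subset by blast
    have "card (rot_ends H (R x)) \<le> card (T x \<union> (Z - nbrs E x))"
      by (rule card_mono) (use TZ[OF that] finZ fin in \<open>auto simp: T_def\<close>)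
    also have "\<dots> \<le> card (T x) + card (Z - nbrs E x)" by (rule card_Un_le)
    also have "\<dots> \<le> card (T x) + g" using dense[OF xZ] by simp
    finally show ?thesis using posa[OF G(1) _ Rne[OF that] exp] R[OF that] by fastforce
  qed
  have finT: "finite (T x)" for x unfolding T_def using finite_nbrs[OF G(2)] by blast
  have "(c - g) * c \<le> (\<Sum>x\<in>S. card (T x))"
  proof -
    have "(c - g) * c \<le> card S * (c - g)" using S by (simp add: mult.commute)
    also have "\<dots> \<le> (\<Sum>x\<in>S. card (T x))"
      using sum_bounded_below[of S "c - g" "\<lambda>x. card (T x)"] cT by simp
    finally show ?thesis .
  qed
  also have "\<dots> = card (SIGMA x:S. T x)"
    by (rule card_SigmaI[symmetric]) (use S finT in auto)
  also have "\<dots> \<le> card (\<Union>e\<in>boosters Z E H. e \<times> e)"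
  proof (rule card_mono)
    show "finite (\<Union>e\<in>boosters Z E H. e \<times> e)"
    proof (rule finite_UN_I)
      show "finite (boosters Z E H)" using finE by (auto simp: boosters_def)
      fix e assume "e \<in> boosters Z E H"
      then have "e \<subseteq> Z" using G(2) by (auto simp: boosters_def simple_graph_def)
      then show "finite (e \<times> e)" using finZ finite_subset by blast
    qed
    show "(SIGMA x:S. T x) \<subseteq> (\<Union>e\<in>boosters Z E H. e \<times> e)"
    proof clarify
      fix x u assume xu: "x \<in> S" "u \<in> T x"
      obtain Q where Q: "Q \<in> rots H (R x)" "hd Q = u" using xu(2) by (auto simp: T_def rot_ends_def)
      note r = R[OF xu(1)]
      have rl: "lpath H (R x)" using r by (simp add: longest_def)
      note rp = rots_path[OF Q(1) rl]
      have "longest Z H Q" using r rp unfolding longest_def by auto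
      then have "{last Q, hd Q} \<in> boosters Z E H"
        using close_cycle[OF conn, of Q E] rp r len3 Q xu(2) by (auto simp: T_def nbrs_def)
      then show "(x, u) \<in> (\<Union>e\<in>boosters Z E H. e \<times> e)"
        using Q rp r by (intro UN_I[of "{last Q, hd Q}"]) auto
    qed
  qed
  also have "\<dots> \<le> (\<Sum>e\<in>boosters Z E H. card (e \<times> e))"
    by (rule card_UN_le) (use finE in \<open>auto simp: boosters_def\<close>)
  also have "\<dots> \<le> 4 * card (boosters Z E H)"
  proof -
    have "card (e \<times> e) \<le> 4" if "e \<in> boosters Z E H" for e
      using that G(2) by (auto simp: boosters_def simple_graph_def card_cartesian_product)
    then show ?thesis using sum_bounded_above[of "boosters Z E H" "\<lambda>e. card (e \<times> e)" 4] by simp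
  qed
  finally show ?thesis .
qed

lemma expands_mono: "expands Z A c \<Longrightarrow> A \<subseteq> H \<Longrightarrow> simple_graph Z H \<Longrightarrow> expands Z H c"
  unfolding expands_def
proof (intro allI impI)
  fix S assume a: "\<forall>S\<subseteq>Z. S \<noteq> {} \<longrightarrow> card S \<le> c \<longrightarrow> 2 * card S < card (\<Union> (nbrs A ` S) - S)" "A \<subseteq> H" "simple_graph Z H"
    and S: "S \<subseteq> Z" "S \<noteq> {}" "card S \<le> c"
  have finS: "finite S" using S(1) simple_graph_finite(1)[OF a(3)] finite_subset by blast
  have "card (\<Union> (nbrs A ` S) - S) \<le> card (\<Union> (nbrs H ` S) - S)"
    using nbrs_mono[OF a(2)] finS finite_nbrs[OF a(3)] by (intro card_mono) blast+
  moreover have "2 * card S < card (\<Union> (nbrs A ` S) - S)" using a(1) S by blast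
  ultimately show "2 * card S < card (\<Union> (nbrs H ` S) - S)" by linarith
qed

lemma graph_connected_mono: "graph_connected Z A \<Longrightarrow> A \<subseteq> H \<Longrightarrow> graph_connected Z H"
  unfolding graph_connected_def cut_def
proof (intro allI impI)
  fix S assume a: "\<forall>S\<subseteq>Z. S \<noteq> {} \<longrightarrow> S \<noteq> Z \<longrightarrow> {e \<in> A. \<exists>a\<in>S. \<exists>b\<in>Z - S. e = {a, b}} \<noteq> {}"
    "A \<subseteq> H" "S \<subseteq> Z" "S \<noteq> {}" "S \<noteq> Z"
  have "{e \<in> A. \<exists>a\<in>S. \<exists>b\<in>Z - S. e = {a, b}} \<noteq> {}" using a by simp
  then show "{e \<in> H. \<exists>a\<in>S. \<exists>b\<in>Z - S. e = {a, b}} \<noteq> {}" using a(2) by fast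
qed

lemma sum_Pow_power:
  fixes x :: real
  assumes "finite E"
  shows "(\<Sum>F\<in>Pow E. x ^ card F) = (1 + x) ^ card E"
  using assms
proof (induction E rule: finite_induct)
  case (insert e E)
  have "(\<Sum>F\<in>Pow (insert e E). x ^ card F) = (\<Sum>F\<in>Pow E. x ^ card F) + (\<Sum>F\<in>insert e ` Pow E. x ^ card F)"
    unfolding Pow_insert by (rule sum.union_disjoint) (use insert.hyps in auto)
  also have "(\<Sum>F\<in>insert e ` Pow E. x ^ card F) = (\<Sum>F\<in>Pow E. x ^ card (insert e F))"
    by (subst sum.reindex) (use insert.hyps in \<open>auto simp: inj_on_def\<close>)
  also have "\<dots> = (\<Sum>F\<in>Pow E. x * x ^ card F)"
  proof (rule sum.cong[OF refl])
    fix F assume "F \<in> Pow E"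
    then have "finite F" "e \<notin> F" using insert.hyps finite_subset by auto
    then show "x ^ card (insert e F) = x * x ^ card F" by simp
  qed
  finally show ?case using insert by (simp add: sum_distrib_left[symmetric] algebra_simps)
qed simp

text \<open>If \<open>A \<union> B\<close> has no Hamilton cycle, let \<open>F\<close> consist of the edges of \<open>B\<close> on a longest path of
  \<open>A \<union> B\<close>. No booster of \<open>A \<union> F\<close> lies in \<open>B\<close>; a union bound over \<open>F\<close> suffices, since \<open>F\<close> is small and
  the boosters are many. The parameter \<open>x\<close> serves to bound the number of choices for \<open>F\<close>.\<close>

lemma sprob_no_ham_cycle:
  fixes x :: real
  assumes G: "simple_graph Z E" and ne: "Z \<noteq> {}" and A: "A \<subseteq> E" "expands Z A c" "graph_connected Z A"
    and c: "2 \<le> c" and dense: "\<And>x. x \<in> Z \<Longrightarrow> card (Z - nbrs E x) \<le> g"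
    and p: "p \<in> {0..1}" and N: "real N \<le> real ((c - g) * c) / 4" and x: "1 \<le> x"
  shows "sprob E p (\<lambda>B. \<not> ham_cycle Z (A \<union> B)) \<le> x ^ card Z * (1 + p / x) ^ card E * (1 - p) ^ N"
proof -
  have fin: "finite E" "finite Z" using simple_graph_finite G by auto
  define I where "I = {F. F \<subseteq> E \<and> card F \<le> card Z \<and> \<not> ham_cycle Z (A \<union> F)}"
  have finI: "finite I" using fin by (auto simp: I_def)
  have "sprob E p (\<lambda>B. \<not> ham_cycle Z (A \<union> B)) \<le>
     sprob E p (\<lambda>B. \<exists>F\<in>I. F \<subseteq> B \<and> boosters Z E (A \<union> F) \<inter> B = {})"
  proof (rule sprob_mono[OF fin(1)])
    fix B assume B: "B \<subseteq> E" "\<not> ham_cycle Z (A \<union> B)"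
    obtain P where P: "longest Z (A \<union> B) P" using longest_exists[OF fin(2)] .
    define F where "F = pedges P \<inter> B"
    have lp: "lpath (A \<union> B) P" "set P \<subseteq> Z" using P by (auto simp: longest_def)
    have "card F \<le> card (pedges P)"
      unfolding F_def by (rule card_mono) (use fin B A lp finite_subset[of "pedges P" E] in \<open>auto simp: lpath_iff_pedges\<close>)
    also have "\<dots> \<le> length P" using card_pedges[of P] by linarith
    also have "\<dots> = card (set P)" using lp(1) by (simp add: lpath_def distinct_card)
    also have "\<dots> \<le> card Z" using lp fin by (intro card_mono)
    finally have cF: "card F \<le> card Z" .
    have ham_mono: "ham_cycle Z F' \<Longrightarrow> F' \<subseteq> A \<union> B \<Longrightarrow> False" for F'
      using B(2) unfolding ham_cycle_def by (blast intro: lpath_mono)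
    have "boosters Z E (A \<union> F) \<inter> B = {}"
    proof (rule ccontr)
      assume "\<not> ?thesis"
      then obtain e where e: "e \<in> boosters Z E (A \<union> F)" "e \<in> B" by blast
      have sub: "insert e (A \<union> F) \<subseteq> A \<union> B" using e by (auto simp: F_def)
      then obtain Q where Q: "lpath (insert e (A \<union> F)) Q" "set Q \<subseteq> Z"
         "\<forall>P. lpath (A \<union> F) P \<longrightarrow> set P \<subseteq> Z \<longrightarrow> length P < length Q"
        using e(1) ham_mono[OF _ sub] unfolding boosters_def by blast
      have "lpath (A \<union> F) P" using lp(1) unfolding lpath_iff_pedges F_def by blast
      then have "length P < length Q" using Q(3) lp(2) by blast
      moreover have "length Q \<le> length P" using P lpath_mono[OF Q(1) sub] Q(2) unfolding longest_def by blast
      ultimately show False by simp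
    qed
    moreover have "F \<in> I" using cF B ham_mono[of "A \<union> F"] by (auto simp: I_def F_def)
    moreover have "F \<subseteq> B" by (auto simp: F_def)
    ultimately show "\<exists>F\<in>I. F \<subseteq> B \<and> boosters Z E (A \<union> F) \<inter> B = {}" by blast
  qed
  also have "\<dots> \<le> (\<Sum>F\<in>I. sprob E p (\<lambda>B. F \<subseteq> B \<and> boosters Z E (A \<union> F) \<inter> B = {}))"
    by (rule sprob_Ex_le[OF finI])
  also have "\<dots> \<le> (\<Sum>F\<in>I. p ^ card F * (1 - p) ^ N)"
  proof (rule sum_mono)
    fix F assume F: "F \<in> I"
    define Bo where "Bo = boosters Z E (A \<union> F)"
    have H: "A \<union> F \<subseteq> E" "simple_graph Z (A \<union> F)"
      using F A simple_graph_subset[OF G] by (auto simp: I_def)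
    \<comment> \<open>Adding an edge of \<open>F\<close> to \<open>A \<union> F\<close> changes
      nothing, and \<open>A \<union> F\<close> has neither a Hamilton cycle nor a path longer than
      all its paths. Disjointness makes the two events on \<open>B\<close> independent.\<close>
    have "F \<inter> Bo = {}"
    proof (rule ccontr)
      assume "\<not> ?thesis"
      then obtain e where e: "e \<in> F" "e \<in> Bo" by blast
      then have "insert e (A \<union> F) = A \<union> F" by blast
      then show False using e F unfolding Bo_def boosters_def I_def by auto
    qed
    then have "sprob E p (\<lambda>B. F \<subseteq> B \<and> Bo \<inter> B = {}) = p ^ card F * (1 - p) ^ card Bo"
      by (intro sprob_subset_avoid fin p) (use F in \<open>auto simp: I_def Bo_def boosters_def\<close>)
    moreover have "N \<le> card Bo"
    proof -
      have "(c - g) * c \<le> 4 * card Bo"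
        unfolding Bo_def
        by (rule card_boosters[OF H(2) G ne _ _ c dense])
          (use A H expands_mono[of Z A c "A \<union> F"] graph_connected_mono[of Z A "A \<union> F"] in auto)
      then have "real ((c - g) * c) \<le> 4 * real (card Bo)" by linarith
      then show ?thesis using N by linarith
    qed
    then have "(1 - p) ^ card Bo \<le> (1 - p) ^ N" using p by (intro power_decreasing) auto
    ultimately show "sprob E p (\<lambda>B. F \<subseteq> B \<and> boosters Z E (A \<union> F) \<inter> B = {}) \<le> p ^ card F * (1 - p) ^ N"
      using p by (simp add: Bo_def mult_left_mono)
  qed
  \<comment> \<open>As \<open>card F \<le> card Z\<close>, a factor \<open>x ^ card F\<close> may be
    traded for \<open>x ^ card Z\<close>. The sum can then be extended to all subsets of
    \<open>E\<close>, where the binomial theorem evaluates it.\<close>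
  also have "\<dots> \<le> (\<Sum>F\<in>I. (x ^ card Z * (p / x) ^ card F) * (1 - p) ^ N)"
  proof (intro sum_mono mult_right_mono)
    fix F assume "F \<in> I"
    then have "x ^ card F \<le> x ^ card Z" using x by (intro power_increasing) (auto simp: I_def)
    then have "x ^ card F * (p / x) ^ card F \<le> x ^ card Z * (p / x) ^ card F"
      using p x by (intro mult_right_mono) auto
    moreover have "x ^ card F * (p / x) ^ card F = p ^ card F" using x by (simp add: power_divide)
    ultimately show "p ^ card F \<le> x ^ card Z * (p / x) ^ card F" by simp
  qed (use p in auto)
  also have "\<dots> \<le> (\<Sum>F\<in>Pow E. (x ^ card Z * (p / x) ^ card F) * (1 - p) ^ N)"
    by (rule sum_mono2) (use fin p x in \<open>auto simp: I_def\<close>)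
  also have "\<dots> = x ^ card Z * (1 + p / x) ^ card E * (1 - p) ^ N"
    by (simp add: sum_distrib_left[symmetric] sum_distrib_right[symmetric] sum_Pow_power[OF fin(1)])
  finally show ?thesis .
qed

section \<open>Hamilton cycles in nearly complete graphs\<close>

lemma card_nbrs:
  assumes "simple_graph V E"
  shows "card (nbrs E v) = card {e \<in> E. v \<in> e}"
proof -
  have "inj_on (\<lambda>u. {v, u}) (nbrs E v)" by (auto simp: inj_on_def doubleton_eq_iff)
  moreover have "(\<lambda>u. {v, u}) ` nbrs E v = {e \<in> E. v \<in> e}"
  proof
    show "(\<lambda>u. {v, u}) ` nbrs E v \<subseteq> {e \<in> E. v \<in> e}" by (auto simp: nbrs_def)
    show "{e \<in> E. v \<in> e} \<subseteq> (\<lambda>u. {v, u}) ` nbrs E v"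
    proof
      fix e assume e: "e \<in> {e \<in> E. v \<in> e}"
      then have "card e = 2" using assms by (auto simp: simple_graph_def)
      then obtain a b where "e = {a, b}" by (meson card_2_iff)
      then show "e \<in> (\<lambda>u. {v, u}) ` nbrs E v" using e by (auto simp: nbrs_def insert_commute)
    qed
  qed
  ultimately show ?thesis by (metis card_image)
qed

text \<open>Chernoff with \<open>x = \<alpha> / 8\<close>: the moment term is at most
  \<open>k powr (- (1 + \<alpha> / 2))\<close>, and \<open>\<eta>\<close> is chosen so that dividing
  by \<open>x ^ r\<close> costs at most \<open>k powr (\<alpha> / 4)\<close>. The remaining exponent
  \<open>1 + \<alpha> / 4\<close> survives the union bound over \<open>k + 1\<close> vertices; here
  the density has to exceed \<open>ln k / k\<close> by a constant factor.\<close>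

lemma eventually_min_degree:
  fixes \<alpha> e :: real
  assumes \<alpha>: "0 < \<alpha>" "\<alpha> \<le> 1" and e: "e > 0"
  shows "\<forall>\<^sub>F k in sequentially. \<forall>(Z :: 'a set) E p. simple_graph Z E \<longrightarrow> card Z \<le> k + 1 \<longrightarrow>
     (\<forall>v\<in>Z. (1 - \<alpha> / 8) * real k \<le> real (card (nbrs E v))) \<longrightarrow> p \<in> {0..1} \<longrightarrow> (1 + \<alpha>) * ln (real k) / real k \<le> p \<longrightarrow>
     sprob E p (\<lambda>A. \<forall>v\<in>Z. \<alpha> / 4 / ln (8 / \<alpha>) * ln (real k) < real (card (nbrs A v))) \<ge> 1 - e"
proof -
  define \<eta> where "\<eta> = \<alpha> / 4 / ln (8 / \<alpha>)"
  define x where "x = \<alpha> / 8"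
  have x: "0 < x" "x \<le> 1" using \<alpha> by (auto simp: x_def)
  have lnx: "ln (8 / \<alpha>) > 0" using \<alpha> by simp
  have "((\<lambda>k. (real k + 1) * exp (- (1 + \<alpha> / 4) * ln (real k))) \<longlongrightarrow> 0) sequentially"
    using \<alpha> by real_asymp
  then have "\<forall>\<^sub>F k in sequentially. (real k + 1) * exp (- (1 + \<alpha> / 4) * ln (real k)) < e"
    by (rule order_tendstoD) (use e in auto)
  then show ?thesis
    using eventually_gt_at_top[of 1]
  proof eventually_elim
    case (elim k)
    show ?case
    proof (intro allI impI)
      fix Z :: "'a set" and E p
      assume a: "simple_graph Z E" "card Z \<le> k + 1" "\<forall>v\<in>Z. (1 - \<alpha> / 8) * real k \<le> real (card (nbrs E v))"
        "p \<in> {0..1}" "(1 + \<alpha>) * ln (real k) / real k \<le> p"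
      have fin: "finite Z" "finite E" using simple_graph_finite a by auto
      have k: "real k > 1" using elim(2) by simp
      have lnk: "ln (real k) > 0" using k by simp
      have one: "sprob E p (\<lambda>A. real (card (nbrs A v)) \<le> \<eta> * ln (real k)) \<le> exp (- (1 + \<alpha> / 4) * ln (real k))"
        if v: "v \<in> Z" for v
      proof -
        define T where "T = {e \<in> E. v \<in> e}"
        define r where "r = nat \<lfloor>\<eta> * ln (real k)\<rfloor>"
        have "\<eta> * ln (real k) \<ge> 0" using \<alpha> lnx lnk by (simp add: \<eta>_def)
        then have r: "real r \<le> \<eta> * ln (real k)" "\<And>n. real n \<le> \<eta> * ln (real k) \<Longrightarrow> n \<le> r"
          by (auto simp: r_def le_nat_floor)
        have "sprob E p (\<lambda>A. real (card (nbrs A v)) \<le> \<eta> * ln (real k)) \<le> sprob E p (\<lambda>A. card (A \<inter> T) \<le> r)"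
        proof (rule sprob_mono[OF fin(2)])
          fix A assume A: "A \<subseteq> E" "real (card (nbrs A v)) \<le> \<eta> * ln (real k)"
          have "A \<inter> T = {e \<in> A. v \<in> e}" using A by (auto simp: T_def)
          then show "card (A \<inter> T) \<le> r"
            using card_nbrs[OF simple_graph_subset[OF a(1) A(1)], of v] r(2) A(2) by simp
        qed
        also have "\<dots> = sprob T p (\<lambda>A. card A \<le> r)"
          by (rule sprob_restrict) (use fin in \<open>auto simp: T_def\<close>)
        also have "\<dots> \<le> exp (\<alpha> / 4 * ln (real k)) * exp (- (1 + \<alpha> / 2) * ln (real k))"
        proof -
          have cT: "real (card T) \<ge> (1 - \<alpha> / 8) * real k" using bspec[OF a(3) v] unfolding T_def card_nbrs[OF a(1), of v] .
          have "sprob T p (\<lambda>A. card A \<le> r) * x ^ r \<le> (1 - p + p * x) ^ card T"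
            by (rule sprob_card_le) (use a x fin in \<open>auto simp: T_def\<close>)
          also have "\<dots> = (1 - p * (1 - x)) ^ card T" by (simp add: algebra_simps)
          also have "\<dots> \<le> exp (- (p * (1 - x)) * ((1 - \<alpha> / 8) * real k))"
            by (rule one_minus_power_le_exp) (use a x cT in \<open>auto simp: mult_le_one\<close>)
          also have "\<dots> = exp (- ((1 - x) * (1 - \<alpha> / 8)) * (p * real k))"
          proof -
            have "- (p * u) * (w * v) = - (u * w) * (p * v)" for u v w :: real by (simp add: algebra_simps)
            then show ?thesis by metis
          qed
          also have "\<dots> \<le> exp (- ((1 - x) * (1 - \<alpha> / 8)) * ((1 + \<alpha>) * ln (real k)))"
          proof -
            have "(1 + \<alpha>) * ln (real k) \<le> p * real k" using a(5) k by (simp add: field_simps)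
            then have "((1 - x) * (1 - \<alpha> / 8)) * ((1 + \<alpha>) * ln (real k)) \<le> ((1 - x) * (1 - \<alpha> / 8)) * (p * real k)"
              using x \<alpha> by (intro mult_left_mono) auto
            then show ?thesis by simp
          qed
          also have "\<dots> \<le> exp (- (1 + \<alpha> / 2) * ln (real k))"
          proof -
            have "\<alpha> * \<alpha> \<le> \<alpha> * 1" using \<alpha> by (intro mult_left_mono) auto
            moreover have "\<alpha> * \<alpha> * \<alpha> \<ge> 0" using \<alpha> by simp
            moreover have "(1 - x) * (1 - \<alpha> / 8) * (1 + \<alpha>) = 1 + 3 * \<alpha> / 4 - 15 * (\<alpha> * \<alpha>) / 64 + \<alpha> * \<alpha> * \<alpha> / 64"
              by (simp add: x_def field_simps)
            ultimately have "1 + \<alpha> / 2 \<le> (1 - x) * (1 - \<alpha> / 8) * (1 + \<alpha>)"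
              using \<alpha> by linarith
            then have "(1 + \<alpha> / 2) * ln (real k) \<le> (1 - x) * (1 - \<alpha> / 8) * (1 + \<alpha>) * ln (real k)"
              using lnk by (intro mult_right_mono) auto
            then show ?thesis by (simp only: exp_le_cancel_iff mult_minus_left neg_le_iff_le mult.assoc)
          qed
          finally have 1: "sprob T p (\<lambda>A. card A \<le> r) * x ^ r \<le> exp (- (1 + \<alpha> / 2) * ln (real k))" .
          have "x ^ r = exp (real r * ln x)" using x by (simp add: exp_of_nat_mult)
          also have "\<dots> = exp (- (real r * ln (8 / \<alpha>)))" using \<alpha> by (simp add: x_def ln_div algebra_simps)
          also have "\<dots> \<ge> exp (- (\<alpha> / 4 * ln (real k)))"
          proof -
            have "real r * ln (8 / \<alpha>) \<le> \<eta> * ln (real k) * ln (8 / \<alpha>)" using r lnx by (intro mult_right_mono) auto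
            also have "\<dots> = \<alpha> / 4 * ln (real k)" using lnx by (simp add: \<eta>_def field_simps)
            finally show ?thesis by simp
          qed
          finally have "exp (- (\<alpha> / 4 * ln (real k))) \<le> x ^ r" .
          then have "sprob T p (\<lambda>A. card A \<le> r) * exp (- (\<alpha> / 4 * ln (real k))) \<le> exp (- (1 + \<alpha> / 2) * ln (real k))"
            using 1 mult_left_mono[of "exp (- (\<alpha> / 4 * ln (real k)))" "x ^ r" "sprob T p (\<lambda>A. card A \<le> r)"] by simp
          then show ?thesis by (simp add: exp_minus field_simps)
        qed
        also have "\<dots> = exp (- (1 + \<alpha> / 4) * ln (real k))" by (simp add: exp_add[symmetric] field_simps)
        finally show ?thesis .
      qed
      have "sprob E p (\<lambda>A. \<exists>v\<in>Z. real (card (nbrs A v)) \<le> \<eta> * ln (real k)) \<le> real (card Z) * exp (- (1 + \<alpha> / 4) * ln (real k))"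
        by (rule sprob_Ex_le_const[OF fin(1) one])
      also have "\<dots> \<le> (real k + 1) * exp (- (1 + \<alpha> / 4) * ln (real k))"
        using a(2) by (intro mult_right_mono) auto
      also have "\<dots> < e" by (rule elim(1))
      finally have "sprob E p (\<lambda>A. \<not> (\<exists>v\<in>Z. real (card (nbrs A v)) \<le> \<eta> * ln (real k))) \<ge> 1 - e"
        unfolding sprob_not by simp
      then show "sprob E p (\<lambda>A. \<forall>v\<in>Z. \<alpha> / 4 / ln (8 / \<alpha>) * ln (real k) < real (card (nbrs A v))) \<ge> 1 - e"
        by (simp add: \<eta>_def not_le)
    qed
  qed
qed

section \<open>Sparsity of small sets, expansion and connectedness\<close>

lemma mult_exp_le: "s * exp u \<le> v \<Longrightarrow> s \<le> v * exp (- u)" for s u v :: real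
  by (simp add: exp_minus field_simps)

lemma sum_powers_le:
  fixes z :: real
  assumes "0 \<le> z" "z \<le> 1 / 2"
  shows "(\<Sum>t\<in>{1..n}. z ^ t) \<le> 2 * z"
proof -
  have "(\<Sum>t\<in>{1..n}. z ^ t) \<le> 2 * z * (1 - (1 / 2) ^ n)"
  proof (induction n)
    case (Suc n)
    have "z ^ Suc n \<le> z * (1 / 2) ^ n" using assms by (simp add: mult_left_mono power_mono)
    then show ?case using Suc by (simp add: algebra_simps)
  qed simp
  also have "\<dots> \<le> 2 * z * 1" using assms by (intro mult_left_mono) auto
  finally show ?thesis by simp
qed

text \<open>A single term of the binomial expansion of \<open>(1 + z) ^ card Z\<close>. With
  \<open>z = t / k\<close> it replaces the usual estimate of binomial coefficients.\<close>

lemma card_subsets_le: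
  fixes z :: real
  assumes "finite Z" "z \<ge> 0"
  shows "real (card {T. T \<subseteq> Z \<and> card T = t}) * z ^ t \<le> exp (z * real (card Z))"
proof -
  have "real (card {T. T \<subseteq> Z \<and> card T = t}) * z ^ t = (\<Sum>T\<in>{T. T \<subseteq> Z \<and> card T = t}. z ^ card T)" by simp
  also have "\<dots> \<le> (\<Sum>T\<in>Pow Z. z ^ card T)" by (rule sum_mono2) (use assms in auto)
  also have "\<dots> = (1 + z) ^ card Z" by (rule sum_Pow_power[OF assms(1)])
  also have "\<dots> \<le> exp z ^ card Z" using assms by (intro power_mono) auto
  finally show ?thesis by (simp add: exp_of_nat2_mult)
qed

lemma card_edges_le:
  assumes "simple_graph V E" "finite T"
  shows "card {e \<in> E. e \<subseteq> T} \<le> card T * card T"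
proof -
  have "{e \<in> E. e \<subseteq> T} \<subseteq> (\<lambda>(a, b). {a, b}) ` (T \<times> T)"
  proof
    fix e assume e: "e \<in> {e \<in> E. e \<subseteq> T}"
    then have "card e = 2" using assms by (auto simp: simple_graph_def)
    then obtain a b where "e = {a, b}" by (meson card_2_iff)
    then show "e \<in> (\<lambda>(a, b). {a, b}) ` (T \<times> T)" using e by auto
  qed
  then have "card {e \<in> E. e \<subseteq> T} \<le> card ((\<lambda>(a, b). {a, b}) ` (T \<times> T))"
    using assms by (intro card_mono) auto
  also have "\<dots> \<le> card (T \<times> T)" using assms by (intro card_image_le) auto
  finally show ?thesis by (simp add: card_cartesian_product)
qed

text \<open>Union bound over the sets of size \<open>t\<close>: with \<open>y = ln (k / t)\<close>
  there are at most \<open>exp (t * (2 + y))\<close> of them, and each is too dense with probability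
  at most \<open>exp (- \<theta> * t * ln k * y / 2)\<close>. The product is at most
  \<open>k powr (- \<theta> * t / 4)\<close>, and the sum over \<open>t\<close> is
  geometric.\<close>

lemma eventually_sparse:
  fixes \<theta> e :: real
  assumes \<theta>: "0 < \<theta>" "\<theta> \<le> 1" and e: "e > 0"
  shows "\<forall>\<^sub>F k in sequentially. \<forall>(Z :: 'a set) E p. simple_graph Z E \<longrightarrow> real (card Z) \<le> 2 * real k \<longrightarrow>
     p \<in> {0..1} \<longrightarrow> p \<le> 2 * ln (real k) / real k \<longrightarrow>
     sprob E p (\<lambda>A. \<forall>T\<subseteq>Z. T \<noteq> {} \<longrightarrow> real (card T) \<le> exp (- 2 * ln (4 / \<theta>) - 2) * real k \<longrightarrow>
       real (card {e \<in> A. e \<subseteq> T}) < \<theta> * real (card T) * ln (real k)) \<ge> 1 - e"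
proof -
  define c where "c = exp (- 2 * ln (4 / \<theta>) - 2)"
  have "((\<lambda>k. exp (- (\<theta> / 4) * ln (real k))) \<longlongrightarrow> 0) sequentially"
    using \<theta> by real_asymp
  then have "\<forall>\<^sub>F k in sequentially. exp (- (\<theta> / 4) * ln (real k)) < min (1 / 2) (e / 2)"
    by (rule order_tendstoD) (use e in auto)
  moreover have "\<forall>\<^sub>F k in sequentially. \<theta> / 4 * ln (real k) \<ge> 3"
    using \<theta> by real_asymp
  ultimately show ?thesis
    using eventually_gt_at_top[of 1]
  proof eventually_elim
    case (elim k)
    show ?case
    proof (intro allI impI)
      fix Z :: "'a set" and E p
      assume a: "simple_graph Z E" "real (card Z) \<le> 2 * real k" "p \<in> {0..1}" "p \<le> 2 * ln (real k) / real k"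
      have fin: "finite Z" "finite E" using simple_graph_finite a by auto
      have k: "real k > 1" using elim(3) by simp
      have lnk: "ln (real k) > 0" using k by simp
      define bad where "bad T A \<longleftrightarrow> real (card {e \<in> A. e \<subseteq> T}) \<ge> \<theta> * real (card T) * ln (real k)" for T :: "'a set" and A
      have one: "sprob E p (\<lambda>A. \<exists>T\<in>{T. T \<subseteq> Z \<and> card T = t}. bad T A) \<le> exp (- (\<theta> / 4) * ln (real k)) ^ t"
        if t: "1 \<le> t" "real t \<le> c * real k" for t
      proof -
        define y where "y = ln (real k / real t)"
        \<comment> \<open>This Chernoff parameter gives
          \<open>p * x * t^2 \<le> \<theta> * t * ln k / 2\<close>. From
          \<open>t \<le> c * k\<close> one has \<open>y \<ge> 2 * ln (4 / \<theta>) + 2\<close>, so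
          \<open>ln x = y - ln (4 / \<theta>)\<close> minus the lost \<open>1 / 2\<close> is still
          at least \<open>y / 2\<close>.\<close>
        define x where "x = \<theta> * real k / (4 * real t)"
        have tpos: "real t > 0" using t by simp
        have ey: "exp y = real k / real t" using tpos k by (simp add: y_def)
        have y: "y \<ge> 2 * ln (4 / \<theta>) + 2"
        proof -
          have "exp (2 * ln (4 / \<theta>) + 2) = 1 / c" by (simp add: c_def exp_minus[symmetric] inverse_eq_divide[symmetric])
          also have "\<dots> \<le> real k / real t" using t tpos k by (simp add: c_def field_simps)
          finally show ?thesis unfolding ey[symmetric] by simp
        qed
        have l4: "ln (4 / \<theta>) \<ge> 0" using \<theta> by simp
        have xe: "x = exp (y - ln (4 / \<theta>))"
        proof -
          have "exp (y - ln (4 / \<theta>)) = (real k / real t) / (4 / \<theta>)" using \<theta> ey by (simp add: exp_diff)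
          then show ?thesis by (simp add: x_def field_simps)
        qed
        have x1: "x \<ge> 1" unfolding xe using y l4 by simp
        have each: "sprob E p (bad T) \<le> exp (- (\<theta> * real t * ln (real k)) * (y / 2))" if T: "T \<subseteq> Z" "card T = t" for T
        proof -
          define W where "W = {e \<in> E. e \<subseteq> T}"
          define r where "r = nat \<lceil>\<theta> * real t * ln (real k)\<rceil>"
          have r: "real r \<ge> \<theta> * real t * ln (real k)" "\<And>n. real n \<ge> \<theta> * real t * ln (real k) \<Longrightarrow> n \<ge> r"
            by (auto simp: r_def ceiling_le_iff) linarith
          have finT: "finite T" using T fin finite_subset by blast
          have cW: "real (card W) \<le> real t * real t"
            unfolding W_def using card_edges_le[OF a(1) finT] T(2) of_nat_mono by fastforce
          have "sprob E p (bad T) \<le> sprob E p (\<lambda>A. card (A \<inter> W) \<ge> r)"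
          proof (rule sprob_mono[OF fin(2)])
            fix A assume A: "A \<subseteq> E" "bad T A"
            have "A \<inter> W = {e \<in> A. e \<subseteq> T}" using A by (auto simp: W_def)
            then show "card (A \<inter> W) \<ge> r" using A(2) r(2) T(2) by (simp add: bad_def)
          qed
          also have "\<dots> = sprob W p (\<lambda>A. card A \<ge> r)"
            by (rule sprob_restrict) (use fin in \<open>auto simp: W_def\<close>)
          also have "\<dots> \<le> exp (\<theta> * real t * ln (real k) / 2) * exp (- (\<theta> * real t * ln (real k)) * (y - ln (4 / \<theta>)))"
          proof -
            have "sprob W p (\<lambda>A. card A \<ge> r) * x ^ r \<le> (1 - p + p * x) ^ card W"
              by (rule sprob_card_ge) (use a x1 fin in \<open>auto simp: W_def\<close>)
            also have "\<dots> \<le> exp (p * x) ^ card W"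
            proof (rule power_mono)
              have "0 \<le> p" using a(3) by simp
              then show "1 - p + p * x \<le> exp (p * x)" using exp_ge_add_one_self[of "p * x"] by linarith
            qed (use a x1 in auto)
            also have "\<dots> = exp (p * x * real (card W))" by (simp add: exp_of_nat2_mult)
            also have "\<dots> \<le> exp (\<theta> * real t * ln (real k) / 2)"
            proof -
              have "p * x * real (card W) \<le> (2 * ln (real k) / real k) * x * (real t * real t)"
                by (intro mult_mono cW a) (use a x1 lnk in auto)
              also have "\<dots> = \<theta> * real t * ln (real k) / 2" using k tpos by (simp add: x_def field_simps)
              finally show ?thesis by simp
            qed
            finally have 1: "sprob W p (\<lambda>A. card A \<ge> r) * x ^ r \<le> exp (\<theta> * real t * ln (real k) / 2)" .
            have "exp (\<theta> * real t * ln (real k) * (y - ln (4 / \<theta>))) \<le> exp (real r * (y - ln (4 / \<theta>)))"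
              using r y l4 by (auto intro!: mult_right_mono)
            also have "\<dots> = x ^ r" by (simp add: xe exp_of_nat_mult)
            finally have "sprob W p (\<lambda>A. card A \<ge> r) * exp (\<theta> * real t * ln (real k) * (y - ln (4 / \<theta>))) \<le> exp (\<theta> * real t * ln (real k) / 2)"
              using 1 mult_left_mono[of _ "x ^ r" "sprob W p (\<lambda>A. card A \<ge> r)"] by (meson order_trans sprob_nonneg)
            then show ?thesis using mult_exp_le by fastforce
          qed
          also have "\<dots> = exp (- (\<theta> * real t * ln (real k)) * (y - ln (4 / \<theta>) - 1 / 2))"
            by (simp add: exp_add[symmetric] algebra_simps)
          also have "\<dots> \<le> exp (- (\<theta> * real t * ln (real k)) * (y / 2))"
          proof -
            have "y / 2 \<le> y - ln (4 / \<theta>) - 1 / 2" using y by simp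
            then have "(\<theta> * real t * ln (real k)) * (y / 2) \<le> (\<theta> * real t * ln (real k)) * (y - ln (4 / \<theta>) - 1 / 2)"
              using \<theta> lnk by (intro mult_left_mono) auto
            then show ?thesis by simp
          qed
          finally show ?thesis .
        qed
        have "sprob E p (\<lambda>A. \<exists>T\<in>{T. T \<subseteq> Z \<and> card T = t}. bad T A) \<le>
           real (card {T. T \<subseteq> Z \<and> card T = t}) * exp (- (\<theta> * real t * ln (real k)) * (y / 2))"
          by (rule sprob_Ex_le_const) (use fin each in auto)
        also have "\<dots> \<le> exp (real t * (2 + y)) * exp (- (\<theta> * real t * ln (real k)) * (y / 2))"
        proof (rule mult_right_mono)
          have "(real t / real k) ^ t = exp (- y) ^ t" using ey by (simp add: exp_minus)
          also have "\<dots> = exp (- (real t * y))" by (simp add: exp_of_nat_mult[symmetric])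
          finally have "real (card {T. T \<subseteq> Z \<and> card T = t}) * exp (- (real t * y)) \<le> exp (real t / real k * real (card Z))"
            using card_subsets_le[OF fin(1), of "real t / real k" t] by simp
          also have "\<dots> \<le> exp (real t / real k * (2 * real k))"
            using mult_left_mono[OF a(2), of "real t / real k"] by simp
          also have "\<dots> = exp (2 * real t)" using k by simp
          finally have "real (card {T. T \<subseteq> Z \<and> card T = t}) \<le> exp (2 * real t) * exp (real t * y)"
            by (simp add: exp_minus field_simps)
          then show "real (card {T. T \<subseteq> Z \<and> card T = t}) \<le> exp (real t * (2 + y))"
            by (simp add: exp_add[symmetric] algebra_simps)
        qed simp
        also have "\<dots> = exp (real t * (2 + y - 2 * (\<theta> / 4 * ln (real k)) * y))"
          by (simp add: exp_add[symmetric] algebra_simps)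
        also have "\<dots> \<le> exp (real t * (- (\<theta> / 4 * ln (real k))))"
        proof -
          have y1: "y \<ge> 1" using y l4 by simp
          have lin: "2 + y - 2 * w * y \<le> - w" if "w \<ge> 3" for w
          proof -
            have "w * y \<ge> 3 * y" "w * y \<ge> w * 1"
              using that y1 by (auto intro!: mult_right_mono mult_left_mono)
            moreover have "2 * w * y = 2 * (w * y)" by simp
            ultimately show ?thesis using y1 by linarith
          qed
          have "2 + y - 2 * (\<theta> / 4 * ln (real k)) * y \<le> - (\<theta> / 4 * ln (real k))"
            by (rule lin[OF elim(2)])
          then have "real t * (2 + y - 2 * (\<theta> / 4 * ln (real k)) * y) \<le> real t * (- (\<theta> / 4 * ln (real k)))"
            using tpos by (intro mult_left_mono) auto
          then show ?thesis by (simp only: exp_le_cancel_iff)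
        qed
        also have "\<dots> = exp (- (\<theta> / 4) * ln (real k)) ^ t" by (simp add: exp_of_nat_mult[symmetric])
        finally show ?thesis .
      qed
      define n where "n = nat \<lfloor>c * real k\<rfloor>"
      have n: "real t \<le> c * real k \<longleftrightarrow> t \<le> n" for t
      proof -
        have "c * real k \<ge> 0" by (simp add: c_def)
        then show ?thesis by (simp add: n_def le_nat_iff le_floor_iff)
      qed
      have "sprob E p (\<lambda>A. \<exists>t\<in>{1..n}. \<exists>T\<in>{T. T \<subseteq> Z \<and> card T = t}. bad T A) \<le> (\<Sum>t\<in>{1..n}. sprob E p (\<lambda>A. \<exists>T\<in>{T. T \<subseteq> Z \<and> card T = t}. bad T A))"
        by (rule sprob_Ex_le) simp
      also have "\<dots> \<le> (\<Sum>t\<in>{1..n}. exp (- (\<theta> / 4) * ln (real k)) ^ t)"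
        by (intro sum_mono one) (use n in auto)
      also have "\<dots> \<le> 2 * exp (- (\<theta> / 4) * ln (real k))"
        by (rule sum_powers_le) (use elim(1) in auto)
      also have "\<dots> \<le> e" using elim(1) by auto
      finally have "1 - e \<le> sprob E p (\<lambda>A. \<not> (\<exists>t\<in>{1..n}. \<exists>T\<in>{T. T \<subseteq> Z \<and> card T = t}. bad T A))"
        unfolding sprob_not by simp
      also have "\<dots> \<le> sprob E p (\<lambda>A. \<forall>T\<subseteq>Z. T \<noteq> {} \<longrightarrow> real (card T) \<le> c * real k \<longrightarrow>
          real (card {e \<in> A. e \<subseteq> T}) < \<theta> * real (card T) * ln (real k))"
      proof (rule sprob_mono[OF fin(2)], intro allI impI)
        fix A T
        assume *: "\<not> (\<exists>t\<in>{1..n}. \<exists>T\<in>{T. T \<subseteq> Z \<and> card T = t}. bad T A)" "T \<subseteq> Z" "T \<noteq> {}" "real (card T) \<le> c * real k"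
        have "finite T" using *(2) fin(1) by (rule finite_subset)
        then have "card T \<in> {1..n}" using *(3,4) n by (auto simp: Suc_le_eq card_gt_0_iff)
        then have "\<not> bad T A" using * by blast
        then show "real (card {e \<in> A. e \<subseteq> T}) < \<theta> * real (card T) * ln (real k)" by (simp add: bad_def not_le)
      qed
      finally show "1 - e \<le> sprob E p (\<lambda>A. \<forall>T\<subseteq>Z. T \<noteq> {} \<longrightarrow> real (card T) \<le> exp (- 2 * ln (4 / \<theta>) - 2) * real k \<longrightarrow>
          real (card {e \<in> A. e \<subseteq> T}) < \<theta> * real (card T) * ln (real k))"
        by (simp add: c_def)
    qed
  qed
qed

text \<open>If \<open>S\<close> had at most \<open>2 * card S\<close> outer neighbours, adding them
  would give a set \<open>T\<close> with at most \<open>3 * card S\<close> vertices that contains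
  every edge at \<open>S\<close>. An edge contributes at most \<open>4\<close> ordered pairs, so
  \<open>h * card S \<le> 4 * card I < 4 * (h / 12) * (3 * card S)\<close>, a contradiction. Hence
  \<open>12 = 4 * 3\<close> and the bound \<open>c1 * l / 3\<close>.\<close>

lemma sparse_expands:
  assumes G: "simple_graph Z A" and c: "real c \<le> c1 * l / 3" and h: "h > 0"
    and deg: "\<And>v. v \<in> Z \<Longrightarrow> h < real (card (nbrs A v))"
    and sparse: "\<And>T. T \<subseteq> Z \<Longrightarrow> T \<noteq> {} \<Longrightarrow> real (card T) \<le> c1 * l \<Longrightarrow> real (card {e \<in> A. e \<subseteq> T}) < h / 12 * real (card T)"
  shows "expands Z A c"
  unfolding expands_def
proof (intro allI impI)
  fix S assume S: "S \<subseteq> Z" "S \<noteq> {}" "card S \<le> c"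
  have finS: "finite S" using S G simple_graph_finite finite_subset by metis
  define N where "N = (\<Union>x\<in>S. nbrs A x)"
  have finN: "finite N" using finS finite_nbrs[OF G] by (auto simp: N_def)
  show "2 * card S < card ((\<Union>x\<in>S. nbrs A x) - S)"
  proof (rule ccontr)
    assume "\<not> ?thesis"
    then have small: "card (N - S) \<le> 2 * card S" by (simp add: N_def)
    define T where "T = S \<union> (N - S)"
    have finT: "finite T" using finS finN by (simp add: T_def)
    have T: "T \<subseteq> Z" "T \<noteq> {}" using S nbrs_subset[OF G] by (auto simp: T_def N_def)
    have cT: "card T \<le> 3 * card S" using card_Un_le[of S "N - S"] small by (simp add: T_def)
    have "3 * real (card S) \<le> 3 * real c" using S(3) by simp
    then have cTr: "real (card T) \<le> c1 * l" using cT c by linarith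
    define I where "I = {e \<in> A. e \<subseteq> T}"
    have finI: "finite I" using simple_graph_finite(2)[OF G] by (simp add: I_def)
    have "h * real (card S) \<le> (\<Sum>v\<in>S. real (card (nbrs A v)))"
      using sum_bounded_below[of S h "\<lambda>v. real (card (nbrs A v))"] deg S(1) less_imp_le
      by (fastforce simp: mult.commute)
    also have "\<dots> = real (card (SIGMA v:S. nbrs A v))"
      using finS finite_nbrs[OF G] by (subst card_SigmaI) auto
    also have "\<dots> \<le> real (4 * card I)"
    proof -
      have "card (SIGMA v:S. nbrs A v) \<le> card (\<Union>e\<in>I. e \<times> e)"
      proof (rule card_mono)
        show "finite (\<Union>e\<in>I. e \<times> e)" using finI finT by (auto simp: I_def intro: finite_subset)
        show "(SIGMA v:S. nbrs A v) \<subseteq> (\<Union>e\<in>I. e \<times> e)"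
          by (auto simp: I_def T_def N_def nbrs_def intro!: bexI[of _ "{_, _}"])
      qed
      also have "\<dots> \<le> (\<Sum>e\<in>I. card (e \<times> e))" by (rule card_UN_le[OF finI])
      also have "\<dots> \<le> 4 * card I"
      proof -
        have "card (e \<times> e) \<le> 4" if "e \<in> I" for e
          using that G by (auto simp: I_def simple_graph_def card_cartesian_product)
        then show ?thesis using sum_bounded_above[of I "\<lambda>e. card (e \<times> e)" 4] by simp
      qed
      finally show ?thesis by linarith
    qed
    also have "\<dots> < 4 * (h / 12 * real (card T))"
      using sparse[OF T cTr] by (simp add: I_def)
    also have "\<dots> \<le> h * real (card S)"
      using cT h by simp
    finally show False by simp
  qed
qed

lemma cut_commute: "cut E A B = cut E B A"
  by (auto simp: cut_def insert_commute)

text \<open>Small sets have neighbours outside by expansion. Of a set and its complement, which have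
  the same cut, one contains at most half of the vertices; so \<open>big\<close> is asked only up to
  that size.\<close>

lemma expands_connected:
  assumes G: "simple_graph Z A" and exp: "expands Z A c"
    and big: "\<And>S. S \<subseteq> Z \<Longrightarrow> c < card S \<Longrightarrow> 2 * card S \<le> card Z \<Longrightarrow> cut A S (Z - S) \<noteq> {}"
  shows "graph_connected Z A"
proof -
  have finZ: "finite Z" using simple_graph_finite G by auto
  have half: "cut A S (Z - S) \<noteq> {}" if S: "S \<subseteq> Z" "S \<noteq> {}" "2 * card S \<le> card Z" for S
  proof (cases "card S \<le> c")
    case True
    then have "2 * card S < card ((\<Union>x\<in>S. nbrs A x) - S)" using exp S unfolding expands_def by blast
    then have "(\<Union>x\<in>S. nbrs A x) - S \<noteq> {}" by (metis card.empty not_less_zero)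
    then obtain x y where "x \<in> S" "y \<in> nbrs A x" "y \<notin> S" by blast
    moreover have "y \<in> Z" using calculation nbrs_subset[OF G] by blast
    ultimately have "{x, y} \<in> cut A S (Z - S)" by (auto simp: cut_def nbrs_def)
    then show ?thesis by blast
  qed (use big S in auto)
  show ?thesis
    unfolding graph_connected_def
  proof (intro allI impI)
    fix S assume S: "S \<subseteq> Z" "S \<noteq> {}" "S \<noteq> Z"
    show "cut A S (Z - S) \<noteq> {}"
    proof (cases "2 * card S \<le> card Z")
      case False
      have "card (Z - S) = card Z - card S" using S finZ by (simp add: card_Diff_subset finite_subset)
      then have "cut A (Z - S) (Z - (Z - S)) \<noteq> {}"
        using False S by (intro half) auto
      moreover have "Z - (Z - S) = S" using S by blast
      ultimately show ?thesis by (simp add: cut_commute)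
    qed (use half S in blast)
  qed
qed

text \<open>Each vertex of \<open>S\<close> has at least
  \<open>7 / 8 * k - (k + 1) / 2 \<ge> k / 4\<close> neighbours in \<open>Z - S\<close>. An empty
  cut thus has probability at most \<open>exp (- c / 4 * k * ln k)\<close>, and there are at most
  \<open>2 ^ (k + 1)\<close> sets.\<close>

lemma eventually_cuts:
  fixes c e :: real
  assumes c: "0 < c" and e: "e > 0"
  shows "\<forall>\<^sub>F k in sequentially. \<forall>(Z :: 'a set) E p. simple_graph Z E \<longrightarrow> card Z \<le> k + 1 \<longrightarrow>
     (\<forall>v\<in>Z. 7 / 8 * real k \<le> real (card (nbrs E v))) \<longrightarrow> p \<in> {0..1} \<longrightarrow> ln (real k) / real k \<le> p \<longrightarrow>
     sprob E p (\<lambda>A. \<forall>S\<subseteq>Z. c * real k \<le> real (card S) \<longrightarrow> 2 * card S \<le> card Z \<longrightarrow> cut A S (Z - S) \<noteq> {}) \<ge> 1 - e"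
proof -
  have "((\<lambda>k. exp ((real k + 1) * ln 2 - c / 4 * (real k * ln (real k)))) \<longlongrightarrow> 0) sequentially"
    using c by real_asymp
  then have "\<forall>\<^sub>F k in sequentially. exp ((real k + 1) * ln 2 - c / 4 * (real k * ln (real k))) < e"
    by (rule order_tendstoD) (use e in auto)
  then show ?thesis
    using eventually_ge_at_top[of 4]
  proof eventually_elim
    case (elim k)
    show ?case
    proof (intro allI impI)
      fix Z :: "'a set" and E p
      assume a: "simple_graph Z E" "card Z \<le> k + 1" "\<forall>v\<in>Z. 7 / 8 * real k \<le> real (card (nbrs E v))"
        "p \<in> {0..1}" "ln (real k) / real k \<le> p"
      have fin: "finite Z" "finite E" using simple_graph_finite a by auto
      have k: "real k \<ge> 4" using elim(2) by simp
      have pk: "ln (real k) \<le> p * real k" using a(5) k by (simp add: field_simps)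
      define I where "I = {S. S \<subseteq> Z \<and> c * real k \<le> real (card S) \<and> 2 * card S \<le> card Z}"
      have finI: "finite I" using fin by (simp add: I_def)
      have one: "sprob E p (\<lambda>A. cut A S (Z - S) = {}) \<le> exp (- p * (c * real k * (real k / 4)))" if S: "S \<in> I" for S
      proof -
        define B where "B = cut E S (Z - S)"
        have finS: "finite S" using S fin finite_subset by (auto simp: I_def)
        have "real k / 4 \<le> real (card (nbrs E v \<inter> (Z - S)))" if "v \<in> S" for v
        proof -
          have "nbrs E v \<subseteq> (nbrs E v \<inter> (Z - S)) \<union> S" using nbrs_subset[OF a(1)] by auto
          then have "card (nbrs E v) \<le> card ((nbrs E v \<inter> (Z - S)) \<union> S)"
            using fin finS by (intro card_mono) auto
          then have "card (nbrs E v) \<le> card (nbrs E v \<inter> (Z - S)) + card S"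
            using card_Un_le order_trans by blast
          moreover have "7 / 8 * real k \<le> real (card (nbrs E v))" using a(3) that S by (auto simp: I_def)
          moreover have "2 * real (card S) \<le> real k + 1" using S a(2) by (simp add: I_def)
          ultimately show ?thesis using k by linarith
        qed
        then have "real (card S) * (real k / 4) \<le> (\<Sum>v\<in>S. real (card (nbrs E v \<inter> (Z - S))))"
          using sum_bounded_below[of S "real k / 4" "\<lambda>v. real (card (nbrs E v \<inter> (Z - S)))"] by simp
        also have "\<dots> = real (card B)"
          unfolding B_def by (subst card_cut[OF a(1) finS]) auto
        finally have "c * real k * (real k / 4) \<le> real (card B)"
          using S mult_right_mono[of "c * real k" "real (card S)" "real k / 4"] by (simp add: I_def)
        then have "(1 - p) ^ card B \<le> exp (- p * (c * real k * (real k / 4)))"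
          by (rule one_minus_power_le_exp[OF a(4)])
        moreover have "sprob E p (\<lambda>A. cut A S (Z - S) = {}) = sprob E p (\<lambda>A. B \<inter> A = {})"
          by (rule sprob_cong[OF fin(2)]) (auto simp: B_def cut_def)
        moreover have "sprob E p (\<lambda>A. B \<inter> A = {}) = (1 - p) ^ card B"
          by (rule sprob_avoid) (use fin a in \<open>auto simp: B_def cut_def\<close>)
        ultimately show ?thesis by simp
      qed
      have "sprob E p (\<lambda>A. \<exists>S\<in>I. cut A S (Z - S) = {}) \<le> real (card I) * exp (- p * (c * real k * (real k / 4)))"
        by (rule sprob_Ex_le_const[OF finI one])
      also have "\<dots> \<le> exp ((real k + 1) * ln 2) * exp (- p * (c * real k * (real k / 4)))"
      proof (rule mult_right_mono)
        have "card I \<le> card (Pow Z)" using fin by (intro card_mono) (auto simp: I_def)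
        then have "real (card I) \<le> 2 ^ card Z" using fin by (simp add: card_Pow)
        also have "\<dots> \<le> 2 ^ (k + 1)" using a(2) by (intro power_increasing) auto
        also have "\<dots> = exp (real (k + 1) * ln 2)" by (subst exp_of_nat_mult) simp
        finally show "real (card I) \<le> exp ((real k + 1) * ln 2)" by (simp add: add.commute)
      qed simp
      also have "\<dots> = exp ((real k + 1) * ln 2 - c / 4 * (real k * (p * real k)))"
        by (simp add: exp_add[symmetric] algebra_simps)
      also have "\<dots> \<le> exp ((real k + 1) * ln 2 - c / 4 * (real k * ln (real k)))"
        using pk c by (auto intro!: mult_left_mono)
      also have "\<dots> < e" by (rule elim(1))
      finally have "1 - e \<le> sprob E p (\<lambda>A. \<not> (\<exists>S\<in>I. cut A S (Z - S) = {}))"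
        unfolding sprob_not by simp
      also have "\<dots> \<le> sprob E p (\<lambda>A. \<forall>S\<subseteq>Z. c * real k \<le> real (card S) \<longrightarrow> 2 * card S \<le> card Z \<longrightarrow> cut A S (Z - S) \<noteq> {})"
        by (rule sprob_mono[OF fin(2)]) (auto simp: I_def)
      finally show "1 - e \<le> sprob E p (\<lambda>A. \<forall>S\<subseteq>Z. c * real k \<le> real (card S) \<longrightarrow> 2 * card S \<le> card Z \<longrightarrow> cut A S (Z - S) \<noteq> {})" .
    qed
  qed
qed

lemma ham_cycle_mono: "ham_cycle Z F \<Longrightarrow> F \<subseteq> F' \<Longrightarrow> ham_cycle Z F'"
  unfolding ham_cycle_def by (blast intro: lpath_mono)

text \<open>The density is split into \<open>1 + \<beta>\<close> and \<open>\<beta>\<close> times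
  \<open>ln k / k\<close>. The first round provides degrees of order \<open>ln k\<close> and
  sparsity, hence a connected expander; the second hits boosters. The tolerance
  \<open>\<gamma>\<close> depends on \<open>\<alpha>\<close> only and serves every error
  \<open>e\<close>.\<close>

lemma eventually_ham_cycle:
  fixes \<alpha> :: real
  assumes \<alpha>: "0 < \<alpha>" "\<alpha> \<le> 1"
  shows "\<exists>\<gamma>>0. \<gamma> \<le> 1 / 8 \<and> (\<forall>e>0. \<forall>\<^sub>F k in sequentially. \<forall>(Z :: 'a set) E p. simple_graph Z E \<longrightarrow> Z \<noteq> {} \<longrightarrow> card Z \<le> k + 1 \<longrightarrow>
     (\<forall>v\<in>Z. (1 - \<gamma>) * real k \<le> real (card (nbrs E v))) \<longrightarrow> p \<in> {0..1} \<longrightarrow> (1 + \<alpha>) * ln (real k) / real k \<le> p \<longrightarrow>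
     sprob E p (ham_cycle Z) \<ge> 1 - e)"
    (is "\<exists>\<gamma>>0. _ \<and> (\<forall>e>0. ?P \<gamma> e)")
proof -
  define \<beta> where "\<beta> = \<alpha> / 2"
  have \<beta>: "0 < \<beta>" "\<beta> \<le> 1 / 2" using \<alpha> by (auto simp: \<beta>_def)
  define \<eta> where "\<eta> = \<beta> / 4 / ln (8 / \<beta>)"
  define \<theta> where "\<theta> = \<eta> / 12"
  have "16 \<le> 8 / \<beta>" using \<beta> by (simp add: field_simps)
  then have "exp 1 \<le> 8 / \<beta>" using exp_le by linarith
  then have "ln (8 / \<beta>) \<ge> 1" using \<beta> by (simp add: ln_ge_iff)
  then have \<eta>: "0 < \<eta>" "\<eta> \<le> 1" using \<beta> by (auto simp: \<eta>_def field_simps)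
  then have \<theta>: "0 < \<theta>" "\<theta> \<le> 1" by (auto simp: \<theta>_def)
  define c1 where "c1 = exp (- 2 * ln (4 / \<theta>) - 2)"
  have c1: "c1 > 0" by (simp add: c1_def)
  \<comment> \<open>The bound \<open>\<beta> / 8\<close> is the degree loss that
    \<open>eventually_min_degree\<close> allows; \<open>c1 / 24\<close> keeps the number
    \<open>g\<close> of non-neighbours well below the number \<open>c\<close> of end points, about
    \<open>c1 * k / 3\<close>.\<close>
  define \<gamma> where "\<gamma> = min (\<beta> / 8) (c1 / 24)"
  have \<gamma>: "0 < \<gamma>" "\<gamma> \<le> \<beta> / 8" "\<gamma> \<le> c1 / 24" "\<gamma> \<le> 1 / 8" using c1 \<beta> by (auto simp: \<gamma>_def)
  have main: "?P \<gamma> e" if e: "e > 0" for e :: real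
  proof -
    have e4: "e / 4 > 0" using e by simp
    have \<beta>1: "\<beta> \<le> 1" using \<beta> by simp
    have c13: "c1 / 3 > 0" using c1 by simp
    note ev1 = eventually_min_degree[OF \<beta>(1) \<beta>1 e4, where ?'a = 'a, folded \<eta>_def]
    note ev2 = eventually_sparse[OF \<theta> e4, where ?'a = 'a, folded c1_def]
    note ev3 = eventually_cuts[OF c13 e4, where ?'a = 'a]
    have "((\<lambda>k. exp ((real k + 1) * ln (ln (real k)) + \<beta> / real k * (real k + 1)^2 - \<beta> * ln (real k) / real k * (c1^2 * real k ^ 2 / 64 - 1))) \<longlongrightarrow> 0) sequentially"
      using c1 \<beta> by real_asymp
    then have ev4: "\<forall>\<^sub>F k in sequentially. exp ((real k + 1) * ln (ln (real k)) + \<beta> / real k * (real k + 1)^2 - \<beta> * ln (real k) / real k * (c1^2 * real k ^ 2 / 64 - 1)) < e / 4"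
      by (rule order_tendstoD) (use e in auto)
    have ev5: "\<forall>\<^sub>F k in sequentially. 2 * ln (real k) / real k \<le> 1" by real_asymp
    have ev6: "\<forall>\<^sub>F k in sequentially. c1 * real k \<ge> 48" using c1 by real_asymp
    have ev7: "\<forall>\<^sub>F k in sequentially. ln (real k) \<ge> 1" by real_asymp
    show ?thesis
      using ev1 ev2 ev3 ev4 ev5 ev6 ev7 eventually_gt_at_top[of 1]
    proof eventually_elim
      case (elim k)
      show ?case
      proof (intro allI impI)
        fix Z :: "'a set" and E p
        assume a: "simple_graph Z E" "Z \<noteq> {}" "card Z \<le> k + 1" "\<forall>v\<in>Z. (1 - \<gamma>) * real k \<le> real (card (nbrs E v))"
          "p \<in> {0..1}" "(1 + \<alpha>) * ln (real k) / real k \<le> p"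
        have fin: "finite Z" "finite E" using simple_graph_finite a by auto
        have k: "real k > 1" using elim(8) by simp
        have lnk: "ln (real k) > 0" using k by simp
        \<comment> \<open>Sparsity is a decreasing property, so the first round uses exactly
          \<open>pa\<close>, however large \<open>p\<close> may be. Monotonicity in the density is
          applied at the very end, to \<open>ham_cycle\<close>.\<close>
        define pa where "pa = (1 + \<beta>) * ln (real k) / real k"
        define pb where "pb = \<beta> * ln (real k) / real k"
        have le2: "x * ln (real k) / real k \<le> 1" if "x \<le> 2" for x
        proof -
          have "x * ln (real k) / real k \<le> 2 * ln (real k) / real k"
            using that lnk k by (intro divide_right_mono mult_right_mono) auto
          then show ?thesis using elim(5) by linarith
        qed
        have pa: "pa \<in> {0..1}" "ln (real k) / real k \<le> pa" "pa \<le> 2 * ln (real k) / real k"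
          using le2[of "1 + \<beta>"] \<beta> lnk k by (auto simp: pa_def intro!: divide_right_mono)
        have pb: "pb \<in> {0..1}" using le2[of \<beta>] \<beta> lnk k by (auto simp: pb_def)
        have deg: "(1 - x) * real k \<le> real (card (nbrs E v))" if "v \<in> Z" "\<gamma> \<le> x" for v x
        proof -
          have "(1 - x) * real k \<le> (1 - \<gamma>) * real k" using that by (intro mult_right_mono) auto
          then show ?thesis using bspec[OF a(4) that(1)] by linarith
        qed
        define c where "c = nat \<lfloor>c1 * real k / 3\<rfloor>"
        have c: "real c \<le> c1 * real k / 3" "c1 * real k / 3 - 1 \<le> real c"
          using c1 k by (auto simp: c_def) linarith+
        define deg_ok where "deg_ok A \<longleftrightarrow> (\<forall>v\<in>Z. \<eta> * ln (real k) < real (card (nbrs A v)))" for A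
        define sparse where "sparse A \<longleftrightarrow> (\<forall>T\<subseteq>Z. T \<noteq> {} \<longrightarrow> real (card T) \<le> c1 * real k \<longrightarrow>
           real (card {e \<in> A. e \<subseteq> T}) < \<theta> * real (card T) * ln (real k))" for A
        define cuts where "cuts A \<longleftrightarrow> (\<forall>S\<subseteq>Z. c1 / 3 * real k \<le> real (card S) \<longrightarrow> 2 * card S \<le> card Z \<longrightarrow>
           cut A S (Z - S) \<noteq> {})" for A
        define Q1 where "Q1 A \<longleftrightarrow> deg_ok A \<and> (sparse A \<and> cuts A)" for A
        have "sprob E pa deg_ok \<ge> 1 - e / 4"
          using elim(1) a(1,3) pa(1) deg[OF _ \<gamma>(2)] by (simp add: pa_def deg_ok_def[abs_def])
        moreover have "sprob E pa sparse \<ge> 1 - e / 4"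
          using elim(2) a(1,3) pa k by (simp add: sparse_def[abs_def])
        moreover have "sprob E pa cuts \<ge> 1 - e / 4"
          using elim(3) a(1,3) pa deg[OF _ \<gamma>(4)] by (simp add: cuts_def[abs_def])
        ultimately have s1: "sprob E pa Q1 \<ge> 1 - 3 * e / 4"
          using sprob_conj_ge[of E pa deg_ok "\<lambda>A. sparse A \<and> cuts A"] sprob_conj_ge[of E pa sparse cuts]
          unfolding Q1_def[abs_def] by linarith
        have s2: "sprob E pb (\<lambda>B. ham_cycle Z (A \<union> B)) \<ge> 1 - e / 4" if A: "A \<subseteq> E" "Q1 A" for A
        proof -
          have GA: "simple_graph Z A" using simple_graph_subset[OF a(1) A(1)] .
          have exp: "expands Z A c"
          proof (rule sparse_expands[OF GA c(1)])
            show "0 < \<eta> * ln (real k)" using \<eta> lnk by simp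
            show "\<eta> * ln (real k) < real (card (nbrs A v))" if "v \<in> Z" for v
              using A(2) that by (simp add: Q1_def deg_ok_def cuts_def)
            show "real (card {e \<in> A. e \<subseteq> T}) < \<eta> * ln (real k) / 12 * real (card T)"
              if "T \<subseteq> Z" "T \<noteq> {}" "real (card T) \<le> c1 * real k" for T
              using A(2) that by (simp add: Q1_def sparse_def \<theta>_def mult.commute mult.left_commute)
          qed
          have conn: "graph_connected Z A"
          proof (rule expands_connected[OF GA exp])
            fix S assume S: "S \<subseteq> Z" "c < card S" "2 * card S \<le> card Z"
            have "c1 / 3 * real k \<le> real (card S)" using c(2) S(2) by simp
            then show "cut A S (Z - S) \<noteq> {}" using A(2) S by (simp add: Q1_def deg_ok_def cuts_def)
          qed
          define g where "g = nat \<lfloor>\<gamma> * real k + 1\<rfloor>"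
          have g: "real g \<le> \<gamma> * real k + 1" using \<gamma> k by (simp add: g_def)
          have \<gamma>k: "\<gamma> * real k \<le> c1 * real k / 24" using \<gamma>(3) k by (simp add: field_simps)
          define N where "N = nat \<lfloor>c1^2 * real k ^ 2 / 64\<rfloor>"
          have N: "real N \<le> c1^2 * real k ^ 2 / 64" "c1^2 * real k ^ 2 / 64 - 1 \<le> real N"
            using k by (auto simp: N_def) linarith+
          \<comment> \<open>With parameter \<open>ln k\<close> the quotient \<open>pb / ln k\<close>
            is \<open>\<beta> / k\<close>. The first two factors are then exponentials of order
            \<open>k * ln (ln k)\<close> and \<open>k\<close>, and both lose against avoiding the
            boosters, of probability \<open>exp (- c * k * ln k)\<close>.\<close>
          have "sprob E pb (\<lambda>B. \<not> ham_cycle Z (A \<union> B)) \<le> ln (real k) ^ card Z * (1 + pb / ln (real k)) ^ card E * (1 - pb) ^ N"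
          proof (rule sprob_no_ham_cycle[OF a(1,2) A(1) exp conn])
            show "2 \<le> c" using c(2) elim(6) by linarith
            show "card (Z - nbrs E x) \<le> g" if x: "x \<in> Z" for x
            proof -
              have "card (Z - nbrs E x) = card Z - card (nbrs E x)"
                using nbrs_subset[OF a(1)] finite_nbrs[OF a(1)] by (intro card_Diff_subset) auto
              moreover have "card (nbrs E x) \<le> card Z" using nbrs_subset[OF a(1)] fin by (intro card_mono) auto
              ultimately have "real (card (Z - nbrs E x)) = real (card Z) - real (card (nbrs E x))" by simp
              also have "\<dots> \<le> \<gamma> * real k + 1"
                using a(3) bspec[OF a(4) x] by (simp add: algebra_simps)
              finally show ?thesis unfolding g_def by (rule le_nat_floor)
            qed
            have "g \<le> c" using g c(2) \<gamma>k elim(6) by linarith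
            then have "c1 * real k / 4 \<le> real (c - g)" using g c(2) \<gamma>k elim(6) by (simp add: of_nat_diff)
            moreover have "c1 * real k / 4 \<le> real c" using c(2) elim(6) by linarith
            ultimately have "(c1 * real k / 4) * (c1 * real k / 4) \<le> real (c - g) * real c"
              using c1 k by (intro mult_mono) auto
            then show "real N \<le> real ((c - g) * c) / 4" using N(1) by (simp add: power2_eq_square field_simps)
          qed (use pb elim in auto)
          also have "\<dots> \<le> exp ((real k + 1) * ln (ln (real k))) * exp (\<beta> / real k * (real k + 1)^2) *
              exp (- pb * (c1^2 * real k ^ 2 / 64 - 1))"
          proof (intro mult_mono)
            have "ln (real k) ^ card Z \<le> ln (real k) ^ (k + 1)" using a(3) elim(7) by (intro power_increasing) auto
            also have "\<dots> = exp (real (k + 1) * ln (ln (real k)))" using lnk by (subst exp_of_nat_mult) simp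
            finally show "ln (real k) ^ card Z \<le> exp ((real k + 1) * ln (ln (real k)))" by (simp add: add.commute)
            have "1 + pb / ln (real k) = 1 + \<beta> / real k" using lnk by (simp add: pb_def)
            also have "\<dots> \<le> exp (\<beta> / real k)" by (rule exp_ge_add_one_self)
            finally have "(1 + pb / ln (real k)) ^ card E \<le> exp (\<beta> / real k) ^ card E"
              using pb lnk by (intro power_mono) auto
            also have "\<dots> = exp (\<beta> / real k * real (card E))" by (simp only: exp_of_nat2_mult)
            also have "\<dots> \<le> exp (\<beta> / real k * (real k + 1)^2)"
            proof -
              have "{e \<in> E. e \<subseteq> Z} = E" using a(1) by (auto simp: simple_graph_def)
              then have "card E \<le> card Z * card Z" using card_edges_le[OF a(1) fin(1)] by simp
              also have "\<dots> \<le> (k + 1) * (k + 1)" using a(3) by (intro mult_mono) auto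
              finally have "real (card E) \<le> real ((k + 1) * (k + 1))" by (simp only: of_nat_le_iff)
              then have "real (card E) \<le> (real k + 1)^2" by (simp add: power2_eq_square algebra_simps)
              then have "\<beta> / real k * real (card E) \<le> \<beta> / real k * (real k + 1)^2" using \<beta> k by (intro mult_left_mono) auto
              then show ?thesis by (simp only: exp_le_cancel_iff)
            qed
            finally show "(1 + pb / ln (real k)) ^ card E \<le> exp (\<beta> / real k * (real k + 1)^2)" .
            show "(1 - pb) ^ N \<le> exp (- pb * (c1^2 * real k ^ 2 / 64 - 1))"
              by (rule one_minus_power_le_exp[OF pb N(2)])
          qed (use pb lnk in auto)
          also have "\<dots> = exp ((real k + 1) * ln (ln (real k)) + \<beta> / real k * (real k + 1)^2 - \<beta> * ln (real k) / real k * (c1^2 * real k ^ 2 / 64 - 1))"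
            unfolding exp_add[symmetric] pb_def by simp
          also have "\<dots> < e / 4" by (rule elim(4))
          finally show ?thesis by (simp add: sprob_not)
        qed
        have "1 - 3 * e / 4 - e / 4 \<le> sprob E (1 - (1 - pa) * (1 - pb)) (ham_cycle Z)"
          by (rule sprob_sprinkle_ge[OF fin(2) pa(1) pb _ s1 s2]) (use e in auto)
        also have "\<dots> \<le> sprob E p (ham_cycle Z)"
        proof (rule sprob_mono_p[OF fin(2)])
          have "1 - (1 - pa) * (1 - pb) \<le> pa + pb" using pa pb by (simp add: algebra_simps)
          also have "\<dots> = ((1 + \<beta>) + \<beta>) * ln (real k) / real k"
            unfolding pa_def pb_def by (simp add: add_divide_distrib distrib_right)
          also have "(1 + \<beta>) + \<beta> = 1 + \<alpha>" by (simp add: \<beta>_def)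
          also have "(1 + \<alpha>) * ln (real k) / real k \<le> p" by (rule a(6))
          finally show "1 - (1 - pa) * (1 - pb) \<le> p" .
          show "0 \<le> 1 - (1 - pa) * (1 - pb)" using pa pb by (simp add: mult_le_one)
        qed (use a in \<open>auto intro: ham_cycle_mono\<close>)
        finally show "1 - e \<le> sprob E p (ham_cycle Z)" by simp
      qed
    qed
  qed
  show ?thesis using \<gamma>(1,4) main by blast
qed

section \<open>Graphs containing a near-clique\<close>

definition has_lpath :: "'a set \<Rightarrow> nat \<Rightarrow> 'a set set \<Rightarrow> bool" where
  "has_lpath V k F \<longleftrightarrow> (\<exists>P. lpath F P \<and> set P \<subseteq> V \<and> k + 1 \<le> length P)"

definition induced :: "'a set set \<Rightarrow> 'a set \<Rightarrow> 'a set set" where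
  "induced E Z = {e \<in> E. e \<subseteq> Z}"

lemma has_lpath_mono: "has_lpath V k F \<Longrightarrow> F \<subseteq> F' \<Longrightarrow> has_lpath V k F'"
  unfolding has_lpath_def by (blast intro: lpath_mono)

lemma induced_subset: "induced E Z \<subseteq> E"
  by (auto simp: induced_def)

lemma simple_graph_induced: "simple_graph V E \<Longrightarrow> Z \<subseteq> V \<Longrightarrow> simple_graph Z (induced E Z)"
  by (auto simp: simple_graph_def induced_def intro: finite_subset)

lemma nbrs_induced: "v \<in> Z \<Longrightarrow> nbrs (induced E Z) v = nbrs E v \<inter> Z"
  by (auto simp: nbrs_def induced_def)

lemma ham_cycle_path_from:
  assumes "ham_cycle Z F" "z \<in> Z"
  obtains Q where "lpath F Q" "set Q = Z" "hd Q = z" "Q \<noteq> []"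
proof -
  obtain Q where Q: "lpath F Q" "set Q = Z" "{last Q, hd Q} \<in> F"
    using assms(1) by (auto simp: ham_cycle_def)
  then obtain as bs where s: "Q = as @ z # bs" using assms(2) by (metis split_list)
  have "lpath F ((z # bs) @ as)"
    using Q(1,3) unfolding s lpath_append by auto
  then show ?thesis using Q(2) that[of "(z # bs) @ as"] by (auto simp: s)
qed

lemma eventually_near_clique:
  fixes \<epsilon> :: real
  assumes \<epsilon>: "0 < \<epsilon>" "\<epsilon> \<le> 1"
  shows "\<exists>\<gamma>>0. \<gamma> \<le> 1 / 8 \<and> (\<forall>e>0. \<forall>\<^sub>F k in sequentially. \<forall>(V :: 'a set) E p W. simple_graph V E \<longrightarrow>
     (\<forall>v\<in>V. k \<le> card (nbrs E v)) \<longrightarrow> W \<subseteq> V \<longrightarrow> W \<noteq> {} \<longrightarrow> card W \<le> k \<longrightarrow>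
     (\<forall>w\<in>W. (1 - \<gamma>) * real k \<le> real (card (nbrs E w \<inter> W))) \<longrightarrow>
     p \<in> {0..1} \<longrightarrow> (1 + \<epsilon>) * ln (real k) / real k \<le> p \<longrightarrow> sprob E p (has_lpath V k) \<ge> 1 - e)"
    (is "\<exists>\<gamma>>0. _ \<and> (\<forall>e>0. ?P \<gamma> e)")
proof -
  obtain \<kappa> where \<kappa>: "\<kappa> > 0" "\<kappa> \<le> 1 / 8"
    and ham: "\<And>e. e > 0 \<Longrightarrow> \<forall>\<^sub>F k in sequentially. \<forall>(Z :: 'a set) E p. simple_graph Z E \<longrightarrow> Z \<noteq> {} \<longrightarrow> card Z \<le> k + 1 \<longrightarrow>
     (\<forall>v\<in>Z. (1 - \<kappa>) * real k \<le> real (card (nbrs E v))) \<longrightarrow> p \<in> {0..1} \<longrightarrow> (1 + \<epsilon>) * ln (real k) / real k \<le> p \<longrightarrow>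
     sprob E p (ham_cycle Z) \<ge> 1 - e"
    using eventually_ham_cycle[OF \<epsilon>, where ?'a = 'a] by blast
  \<comment> \<open>Smallness against \<open>\<kappa>\<close> is used twice: at most
    \<open>\<gamma> * k + 1\<close> vertices remain to be found outside \<open>Z\<close>, and
    \<open>Y2\<close> is too small to contain most of the \<open>\<kappa> * k\<close> neighbours
    that a vertex of \<open>Y\<close> has off \<open>W\<close>.\<close>
  define \<gamma> where "\<gamma> = \<kappa> / 24"
  have \<gamma>: "0 < \<gamma>" "\<gamma> \<le> 1 / 8" "\<gamma> \<le> \<kappa>" using \<kappa> by (auto simp: \<gamma>_def)
  have main: "?P \<gamma> e"
    if e: "e > 0" for e :: real
  proof -
    have pos: "(1::real) > 0" "\<kappa> / 2 > 0" "\<kappa> / 2 \<le> 1" "e / 8 > 0" "e / 2 > 0" using \<kappa> e by auto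
    note ev1 = ham[OF pos(5)]
    note ev2 = eventually_long_path[OF pos(1-4), where ?'a = 'a]
    have "((\<lambda>k. exp (- (1 * (1 / 4)) * ln (real k))) \<longlongrightarrow> 0) sequentially" by real_asymp
    then have ev3: "\<forall>\<^sub>F k in sequentially. exp (- (1 * (1 / 4)) * ln (real k)) < e / 4"
      by (rule order_tendstoD) (use e in auto)
    have ev4: "\<forall>\<^sub>F k in sequentially. \<kappa> * real k \<ge> 24" using \<kappa> by real_asymp
    show ?thesis
      using ev1 ev2 ev3 ev4 eventually_gt_at_top[of 1]
    proof eventually_elim
      case (elim k)
      show ?case
      proof (intro allI impI)
        fix V :: "'a set" and E p W
        assume a: "simple_graph V E" "\<forall>v\<in>V. k \<le> card (nbrs E v)" "W \<subseteq> V" "W \<noteq> {}" "card W \<le> k"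
          "\<forall>w\<in>W. (1 - \<gamma>) * real k \<le> real (card (nbrs E w \<inter> W))" "p \<in> {0..1}" "(1 + \<epsilon>) * ln (real k) / real k \<le> p"
        have fin: "finite V" "finite E" "finite W" using simple_graph_finite[OF a(1)] a(3) finite_subset by auto
        have k: "real k > 1" using elim(5) by simp
        have lnk: "ln (real k) > 0" using k by simp
        have p1: "1 * ln (real k) / real k \<le> p"
        proof -
          have "1 * ln (real k) / real k \<le> (1 + \<epsilon>) * ln (real k) / real k"
            using \<epsilon> lnk k by (intro divide_right_mono mult_right_mono) auto
          then show ?thesis using a(8) by linarith
        qed
        have cardW: "(1 - \<gamma>) * real k \<le> real (card W)"
        proof -
          obtain w where w: "w \<in> W" using a(4) by blast
          have "card (nbrs E w \<inter> W) \<le> card W" using fin by (intro card_mono) auto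
          then show ?thesis using bspec[OF a(6) w] by linarith
        qed
        define Y2 where "Y2 = {y \<in> V - W. (1 - \<kappa>) * real k \<le> real (card (nbrs E y \<inter> W))}"
        have finY2: "finite Y2" using fin by (simp add: Y2_def)
        have hamZ: "sprob E p (\<lambda>F. ham_cycle Z F) \<ge> 1 - e / 2"
          if Z: "W \<subseteq> Z" "Z \<subseteq> W \<union> Y2" "card Z \<le> k + 1" for Z
        proof -
          have ZV: "Z \<subseteq> V" using Z a(3) by (auto simp: Y2_def)
          have finZ: "finite Z" using ZV fin finite_subset by blast
          have "(1 - \<kappa>) * real k \<le> real (card (nbrs (induced E Z) v))" if v: "v \<in> Z" for v
          proof -
            have 1: "card (nbrs E v \<inter> W) \<le> card (nbrs (induced E Z) v)"
              unfolding nbrs_induced[OF v] using Z finZ by (intro card_mono) auto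
            have "(1 - \<kappa>) * real k \<le> (1 - \<gamma>) * real k" using \<gamma> by (intro mult_right_mono) auto
            then have "(1 - \<kappa>) * real k \<le> real (card (nbrs E v \<inter> W))"
              using v Z a(6) by (fastforce simp: Y2_def)
            then show ?thesis using 1 by linarith
          qed
          then have "sprob (induced E Z) p (ham_cycle Z) \<ge> 1 - e / 2"
            using elim(1) simple_graph_induced[OF a(1) ZV] Z a by blast
          also have "sprob (induced E Z) p (ham_cycle Z) = sprob E p (\<lambda>F. ham_cycle Z (F \<inter> induced E Z))"
            by (rule sprob_restrict[symmetric, OF fin(2) induced_subset])
          also have "\<dots> \<le> sprob E p (\<lambda>F. ham_cycle Z F)"
            by (rule sprob_mono[OF fin(2)]) (auto elim: ham_cycle_mono)
          finally show ?thesis .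
        qed
        show "1 - e \<le> sprob E p (has_lpath V k)"
        proof (cases "k + 1 \<le> card W + card Y2")
          case True
          then obtain Y3 where Y3: "Y3 \<subseteq> Y2" "card Y3 = k + 1 - card W"
            using obtain_subset_with_card_n[of "k + 1 - card W" Y2] by force
          define Z where "Z = W \<union> Y3"
          have "finite Y3" using Y3(1) finY2 by (rule finite_subset)
          then have "card Z = card W + card Y3" unfolding Z_def
            using fin Y3 by (intro card_Un_disjoint) (auto simp: Y2_def)
          then have cZ: "card Z = k + 1" using Y3 a(5) by simp
          have "1 - e / 2 \<le> sprob E p (\<lambda>F. ham_cycle Z F)"
            by (rule hamZ) (use Y3 cZ in \<open>auto simp: Z_def\<close>)
          also have "\<dots> \<le> sprob E p (has_lpath V k)"
          proof (rule sprob_mono[OF fin(2)])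
            fix F assume "ham_cycle Z F"
            then obtain Q where Q: "lpath F Q" "set Q = Z" by (auto simp: ham_cycle_def)
            have "length Q = k + 1" using Q cZ by (metis distinct_card lpath_def)
            moreover have "Z \<subseteq> V" using a(3) Y3 by (auto simp: Z_def Y2_def)
            ultimately show "has_lpath V k F" unfolding has_lpath_def using Q by (intro exI[of _ Q]) simp
          qed
          finally show ?thesis using e by simp
        next
          case False
          define Z where "Z = W \<union> Y2"
          define Y where "Y = V - Z"
          define s where "s = k + 1 - card Z"
          have cZ: "card Z = card W + card Y2" unfolding Z_def
            using fin finY2 by (intro card_Un_disjoint) (auto simp: Y2_def)
          have ZV: "Z \<subseteq> V" and finZ: "finite Z" using a(3) fin finY2 by (auto simp: Z_def Y2_def)
          have cY2: "real (card Y2) \<le> \<gamma> * real k" using False cardW by (simp add: algebra_simps)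
          have "real (card W) \<le> real (card Z)" using cZ by simp
          then have cZk: "(1 - \<gamma>) * real k \<le> real (card Z)" using cardW by linarith
          then have cZ2: "real k / 2 \<le> real (card Z)"
            using mult_right_mono[of "1 / 2" "1 - \<gamma>" "real k"] \<gamma> by simp
          have Zne: "Z \<noteq> {}" using a(4) by (simp add: Z_def)
          have \<gamma>k: "\<gamma> * real k = \<kappa> * real k / 24" by (simp add: \<gamma>_def)
          have "real s = real k + 1 - real (card Z)" using False cZ by (simp add: s_def of_nat_diff)
          then have s: "1 \<le> s" "real s \<le> \<kappa> / 2 * real k / 4"
            using False cZ cZk \<gamma>k elim(4) by (auto simp: s_def algebra_simps)
          have YV: "Y \<subseteq> V" by (auto simp: Y_def)
          have degY: "\<kappa> / 2 * real k \<le> real (card (nbrs (induced E Y) y))" if y: "y \<in> Y" for y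
          proof -
            have "real (card (nbrs E y)) \<le> real (card (nbrs E y \<inter> Y)) + real (card (nbrs E y \<inter> W)) + real (card Y2)"
              by (rule card_le_cover3)
                (use nbrs_subset[OF a(1), of y] finite_nbrs[OF a(1), of y] finY2 in \<open>auto simp: Y_def Z_def\<close>)
            moreover have "real k \<le> real (card (nbrs E y))" using a(2) y YV by auto
            moreover have "real (card (nbrs E y \<inter> W)) < (1 - \<kappa>) * real k"
              using y by (auto simp: Y_def Z_def Y2_def)
            ultimately show ?thesis unfolding nbrs_induced[OF y] using cY2 \<gamma>k elim(4) by (simp add: algebra_simps)
          qed
          \<comment> \<open>In this case \<open>card Z \<le> k\<close>, so the at least
            \<open>k\<close> neighbours of \<open>z\<close> do not fit into
            \<open>Z - {z}\<close>.\<close>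
          have "\<exists>y. y \<in> Y \<and> {z, y} \<in> E" if z: "z \<in> Z" for z
          proof (rule ccontr)
            assume "\<not> ?thesis"
            then have "nbrs E z \<subseteq> Z - {z}"
              using nbrs_subset[OF a(1), of z] nbrs_irrefl[OF a(1), of z] by (auto simp: Y_def nbrs_def)
            then have "card (nbrs E z) \<le> card Z - 1" using finZ z card_mono[of "Z - {z}" "nbrs E z"] by simp
            moreover have "k \<le> card (nbrs E z)" using a(2) z ZV by blast
            moreover have "card Z > 0" using z finZ by (auto simp: card_gt_0_iff)
            ultimately show False using False cZ by linarith
          qed
          then obtain f where f: "\<And>z. z \<in> Z \<Longrightarrow> f z \<in> Y \<and> {z, f z} \<in> E" by metis
          have exit: "sprob E p (\<lambda>F. \<exists>z\<in>Z. {z, f z} \<in> F \<and> long_path Y (f z) s F) \<ge> 1 - 2 * (e / 8) - exp (- p * (real (card Z) / 2))"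
          proof (rule sprob_exit[where EY = "induced E Y"])
            show "z \<notin> Y \<and> f z \<in> Y \<and> {z, f z} \<in> E" if "z \<in> Z" for z using f that by (auto simp: Y_def)
            show "1 - e / 8 \<le> sprob (induced E Y) p (long_path Y (f z) s)" if "z \<in> Z" for z
              using elim(2) simple_graph_induced[OF a(1) YV] degY a(7) p1 s f[OF that] by blast
          qed (use fin finZ Zne a induced_subset in \<open>auto simp: induced_def\<close>)
          have "exp (- p * (real (card Z) / 2)) \<le> exp (- (1 * (1 / 4)) * ln (real k))"
            by (rule exp_density_le[OF _ p1 a(7)]) (use k cZ2 in auto)
          then have exit2: "sprob E p (\<lambda>F. \<exists>z\<in>Z. {z, f z} \<in> F \<and> long_path Y (f z) s F) \<ge> 1 - e / 2"
            using exit elim(3) by linarith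
          have "1 - e / 2 \<le> sprob E p (\<lambda>F. ham_cycle Z F)"
            by (rule hamZ) (use False cZ in \<open>auto simp: Z_def\<close>)
          then have "1 - e \<le> sprob E p (\<lambda>F. ham_cycle Z F \<and> (\<exists>z\<in>Z. {z, f z} \<in> F \<and> long_path Y (f z) s F))"
            using exit2 sprob_conj_ge[of E p "\<lambda>F. ham_cycle Z F" "\<lambda>F. \<exists>z\<in>Z. {z, f z} \<in> F \<and> long_path Y (f z) s F"] by linarith
          also have "\<dots> \<le> sprob E p (has_lpath V k)"
          proof (rule sprob_mono[OF fin(2)])
            fix F assume "ham_cycle Z F \<and> (\<exists>z\<in>Z. {z, f z} \<in> F \<and> long_path Y (f z) s F)"
            then obtain z P where z: "ham_cycle Z F" "z \<in> Z" "{z, f z} \<in> F"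
              and P: "lpath F P" "P \<noteq> []" "last P = f z" "set P \<subseteq> Y" "s \<le> length P"
              unfolding long_path_def by blast
            obtain Q where Q: "lpath F Q" "set Q = Z" "hd Q = z" "Q \<noteq> []" using ham_cycle_path_from[OF z(1,2)] .
            have "lpath F (P @ Q)" using P Q z by (auto simp: lpath_append Y_def insert_commute)
            moreover have "set (P @ Q) \<subseteq> V" using P Q YV ZV by auto
            moreover have "length Q = card Z" using Q by (metis distinct_card lpath_def)
            then have "k + 1 \<le> length (P @ Q)" using P(5) by (simp add: s_def)
            ultimately show "has_lpath V k F" unfolding has_lpath_def by blast
          qed
          finally show ?thesis .
        qed
      qed
    qed
  qed
  show ?thesis using \<gamma>(1,2) main by blast
qed

section \<open>Rerouting a path through a dead vertex\<close>

lemma lpath_take: "lpath F P \<Longrightarrow> lpath F (take n P)"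
  by (metis append_take_drop_id lpath_append)

lemma lpath_drop: "lpath F P \<Longrightarrow> lpath F (drop n P)"
  by (metis append_take_drop_id lpath_append)

text \<open>The path from \<open>P ! g\<close> to \<open>P ! j\<close>, then via \<open>d\<close> to \<open>P ! i\<close> and on to \<open>P ! t\<close>: it uses almost all
  of \<open>P\<close> but ends at the inner vertex \<open>P ! t\<close>, where a path \<open>Q\<close> avoiding \<open>P\<close> is attached.\<close>

lemma reroute:
  assumes P: "lpath F P" "length P = m" "d \<notin> set P" and ord: "i \<le> t" "t < g" "g \<le> j" "j < m"
    and d: "{d, P ! i} \<in> F" "{d, P ! j} \<in> F"
    and Q: "lpath F Q" "Q \<noteq> []" "{P ! t, last Q} \<in> F" "set Q \<inter> set (take (t + 1) P) = {}" "set Q \<inter> set (drop g P) = {}" "d \<notin> set Q"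
    and V: "set P \<subseteq> V" "set Q \<subseteq> V" "d \<in> V"
    and len: "k + 1 \<le> (t + 1 - i) + 1 + (j + 1 - g) + length Q"
  shows "has_lpath V k F"
proof -
  define A where "A = drop i (take (t + 1) P)"
  define B where "B = take (j + 1 - g) (drop g P)"
  have lA: "length A = t + 1 - i" "A \<noteq> []" and lB: "length B = j + 1 - g" "B \<noteq> []"
    using ord P(2) by (auto simp: A_def B_def)
  have lp: "lpath F A" "lpath F B" using P(1) by (auto simp: A_def B_def intro: lpath_take lpath_drop)
  have hdA: "hd A = P ! i" using ord P(2) by (simp add: A_def hd_drop_conv_nth)
  have lastA: "last A = P ! t"
    using ord P(2) lA unfolding A_def by (subst last_drop) (auto simp: take_Suc_conv_app_nth)
  have lastB: "last B = P ! j"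
    using ord P(2) lB by (simp add: last_conv_nth) (simp add: B_def)
  have sA: "set A \<subseteq> set (take (t + 1) P)" unfolding A_def by (rule set_drop_subset)
  have sB: "set B \<subseteq> set (drop g P)" unfolding B_def by (rule set_take_subset)
  have "set (take (t + 1) P) \<inter> set (drop g P) = {}"
    using P(1) ord by (intro set_take_disj_set_drop_if_distinct) (auto simp: lpath_def)
  then have disj: "set A \<inter> set B = {}" using sA sB by blast
  have sub: "set A \<subseteq> set P" "set B \<subseteq> set P"
    using sA sB set_take_subset[of "t + 1" P] set_drop_subset[of g P] by blast+
  have "lpath F (B @ [d] @ A @ rev Q)"
    using lp disj d Q sub P(3) sA sB lA(2) lB(2) hdA lastA lastB
    by (auto simp: lpath_append lpath_Cons insert_commute hd_rev hd_append)
  moreover have "set (B @ [d] @ A @ rev Q) \<subseteq> V" using sub V by auto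
  moreover have "k + 1 \<le> length (B @ [d] @ A @ rev Q)" using len lA lB by simp
  ultimately show ?thesis unfolding has_lpath_def by blast
qed

section \<open>Graphs without a near-clique\<close>

lemma sprob_no_edge_le:
  assumes "simple_graph V E" "p \<in> {0..1}" "real (card (S \<inter> nbrs E d)) \<ge> h"
  shows "sprob E p (\<lambda>F. \<not> (\<exists>x\<in>S. {d, x} \<in> F)) \<le> exp (- p * h)"
proof -
  define B where "B = (\<lambda>x. {d, x}) ` (S \<inter> nbrs E d)"
  have "card B = card (S \<inter> nbrs E d)"
    unfolding B_def by (rule card_image) (auto simp: inj_on_def doubleton_eq_iff)
  then have "(1 - p) ^ card B \<le> exp (- p * h)"
    using one_minus_power_le_exp[OF assms(2)] assms(3) by metis
  moreover have "sprob E p (\<lambda>F. B \<inter> F = {}) = (1 - p) ^ card B"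
    by (rule sprob_avoid) (use simple_graph_finite assms in \<open>auto simp: B_def nbrs_def\<close>)
  moreover have "sprob E p (\<lambda>F. \<not> (\<exists>x\<in>S. {d, x} \<in> F)) \<le> sprob E p (\<lambda>F. B \<inter> F = {})"
    by (rule sprob_mono) (use simple_graph_finite assms in \<open>auto simp: B_def\<close>)
  ultimately show ?thesis by simp
qed

text \<open>A union bound over three second-round events: \<open>d\<close> has an edge to the first
  \<open>l\<close> vertices of \<open>P\<close>, one to the last \<open>l\<close>, and some
  \<open>z\<close> has an exit. The rerouted path loses fewer than \<open>l\<close> vertices at
  either end and \<open>g - t - 1\<close> inside, which the \<open>s\<close> new vertices must make
  up for; this is the inequality on \<open>k\<close>.\<close>

lemma sprob_reroute:
  assumes G: "simple_graph V E" and p: "p \<in> {0..1}"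
    and P: "lpath A P" "length P = m" "set P \<subseteq> V" "d \<in> V" "d \<notin> set P"
    and h: "h \<le> real (card (set (take l P) \<inter> nbrs E d))" "h \<le> real (card (set (drop (m - l) P) \<inter> nbrs E d))"
    and exit: "sprob E p (\<lambda>F. \<exists>z\<in>Z. {z, f z} \<in> F \<and> long_path Y (f z) s F) \<ge> 1 - c"
    and Y: "Y \<subseteq> V" "d \<notin> Y"
    and Z: "\<And>z. z \<in> Z \<Longrightarrow> \<exists>t g. z = P ! t \<and> l \<le> t \<and> t < g \<and> g + l \<le> m \<and>
       Y \<inter> set (take (t + 1) P) = {} \<and> Y \<inter> set (drop g P) = {} \<and> k + 2 * l + g \<le> m + s + t"
  shows "sprob E p (\<lambda>F. has_lpath V k (A \<union> F)) \<ge> 1 - c - 2 * exp (- p * h)"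
proof -
  define E1 where "E1 F \<longleftrightarrow> (\<exists>x\<in>set (take l P). {d, x} \<in> F)" for F
  define E2 where "E2 F \<longleftrightarrow> (\<exists>x\<in>set (drop (m - l) P). {d, x} \<in> F)" for F
  define E3 where "E3 F \<longleftrightarrow> (\<exists>z\<in>Z. {z, f z} \<in> F \<and> long_path Y (f z) s F)" for F
  have "sprob E p E1 \<ge> 1 - exp (- p * h)" "sprob E p E2 \<ge> 1 - exp (- p * h)"
    using sprob_no_edge_le[OF G p h(1)] sprob_no_edge_le[OF G p h(2)]
    unfolding sprob_not E1_def[abs_def] E2_def[abs_def] by linarith+
  moreover have "sprob E p E3 \<ge> 1 - c" using exit unfolding E3_def[abs_def] .
  ultimately have "1 - c - 2 * exp (- p * h) \<le> sprob E p (\<lambda>F. E1 F \<and> (E2 F \<and> E3 F))"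
    using sprob_conj_ge[of E p E1 "\<lambda>F. E2 F \<and> E3 F"] sprob_conj_ge[of E p E2 E3] by linarith
  also have "\<dots> \<le> sprob E p (\<lambda>F. has_lpath V k (A \<union> F))"
  proof (rule sprob_mono[OF simple_graph_finite(2)[OF G]])
    fix F assume F: "E1 F \<and> (E2 F \<and> E3 F)"
    obtain z where z: "z \<in> Z" "{z, f z} \<in> F" "long_path Y (f z) s F" using F E3_def by blast
    obtain Q where Q: "lpath F Q" "Q \<noteq> []" "last Q = f z" "set Q \<subseteq> Y" "s \<le> length Q"
      using z(3) unfolding long_path_def by blast
    obtain t g where tg: "z = P ! t" "l \<le> t" "t < g" "g + l \<le> m" "Y \<inter> set (take (t + 1) P) = {}" "Y \<inter> set (drop g P) = {}"
      "k + 2 * l + g \<le> m + s + t" using Z[OF z(1)] by blast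
    obtain i where i: "i < l" "{d, P ! i} \<in> F"
      using F E1_def P(2) by (auto simp: in_set_conv_nth)
    obtain j' where j': "j' < length (drop (m - l) P)" "{d, drop (m - l) P ! j'} \<in> F"
      using F E2_def by (metis in_set_conv_nth)
    define j where "j = m - l + j'"
    have j: "m - l \<le> j" "j < m" "{d, P ! j} \<in> F" using j' P(2) by (auto simp: j_def)
    show "has_lpath V k (A \<union> F)"
    proof (rule reroute[where i = i and t = t and g = g and j = j and Q = Q])
      show "lpath (A \<union> F) P" "lpath (A \<union> F) Q" using P(1) Q(1) by (auto intro: lpath_mono)
      show "k + 1 \<le> (t + 1 - i) + 1 + (j + 1 - g) + length Q"
        using tg i j Q(5) by linarith
    qed (use P Q Y tg i j z in auto)
  qed
  finally show ?thesis .
qed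

lemma window_nbrs:
  assumes "finite U" "S \<subseteq> U" "real (card U) - real (card (N \<inter> U)) \<le> x"
  shows "real (card S) - x \<le> real (card (S \<inter> N))"
proof -
  have fin: "finite S" using assms finite_subset by blast
  have "card S \<le> card ((S \<inter> N) \<union> (U - N))" using assms fin by (intro card_mono) auto
  also have "\<dots> \<le> card (S \<inter> N) + card (U - N)" by (rule card_Un_le)
  finally have "card S \<le> card (S \<inter> N) + card (U - N)" .
  moreover have "card U = card (N \<inter> U) + card (U - N)"
    using assms by (subst card_Un_disjoint[symmetric]) (auto intro!: arg_cong[where f = card])
  ultimately show ?thesis using assms(3) by linarith
qed

lemma nth_in_take_iff: "distinct P \<Longrightarrow> i < length P \<Longrightarrow> P ! i \<in> set (take n P) \<longleftrightarrow> i < n"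
  by (auto simp: in_set_conv_nth nth_eq_iff_index_eq)

lemma nth_in_drop_iff: "distinct P \<Longrightarrow> i < length P \<Longrightarrow> P ! i \<in> set (drop n P) \<longleftrightarrow> n \<le> i"
proof
  assume a: "distinct P" "i < length P"
  show "n \<le> i" if "P ! i \<in> set (drop n P)"
  proof (rule ccontr)
    assume "\<not> n \<le> i"
    then have "P ! i \<in> set (take n P)" using nth_in_take_iff[OF a, of n] by simp
    then show False using that a set_take_disj_set_drop_if_distinct[of P n n] by blast
  qed
  show "P ! i \<in> set (drop n P)" if "n \<le> i"
    using a that by (auto simp: in_set_conv_nth intro!: exI[of _ "i - n"])
qed

text \<open>As \<open>m \<le> k\<close>, the vertex \<open>d\<close> misses at most
  \<open>3 * \<delta> * k\<close> vertices of \<open>P\<close>. A window of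
  \<open>l \<ge> 6 * \<delta> * k\<close> vertices at either end therefore still contains
  \<open>3 * \<delta> * k\<close> of its neighbours.\<close>

lemma sprob_reroute_dead_end:
  fixes \<rho> \<delta> :: real
  assumes G: "simple_graph V E" and p: "p \<in> {0..1}" "\<rho> * ln (real k) / real k \<le> p" and k: "0 < k"
    and P: "lpath A P" "length P = m" "m \<le> k" "set P \<subseteq> V" "d \<in> V" "d \<notin> set P"
    and d: "(1 - 3 * \<delta>) * real k \<le> real (card (nbrs E d \<inter> set P))" and "0 \<le> \<delta>"
    and l: "6 * (\<delta> * real k) \<le> real l" "l \<le> m"
    and exit: "sprob E p (\<lambda>F. \<exists>z\<in>Z. {z, f z} \<in> F \<and> long_path Y (f z) s F) \<ge> 1 - e / 2"
    and e: "exp (- (\<rho> * (3 * \<delta>)) * ln (real k)) < e / 8"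
    and Y: "Y \<subseteq> V" "d \<notin> Y"
    and Z: "\<And>z. z \<in> Z \<Longrightarrow> \<exists>t g. z = P ! t \<and> l \<le> t \<and> t < g \<and> g + l \<le> m \<and>
       Y \<inter> set (take (t + 1) P) = {} \<and> Y \<inter> set (drop g P) = {} \<and> k + 2 * l + g \<le> m + s + t"
  shows "sprob E p (\<lambda>F. has_lpath V k (A \<union> F)) \<ge> 1 - e"
proof -
  have dP: "distinct P" using P(1) by (simp add: lpath_def)
  have gap: "real (card (set P)) - real (card (nbrs E d \<inter> set P)) \<le> 3 * \<delta> * real k"
    using d P(2,3) distinct_card[OF dP] by (simp add: algebra_simps)
  have "card (set (take l P)) = l" "card (set (drop (m - l) P)) = l"
    using dP l(2) P(2) by (auto simp: distinct_card)
  then have "3 * \<delta> * real k \<le> real (card (set (take l P) \<inter> nbrs E d))"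
    "3 * \<delta> * real k \<le> real (card (set (drop (m - l) P) \<inter> nbrs E d))"
    using window_nbrs[OF _ set_take_subset gap, of l] window_nbrs[OF _ set_drop_subset gap, of "m - l"] l(1) by auto
  then have "1 - e / 2 - 2 * exp (- p * (3 * \<delta> * real k)) \<le> sprob E p (\<lambda>F. has_lpath V k (A \<union> F))"
    by (rule sprob_reroute[OF G p(1) P(1,2,4-6) _ _ exit Y Z])
  moreover have "exp (- p * (3 * \<delta> * real k)) \<le> exp (- (\<rho> * (3 * \<delta>)) * ln (real k))"
    by (rule exp_density_le[OF k p(2,1)]) (use assms(12) in auto)
  ultimately show ?thesis using e exp_gt_zero[of "- (\<rho> * (3 * \<delta>)) * ln (real k)"] by linarith
qed

text \<open>The rerouted path continues off \<open>P\<close> while avoiding the few vertices adjacent to almost all of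
  \<open>P\<close>: what remains has linear minimum degree.\<close>

lemma eventually_reroute_sparse:
  fixes \<rho> \<gamma> \<kappa> \<mu> \<delta> e :: real
  assumes pos: "\<rho> > 0" "0 < \<gamma>" "\<gamma> \<le> 1" "0 < \<kappa>" "\<kappa> \<le> 1" "\<mu> \<le> \<gamma> / 4" "\<mu> \<le> \<kappa> / 4" "0 < \<delta>" "\<delta> \<le> \<gamma> / 1000" "\<delta> \<le> \<kappa> / 1000" "e > 0"
  shows "\<forall>\<^sub>F k in sequentially. \<forall>(V :: 'a set) E p A P d. simple_graph V E \<longrightarrow> (\<forall>v\<in>V. k \<le> card (nbrs E v)) \<longrightarrow>
     p \<in> {0..1} \<longrightarrow> \<rho> * ln (real k) / real k \<le> p \<longrightarrow>
     lpath A P \<longrightarrow> set P \<subseteq> V \<longrightarrow> length P \<le> k \<longrightarrow> d \<in> V \<longrightarrow> d \<notin> set P \<longrightarrow>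
     (1 - 3 * \<delta>) * real k \<le> real (card (nbrs E d \<inter> set P)) \<longrightarrow>
     real (card {y \<in> V - set P - {d}. (1 - \<kappa>) * real k \<le> real (card (nbrs E y \<inter> set P))}) < \<mu> * real k \<longrightarrow>
     \<not> (\<exists>W\<subseteq>V. W \<noteq> {} \<and> card W \<le> k \<and> (\<forall>w\<in>W. (1 - \<gamma>) * real k \<le> real (card (nbrs E w \<inter> W)))) \<longrightarrow>
     sprob E p (\<lambda>F. has_lpath V k (A \<union> F)) \<ge> 1 - e"
proof -
  have pos': "\<kappa> / 2 > 0" "\<kappa> / 2 \<le> 1" "e / 8 > 0" using pos by auto
  note ev1 = eventually_long_path[OF pos(1) pos', where ?'a = 'a]
  have "((\<lambda>k. exp (- (\<rho> * (\<gamma> / 16)) * ln (real k))) \<longlongrightarrow> 0) sequentially" using pos by real_asymp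
  then have ev2: "\<forall>\<^sub>F k in sequentially. exp (- (\<rho> * (\<gamma> / 16)) * ln (real k)) < e / 4"
    by (rule order_tendstoD) (use pos in auto)
  have "((\<lambda>k. exp (- (\<rho> * (3 * \<delta>)) * ln (real k))) \<longlongrightarrow> 0) sequentially" using pos by real_asymp
  then have ev3: "\<forall>\<^sub>F k in sequentially. exp (- (\<rho> * (3 * \<delta>)) * ln (real k)) < e / 8"
    by (rule order_tendstoD) (use pos in auto)
  have ev4: "\<forall>\<^sub>F k in sequentially. \<kappa> * real k \<ge> 1000" using pos by real_asymp
  have ev5: "\<forall>\<^sub>F k in sequentially. \<gamma> * real k \<ge> 1000" using pos by real_asymp
  show ?thesis
    using ev1 ev2 ev3 ev4 ev5 eventually_gt_at_top[of 1]
  proof eventually_elim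
    case (elim k)
    show ?case
    proof (intro allI impI)
      fix V :: "'a set" and E p A P d
      assume a: "simple_graph V E" "\<forall>v\<in>V. k \<le> card (nbrs E v)" "p \<in> {0..1}" "\<rho> * ln (real k) / real k \<le> p"
        and P: "lpath A P" "set P \<subseteq> V" "length P \<le> k" "d \<in> V" "d \<notin> set P"
        and d: "(1 - 3 * \<delta>) * real k \<le> real (card (nbrs E d \<inter> set P))"
        and Yb: "real (card {y \<in> V - set P - {d}. (1 - \<kappa>) * real k \<le> real (card (nbrs E y \<inter> set P))}) < \<mu> * real k"
        and NC: "\<not> (\<exists>W\<subseteq>V. W \<noteq> {} \<and> card W \<le> k \<and> (\<forall>w\<in>W. (1 - \<gamma>) * real k \<le> real (card (nbrs E w \<inter> W))))"
      have fin: "finite V" "finite E" using simple_graph_finite[OF a(1)] by auto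
      have k: "real k > 1" using elim(6) by simp
      have mk: "\<mu> * real k \<le> \<gamma> * real k / 4" "\<mu> * real k \<le> \<kappa> * real k / 4"
        "\<delta> * real k \<le> \<gamma> * real k / 1000" "\<delta> * real k \<le> \<kappa> * real k / 1000" "\<gamma> * real k \<le> real k" "\<delta> * real k > 0"
        using mult_right_mono[OF pos(6), of "real k"] mult_right_mono[OF pos(7), of "real k"]
          mult_right_mono[OF pos(9), of "real k"] mult_right_mono[OF pos(10), of "real k"] pos k by auto
      define U where "U = set P"
      define m where "m = length P"
      have dP: "distinct P" using P(1) by (simp add: lpath_def)
      have cU: "card U = m" using dP by (simp add: U_def m_def distinct_card)
      have mle: "m \<le> k" using P(3) by (simp add: m_def)
      have UV: "U \<subseteq> V" "finite U" using P by (auto simp: U_def)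
      have mge: "real k - 3 * (\<delta> * real k) \<le> real m"
      proof -
        have "card (nbrs E d \<inter> U) \<le> m" unfolding cU[symmetric] using UV by (intro card_mono) auto
        then show ?thesis using d by (simp add: U_def algebra_simps)
      qed
      define Yb where "Yb = {y \<in> V - U - {d}. (1 - \<kappa>) * real k \<le> real (card (nbrs E y \<inter> U))}"
      have cYb: "real (card Yb) < \<mu> * real k" using Yb by (simp add: Yb_def U_def)
      have finYb: "finite Yb" using fin by (simp add: Yb_def)
      have cYb': "real (card (insert d Yb)) \<le> \<mu> * real k + 1"
        using cYb finYb by (simp add: card_insert_if)
      define Y where "Y = V - U - {d} - Yb"
      have YV: "Y \<subseteq> V" by (auto simp: Y_def)
      define U1 where "U1 = {u \<in> U. nbrs E u \<inter> Y \<noteq> {}}"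
      have cU1: "\<gamma> / 4 * real k \<le> real (card U1)"
      proof (rule ccontr)
        assume "\<not> ?thesis"
        then have small: "real (card U1) < \<gamma> * real k / 4" by simp
        \<comment> \<open>Vertices of \<open>W\<close> have no neighbour in \<open>Y\<close>, so
          their at least \<open>k\<close> neighbours lie in \<open>W\<close> up to
          \<open>card U1 + \<mu> * k + 1\<close> exceptions, and \<open>W\<close> would be a
          near-clique.\<close>
        define W where "W = U - U1"
        have "card W \<le> k" unfolding W_def using UV mle cU card_mono[of U "U - U1"] by force
        moreover have "W \<noteq> {}"
        proof
          assume "W = {}"
          then have "U1 = U" by (auto simp: W_def U1_def)
          then have "real m < \<gamma> * real k / 4" using small cU by simp
          then show False using mge mk k elim(5) by linarith
        qed
        moreover have "(1 - \<gamma>) * real k \<le> real (card (nbrs E w \<inter> W))" if w: "w \<in> W" for w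
        proof -
          have "real (card (nbrs E w)) \<le> real (card (nbrs E w \<inter> W)) + real (card U1) + real (card (insert d Yb))"
            by (rule card_le_cover3)
              (use w nbrs_subset[OF a(1), of w] finite_nbrs[OF a(1), of w] finYb UV in \<open>auto simp: W_def U1_def Y_def\<close>)
          moreover have "real k \<le> real (card (nbrs E w))" using a(2) w UV by (auto simp: W_def)
          moreover have "(1 - \<gamma>) * real k = real k - \<gamma> * real k" by (simp add: algebra_simps)
          ultimately show ?thesis using small cYb' mk elim(5) by linarith
        qed
        moreover have "W \<subseteq> V" using UV by (auto simp: W_def)
        ultimately show False using NC by blast
      qed
      define l where "l = nat \<lceil>6 * \<delta> * real k\<rceil>"
      have l: "6 * (\<delta> * real k) \<le> real l" "real l \<le> 6 * (\<delta> * real k) + 1"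
        using mk(6) by (auto simp: l_def) linarith+
      have lm: "2 * l \<le> m" using l mge mk k elim(4,5) by linarith
      define Z where "Z = U1 - set (take l P) - set (drop (m - l) P)"
      have finZ: "finite Z" using UV by (auto simp: Z_def U1_def)
      have cZ: "\<gamma> / 8 * real k \<le> real (card Z)"
      proof -
        have "card U1 \<le> card (Z \<union> (set (take l P) \<union> set (drop (m - l) P)))"
          using finZ by (intro card_mono) (auto simp: Z_def)
        also have "\<dots> \<le> card Z + (card (set (take l P)) + card (set (drop (m - l) P)))"
          by (meson card_Un_le add_left_mono order_trans)
        also have "\<dots> \<le> card Z + (l + l)"
          using card_length[of "take l P"] card_length[of "drop (m - l) P"] by (simp add: m_def) linarith
        finally have "real (card U1) \<le> real (card Z) + 2 * real l" by linarith
        then show ?thesis using cU1 l mk elim(5) by linarith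
      qed
      have Zne: "Z \<noteq> {}"
      proof
        assume "Z = {}"
        then show False using cZ elim(5) by simp
      qed
      define s where "s = nat \<lfloor>\<kappa> * real k / 8\<rfloor>"
      have s: "real s \<le> \<kappa> * real k / 8" "\<kappa> * real k / 8 - 1 \<le> real s" "1 \<le> s"
        using elim(4) by (auto simp: s_def le_nat_iff le_floor_iff) linarith+
      have "\<exists>y. y \<in> Y \<and> {z, y} \<in> E" if "z \<in> Z" for z
        using that by (auto simp: Z_def U1_def nbrs_def)
      then obtain f where f: "\<And>z. z \<in> Z \<Longrightarrow> f z \<in> Y \<and> {z, f z} \<in> E" by metis
      have degY: "\<kappa> / 2 * real k \<le> real (card (nbrs (induced E Y) y))" if y: "y \<in> Y" for y
      proof -
        have "real (card (nbrs E y)) \<le> real (card (nbrs E y \<inter> Y)) + real (card (nbrs E y \<inter> U)) + real (card (insert d Yb))"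
          by (rule card_le_cover3)
            (use nbrs_subset[OF a(1), of y] finite_nbrs[OF a(1), of y] finYb in \<open>auto simp: Y_def\<close>)
        moreover have "real k \<le> real (card (nbrs E y))" using a(2) y YV by auto
        moreover have "real (card (nbrs E y \<inter> U)) < (1 - \<kappa>) * real k"
          using y by (auto simp: Y_def Yb_def)
        moreover have "(1 - \<kappa>) * real k = real k - \<kappa> * real k" by (simp add: algebra_simps)
        ultimately show ?thesis unfolding nbrs_induced[OF y] using cYb' mk elim(4) by linarith
      qed
      have exit: "sprob E p (\<lambda>F. \<exists>z\<in>Z. {z, f z} \<in> F \<and> long_path Y (f z) s F) \<ge> 1 - 2 * (e / 8) - exp (- p * (real (card Z) / 2))"
      proof (rule sprob_exit[where EY = "induced E Y"])
        show "z \<notin> Y \<and> f z \<in> Y \<and> {z, f z} \<in> E" if "z \<in> Z" for z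
          using f that by (auto simp: Y_def Z_def U1_def)
        have "real s \<le> \<kappa> / 2 * real k / 4" using s by simp
        then show "1 - e / 8 \<le> sprob (induced E Y) p (long_path Y (f z) s)" if "z \<in> Z" for z
          using elim(1) simple_graph_induced[OF a(1) YV] degY a(3,4) s(3) f[OF that] by blast
      qed (use fin finZ Zne a induced_subset in \<open>auto simp: induced_def\<close>)
      have "exp (- p * (real (card Z) / 2)) \<le> exp (- (\<rho> * (\<gamma> / 16)) * ln (real k))"
        by (rule exp_density_le[OF _ a(4,3)]) (use k cZ pos in auto)
      then have exit2: "sprob E p (\<lambda>F. \<exists>z\<in>Z. {z, f z} \<in> F \<and> long_path Y (f z) s F) \<ge> 1 - e / 2"
        using exit elim(2) by linarith
      show "1 - e \<le> sprob E p (\<lambda>F. has_lpath V k (A \<union> F))"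
      proof (rule sprob_reroute_dead_end[OF a(1,3,4) _ P(1) m_def[symmetric] mle P(2,4,5) d _ l(1) _ exit2 elim(3) YV])
        show "l \<le> m" using lm by simp
        show "d \<notin> Y" by (simp add: Y_def)
        fix z assume z: "z \<in> Z"
        then obtain t where t: "t < m" "z = P ! t" by (auto simp: Z_def U1_def U_def m_def in_set_conv_nth)
        have "l \<le> t" "t < m - l"
          using z t nth_in_take_iff[OF dP, of t l] nth_in_drop_iff[OF dP, of t "m - l"] by (auto simp: Z_def m_def)
        \<comment> \<open>Here \<open>g = t + 1\<close>, so nothing is cut out inside. About
          \<open>\<kappa> * k / 8\<close> new vertices pay for the windows \<open>2 * l\<close> and
          for the at most \<open>3 * \<delta> * k\<close> vertices by which \<open>P\<close> falls
          short of \<open>k\<close>.\<close>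
        moreover have "real k + 2 * real l + 1 \<le> real m + real s"
          using l mge s mk elim(4) by linarith
        then have "k + 2 * l + 1 \<le> m + s" by linarith
        moreover have "Y \<inter> set (take (t + 1) P) = {}" "Y \<inter> set (drop (t + 1) P) = {}"
          using set_take_subset[of "t + 1" P] set_drop_subset[of "t + 1" P] by (auto simp: Y_def U_def)
        ultimately show "\<exists>t g. z = P ! t \<and> l \<le> t \<and> t < g \<and> g + l \<le> m \<and>
             Y \<inter> set (take (t + 1) P) = {} \<and> Y \<inter> set (drop g P) = {} \<and> k + 2 * l + g \<le> m + s + t"
          using t by (intro exI[of _ t] exI[of _ "t + 1"]) auto
      qed (use k pos in auto)
    qed
  qed
qed

section \<open>Averaging over blocks of a path\<close>

lemma card_exceeding_le:
  fixes w :: "'b \<Rightarrow> real"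
  assumes "finite S" "\<And>s. s \<in> S \<Longrightarrow> 0 \<le> w s" "(\<Sum>s\<in>S. w s) \<le> t * r" "t > 0"
  shows "real (card {s \<in> S. t < w s}) \<le> r"
proof -
  have "real (card {s \<in> S. t < w s}) * t = (\<Sum>s\<in>{s \<in> S. t < w s}. t)" by simp
  also have "\<dots> \<le> (\<Sum>s\<in>{s \<in> S. t < w s}. w s)" by (intro sum_mono) auto
  also have "\<dots> \<le> (\<Sum>s\<in>S. w s)" by (rule sum_mono2) (use assms in auto)
  also have "\<dots> \<le> r * t" using assms(3) by (simp add: mult.commute)
  finally show ?thesis using assms(4) by (simp add: mult_le_cancel_right)
qed

text \<open>The \<open>N\<close> blocks are disjoint, so over all of them each \<open>y\<close>
  misses at most \<open>x\<close> vertices. Some block has at most the average share of the total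
  \<open>card Y * x\<close>.\<close>

lemma good_block:
  fixes x :: real
  assumes P: "distinct P" and Y: "finite Y" and miss: "\<And>y. y \<in> Y \<Longrightarrow> real (card (set P - B y)) \<le> x"
    and N: "0 < N" "a + N * L \<le> length P"
  obtains b where "b < N" "real N * (\<Sum>y\<in>Y. real (card ((!) P ` {a + b * L..<a + b * L + L} - B y))) \<le> real (card Y) * x"
proof -
  define J where "J b = (!) P ` {a + b * L..<a + b * L + L}" for b
  have bound: "a + b * L + L \<le> length P" if "b < N" for b
  proof -
    have "(b + 1) * L \<le> N * L" using that by (intro mult_right_mono) auto
    then show ?thesis using N(2) by simp
  qed
  have JP: "J b \<subseteq> set P" if "b < N" for b using bound[OF that] by (auto simp: J_def)
  have disj: "J b \<inter> J b' = {}" if "b < N" "b' < N" "b \<noteq> b'" for b b'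
  proof -
    have "i \<noteq> j" if ij: "i \<in> {a + b * L..<a + b * L + L}" "j \<in> {a + b' * L..<a + b' * L + L}" for i j
    proof
      assume "i = j"
      consider "b + 1 \<le> b'" | "b' + 1 \<le> b" using \<open>b \<noteq> b'\<close> by linarith
      then show False
      proof cases
        case 1
        then have "(b + 1) * L \<le> b' * L" by (intro mult_right_mono) auto
        then show False using ij \<open>i = j\<close> by simp
      next
        case 2
        then have "(b' + 1) * L \<le> b * L" by (intro mult_right_mono) auto
        then show False using ij \<open>i = j\<close> by simp
      qed
    qed
    then show ?thesis
      using P bound[OF that(1)] bound[OF that(2)] by (fastforce simp: J_def nth_eq_iff_index_eq)
  qed
  have "(\<Sum>b<N. \<Sum>y\<in>Y. real (card (J b - B y))) = (\<Sum>y\<in>Y. \<Sum>b<N. real (card (J b - B y)))"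
    by (rule sum.swap)
  also have "\<dots> \<le> (\<Sum>y\<in>Y. x)"
  proof (rule sum_mono)
    fix y assume y: "y \<in> Y"
    have "(\<Sum>b<N. card (J b - B y)) = card (\<Union>b<N. J b - B y)"
      by (rule card_UN_disjoint[symmetric]) (use disj in \<open>auto simp: J_def\<close>)
    also have "\<dots> \<le> card (set P - B y)" by (rule card_mono) (use JP in auto)
    finally have "real (\<Sum>b<N. card (J b - B y)) \<le> real (card (set P - B y))" by (simp only: of_nat_le_iff)
    then show "(\<Sum>b<N. real (card (J b - B y))) \<le> x" using miss[OF y] by simp
  qed
  finally have total: "(\<Sum>b<N. \<Sum>y\<in>Y. real (card (J b - B y))) \<le> real (card Y) * x" by simp
  have "\<exists>b<N. real N * (\<Sum>y\<in>Y. real (card (J b - B y))) \<le> real (card Y) * x"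
  proof (rule ccontr)
    assume "\<not> ?thesis"
    then have "real (card Y) * x < real N * (\<Sum>y\<in>Y. real (card (J b - B y)))" if "b < N" for b
      using that by auto
    then have "(\<Sum>b<N. real (card Y) * x) < (\<Sum>b<N. real N * (\<Sum>y\<in>Y. real (card (J b - B y))))"
      using N(1) by (intro sum_strict_mono) auto
    then have "real N * (real (card Y) * x) < real N * (\<Sum>b<N. \<Sum>y\<in>Y. real (card (J b - B y)))"
      by (simp add: sum_distrib_left)
    then show False using total N(1) by (simp add: mult_less_cancel_left)
  qed
  then show ?thesis using that unfolding J_def by blast
qed

text \<open>Double counting of the non-adjacent pairs between \<open>J\<close> and
  \<open>Y\<close>.\<close>

lemma sum_missing_swap:
  assumes "finite J" "finite Y"
  shows "(\<Sum>j\<in>J. real (card (Y - nbrs E j))) = (\<Sum>y\<in>Y. real (card (J - nbrs E y)))"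
proof -
  have *: "real (card (A - nbrs E x)) = (\<Sum>a\<in>A. if {a, x} \<in> E then 0 else 1)" if "finite A" for A x
  proof -
    have "A - nbrs E x = {a \<in> A. {a, x} \<notin> E}" by (auto simp: nbrs_def insert_commute)
    moreover have "A \<inter> - {a. {a, x} \<in> E} = {a \<in> A. {a, x} \<notin> E}" by auto
    ultimately show ?thesis using that by (simp add: sum.If_cases)
  qed
  have "(\<Sum>j\<in>J. real (card (Y - nbrs E j))) = (\<Sum>j\<in>J. \<Sum>y\<in>Y. if {y, j} \<in> E then 0 else 1)"
    by (simp only: *[OF assms(2)])
  also have "\<dots> = (\<Sum>y\<in>Y. \<Sum>j\<in>J. if {y, j} \<in> E then 0 else 1)" by (rule sum.swap)
  also have "\<dots> = (\<Sum>y\<in>Y. \<Sum>j\<in>J. if {j, y} \<in> E then 0 else 1)" by (simp only: insert_commute)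
  also have "\<dots> = (\<Sum>y\<in>Y. real (card (J - nbrs E y)))" by (simp only: *[OF assms(1)])
  finally show ?thesis .
qed

lemma card_Int_ge:
  assumes "finite A" "A \<subseteq> J" "finite J"
  shows "real (card A) - real (card (J - B)) \<le> real (card (B \<inter> A))"
proof -
  have "card A \<le> card ((B \<inter> A) \<union> (J - B))" using assms by (intro card_mono) auto
  also have "\<dots> \<le> card (B \<inter> A) + card (J - B)" by (rule card_Un_le)
  finally show ?thesis by linarith
qed

text \<open>The rerouted path drops a segment of \<open>P\<close> and continues in the bipartite graph between this
  segment and the vertices adjacent to almost all of \<open>P\<close>; this path is nearly twice as long as the
  segment.\<close>

lemma eventually_reroute_dense:
  fixes \<rho> \<mu> \<delta> e :: real
  assumes pos: "\<rho> > 0" "0 < \<mu>" "\<mu> \<le> 1 / 100" "0 < \<delta>" "\<delta> \<le> \<mu> / 100" "e > 0" and \<kappa>: "\<kappa> = 1 / 6400"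
  shows "\<forall>\<^sub>F k in sequentially. \<forall>(V :: 'a set) E p A P d. simple_graph V E \<longrightarrow>
     p \<in> {0..1} \<longrightarrow> \<rho> * ln (real k) / real k \<le> p \<longrightarrow>
     lpath A P \<longrightarrow> set P \<subseteq> V \<longrightarrow> length P \<le> k \<longrightarrow> d \<in> V \<longrightarrow> d \<notin> set P \<longrightarrow>
     (1 - 3 * \<delta>) * real k \<le> real (card (nbrs E d \<inter> set P)) \<longrightarrow>
     \<mu> * real k \<le> real (card {y \<in> V - set P - {d}. (1 - \<kappa>) * real k \<le> real (card (nbrs E y \<inter> set P))}) \<longrightarrow>
     sprob E p (\<lambda>F. has_lpath V k (A \<union> F)) \<ge> 1 - e"
proof -
  have pos': "4 / 5 * \<mu> > 0" "4 / 5 * \<mu> \<le> 1" "e / 8 > 0" using pos by auto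
  note ev1 = eventually_long_path_bipartite[OF pos(1) pos', where ?'a = 'a]
  have "((\<lambda>k. exp (- (\<rho> * (\<mu> / 40)) * ln (real k))) \<longlongrightarrow> 0) sequentially" using pos by real_asymp
  then have ev2: "\<forall>\<^sub>F k in sequentially. exp (- (\<rho> * (\<mu> / 40)) * ln (real k)) < e / 4"
    by (rule order_tendstoD) (use pos in auto)
  have "((\<lambda>k. exp (- (\<rho> * (3 * \<delta>)) * ln (real k))) \<longlongrightarrow> 0) sequentially" using pos by real_asymp
  then have ev3: "\<forall>\<^sub>F k in sequentially. exp (- (\<rho> * (3 * \<delta>)) * ln (real k)) < e / 8"
    by (rule order_tendstoD) (use pos in auto)
  have ev4: "\<forall>\<^sub>F k in sequentially. \<mu> * real k \<ge> 1000" using pos by real_asymp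
  show ?thesis
    using ev1 ev2 ev3 ev4 eventually_gt_at_top[of 1]
  proof eventually_elim
    case (elim k)
    show ?case
    proof (intro allI impI)
      fix V :: "'a set" and E p A P d
      assume a: "simple_graph V E" "p \<in> {0..1}" "\<rho> * ln (real k) / real k \<le> p"
        and P: "lpath A P" "set P \<subseteq> V" "length P \<le> k" "d \<in> V" "d \<notin> set P"
        and d: "(1 - 3 * \<delta>) * real k \<le> real (card (nbrs E d \<inter> set P))"
        and Yb: "\<mu> * real k \<le> real (card {y \<in> V - set P - {d}. (1 - \<kappa>) * real k \<le> real (card (nbrs E y \<inter> set P))})"
      have fin: "finite V" "finite E" using simple_graph_finite[OF a(1)] by auto
      have k: "real k > 1" using elim(5) by simp
      have mk: "\<delta> * real k \<le> \<mu> * real k / 100" "\<mu> * real k \<le> real k / 100" "\<delta> * real k > 0"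
        using mult_right_mono[OF pos(5), of "real k"] mult_right_mono[OF pos(3), of "real k"] pos k by auto
      define U where "U = set P"
      define m where "m = length P"
      have dP: "distinct P" using P(1) by (simp add: lpath_def)
      have cU: "card U = m" using dP by (simp add: U_def m_def distinct_card)
      have mle: "m \<le> k" using P(3) by (simp add: m_def)
      have UV: "U \<subseteq> V" "finite U" using P by (auto simp: U_def)
      have mge: "real k - 3 * (\<delta> * real k) \<le> real m"
      proof -
        have "card (nbrs E d \<inter> U) \<le> m" unfolding cU[symmetric] using UV by (intro card_mono) auto
        then show ?thesis using d by (simp add: U_def algebra_simps)
      qed
      define l where "l = nat \<lceil>6 * \<delta> * real k\<rceil>"
      have l: "6 * (\<delta> * real k) \<le> real l" "real l \<le> 6 * (\<delta> * real k) + 1"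
        using mk(3) by (auto simp: l_def) linarith+
      define L where "L = nat \<lfloor>\<mu> * real k\<rfloor>"
      have L: "real L \<le> \<mu> * real k" "\<mu> * real k - 1 \<le> real L"
        using elim(4) by (auto simp: L_def)
      have L0: "real L \<ge> 999" using L elim(4) by linarith
      define Yb where "Yb = {y \<in> V - U - {d}. (1 - \<kappa>) * real k \<le> real (card (nbrs E y \<inter> U))}"
      have "real L \<le> real (card Yb)" using Yb L by (simp add: Yb_def U_def)
      then have "L \<le> card Yb" by simp
      then obtain Y0 where Y0: "Y0 \<subseteq> Yb" "card Y0 = L" "finite Y0"
        using obtain_subset_with_card_n[of L Yb] by blast
      \<comment> \<open>The blocks take up at most \<open>k / 2\<close> positions, which leaves room
        for both end windows, and at least \<open>k / 4\<close> by \<open>N4\<close>, which keeps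
        the average per block small.\<close>
      define N where "N = k div (2 * L)"
      have N2: "N * (2 * L) \<le> k" by (simp add: N_def)
      have N4: "real k \<le> real N * (4 * real L)"
      proof -
        have "k < (N + 1) * (2 * L)" unfolding N_def using L0 by (simp add: dividend_less_div_times)
        then have "real k < real ((N + 1) * (2 * L))" by (simp only: of_nat_less_iff)
        then have "real k < 2 * (real N * real L) + 2 * real L" by (simp add: algebra_simps)
        moreover have "4 * real L \<le> real k" using L mk k by linarith
        ultimately show ?thesis by linarith
      qed
      have N0: "0 < N"
      proof (rule ccontr)
        assume "\<not> 0 < N"
        then show False using N4 k by simp
      qed
      have NLm: "l + N * L + l \<le> m"
      proof -
        have "2 * (N * L) \<le> k" using N2 by (simp add: algebra_simps)
        then have "2 * real (N * L) \<le> real k" by linarith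
        then have "real l + real (N * L) + real l \<le> real m" using l mge mk elim(4) k by linarith
        then show ?thesis by linarith
      qed
      have missU: "real (card (set P - nbrs E y)) \<le> \<kappa> * real k" if y: "y \<in> Y0" for y
      proof -
        have "card U = card (nbrs E y \<inter> U) + card (U - nbrs E y)"
          using UV by (subst card_Un_disjoint[symmetric]) (auto intro!: arg_cong[where f = card])
        moreover have "(1 - \<kappa>) * real k \<le> real (card (nbrs E y \<inter> U))" using y Y0 by (auto simp: Yb_def)
        ultimately show ?thesis using cU mle by (simp add: U_def algebra_simps)
      qed
      have NLP: "l + N * L \<le> length P" using NLm by (simp add: m_def)
      obtain b where b: "b < N"
        "real N * (\<Sum>y\<in>Y0. real (card ((!) P ` {l + b * L..<l + b * L + L} - nbrs E y))) \<le> real (card Y0) * (\<kappa> * real k)"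
        using good_block[where B = "nbrs E", OF dP Y0(3) missU N0 NLP] by blast
      define a0 where "a0 = l + b * L"
      have a0: "l \<le> a0" "a0 + L + l \<le> m"
      proof -
        have "(b + 1) * L \<le> N * L" using b(1) by (intro mult_right_mono) auto
        then show "l \<le> a0" "a0 + L + l \<le> m" using NLm by (auto simp: a0_def)
      qed
      \<comment> \<open>The first eighth of the block supplies the vertices \<open>z\<close> at
        which \<open>P\<close> is left, the rest becomes one side of the bipartite graph. In this
        order the latter avoids the retained part \<open>take (t + 1) P\<close>.\<close>
      define q where "q = L div 8"
      have q: "real q \<le> real L / 8" "real L / 8 - 1 \<le> real q"
      proof -
        have "8 * q \<le> L" "L < 8 * q + 8" by (auto simp: q_def)
        then show "real q \<le> real L / 8" "real L / 8 - 1 \<le> real q" by linarith+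
      qed
      have qL: "q \<le> L" by (simp add: q_def)
      define J where "J = (!) P ` {a0..<a0 + L}"
      define Ja where "Ja = (!) P ` {a0..<a0 + q}"
      define Jr where "Jr = (!) P ` {a0 + q..<a0 + L}"
      have inj: "inj_on ((!) P) {..<m}" using dP by (auto simp: inj_on_def m_def nth_eq_iff_index_eq)
      have cJ: "card Ja = q" "card Jr = L - q"
        unfolding Ja_def Jr_def by (subst card_image, rule inj_on_subset[OF inj], use a0 qL in auto)+
      have Jsub: "Ja \<subseteq> J" "Jr \<subseteq> J" "J \<subseteq> U" "finite J" "finite Ja" "finite Jr"
        using qL a0 by (auto simp: J_def Ja_def Jr_def U_def m_def)
      \<comment> \<open>This is where \<open>\<kappa> = 1 / 6400\<close> comes from: the chosen
        block and \<open>Y0\<close> have at most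
        \<open>4 * \<kappa> * L^2 = (\<sigma> * L)^2\<close> non-adjacent pairs. By Markov at most
        \<open>\<sigma> * L\<close> vertices on either side miss more than
        \<open>\<sigma> * L\<close> on the other.\<close>
      define \<sigma> where "\<sigma> = (1 / 40 :: real)"
      have miss: "(\<Sum>y\<in>Y0. real (card (J - nbrs E y))) \<le> (\<sigma> * real L) * (\<sigma> * real L)"
      proof -
        define S where "S = (\<Sum>y\<in>Y0. real (card (J - nbrs E y)))"
        have "real N * S \<le> real L * (\<kappa> * real k)" using b(2) Y0(2) by (simp add: S_def J_def a0_def)
        also have "\<dots> \<le> real L * (\<kappa> * (real N * (4 * real L)))"
          using N4 by (intro mult_left_mono) (auto simp: \<kappa>)
        also have "\<dots> = real N * ((\<sigma> * real L) * (\<sigma> * real L))" by (simp add: \<kappa> \<sigma>_def)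
        finally show ?thesis using N0 by (simp add: S_def mult_le_cancel_left)
      qed
      have miss': "(\<Sum>j\<in>J. real (card (Y0 - nbrs E j))) \<le> (\<sigma> * real L) * (\<sigma> * real L)"
        using miss sum_missing_swap[OF Jsub(4) Y0(3), of E] by simp
      have \<sigma>L: "\<sigma> * real L > 0" using L0 by (simp add: \<sigma>_def)
      define Y1 where "Y1 = {y \<in> Y0. real (card (J - nbrs E y)) \<le> \<sigma> * real L}"
      define J0 where "J0 = {j \<in> Jr. real (card (Y0 - nbrs E j)) \<le> \<sigma> * real L}"
      have badY: "real (card {y \<in> Y0. \<sigma> * real L < real (card (J - nbrs E y))}) \<le> \<sigma> * real L"
        by (rule card_exceeding_le[OF Y0(3) _ miss \<sigma>L]) simp
      have badJ: "real (card {j \<in> J. \<sigma> * real L < real (card (Y0 - nbrs E j))}) \<le> \<sigma> * real L"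
        by (rule card_exceeding_le[OF Jsub(4) _ miss' \<sigma>L]) simp
      have cY1: "real L - \<sigma> * real L \<le> real (card Y1)"
      proof -
        have "card Y0 \<le> card (Y1 \<union> {y \<in> Y0. \<sigma> * real L < real (card (J - nbrs E y))})"
          using Y0(3) by (intro card_mono) (auto simp: Y1_def)
        also have "\<dots> \<le> card Y1 + card {y \<in> Y0. \<sigma> * real L < real (card (J - nbrs E y))}" by (rule card_Un_le)
        finally show ?thesis using badY Y0(2) by linarith
      qed
      have cJ0: "real L - real q - \<sigma> * real L \<le> real (card J0)"
      proof -
        have "card Jr \<le> card (J0 \<union> {j \<in> J. \<sigma> * real L < real (card (Y0 - nbrs E j))})"
          using Jsub by (intro card_mono) (auto simp: J0_def)
        also have "\<dots> \<le> card J0 + card {j \<in> J. \<sigma> * real L < real (card (Y0 - nbrs E j))}" by (rule card_Un_le)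
        finally show ?thesis using badJ cJ qL by (simp add: of_nat_diff)
      qed
      have disjoint: "Y0 \<inter> U = {}" "d \<notin> Y0" "Y0 \<subseteq> V" using Y0(1) by (auto simp: Yb_def)
      have sub: "Y1 \<subseteq> Y0" "J0 \<subseteq> Jr" "finite Y1" "finite J0" using Y0 Jsub by (auto simp: Y1_def J0_def)
      have disj01: "J0 \<inter> Y1 = {}" using sub Jsub disjoint by blast
      define V2 where "V2 = J0 \<union> Y1"
      define E2 where "E2 = cut E J0 Y1"
      have V2V: "V2 \<subseteq> V" using sub Jsub UV disjoint unfolding V2_def by blast
      have G2: "simple_graph V2 E2"
        using a(1) sub by (auto simp: simple_graph_def V2_def E2_def cut_def)
      \<comment> \<open>Each side has lost at most \<open>\<sigma> * L\<close> exceptional vertices,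
        and a remaining vertex misses at most \<open>\<sigma> * L\<close> more. On the shorter side
        \<open>J0\<close> this leaves about \<open>(7 / 8 - 2 * \<sigma>) * L = 33 / 40 * L\<close>,
        above \<open>4 / 5\<close>.\<close>
      have deg2: "4 / 5 * \<mu> * real k \<le> real (card (nbrs E2 v))" if v: "v \<in> V2" for v
      proof (cases "v \<in> J0")
        case True
        have "nbrs E v \<inter> Y1 \<subseteq> nbrs E2 v" using True by (auto simp: nbrs_def E2_def cut_def)
        then have "card (nbrs E v \<inter> Y1) \<le> card (nbrs E2 v)" using finite_nbrs[OF G2] by (intro card_mono) auto
        moreover have "real (card Y1) - real (card (Y0 - nbrs E v)) \<le> real (card (nbrs E v \<inter> Y1))"
          by (rule card_Int_ge) (use sub Y0 in auto)
        moreover have "real (card (Y0 - nbrs E v)) \<le> \<sigma> * real L" using True by (simp add: J0_def)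
        ultimately show ?thesis using cY1 L elim(4) by (simp add: \<sigma>_def)
      next
        case False
        then have v1: "v \<in> Y1" using v by (simp add: V2_def)
        have "nbrs E v \<inter> J0 \<subseteq> nbrs E2 v" using v1 by (auto simp: nbrs_def E2_def cut_def insert_commute)
        then have "card (nbrs E v \<inter> J0) \<le> card (nbrs E2 v)" using finite_nbrs[OF G2] by (intro card_mono) auto
        moreover have "real (card J0) - real (card (J - nbrs E v)) \<le> real (card (nbrs E v \<inter> J0))"
          by (rule card_Int_ge) (use sub Jsub in auto)
        moreover have "real (card (J - nbrs E v)) \<le> \<sigma> * real L" using v1 by (simp add: Y1_def)
        ultimately show ?thesis using cJ0 q L elim(4) by (simp add: \<sigma>_def)
      qed
      \<comment> \<open>The path has about \<open>9 / 5 * 4 / 5 = 1.44\<close> times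
        \<open>\<mu> * k\<close> vertices, while at most \<open>L \<le> \<mu> * k\<close> are
        dropped from \<open>P\<close>. The surplus covers the windows and the shortfall of
        \<open>P\<close>, both of order \<open>\<delta> * k\<close>.\<close>
      define s where "s = nat \<lfloor>9 / 5 * (4 / 5 * \<mu>) * real k\<rfloor>"
      have s: "real s \<le> 9 / 5 * (4 / 5 * \<mu>) * real k" "9 / 5 * (4 / 5 * (\<mu> * real k)) - 1 \<le> real s" "1 \<le> s"
        using elim(4) by (auto simp: s_def le_nat_iff le_floor_iff) linarith+
      define Z where "Z = {z \<in> Ja. nbrs E z \<inter> Y1 \<noteq> {}}"
      have finZ: "finite Z" using Jsub by (simp add: Z_def)
      have cZ: "\<mu> / 20 * real k \<le> real (card Z)"
      proof -
        \<comment> \<open>A vertex of \<open>Ja\<close> with no neighbour in \<open>Y1\<close>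
          misses nearly all of \<open>Y0\<close>, so it is one of the few exceptional vertices of
          the block.\<close>
        have "\<sigma> * real L < real (card (Y0 - nbrs E z))" if "z \<in> Ja" "z \<notin> Z" for z
        proof -
          have "Y1 \<subseteq> Y0 - nbrs E z" using that sub by (auto simp: Z_def)
          then have "card Y1 \<le> card (Y0 - nbrs E z)" using Y0(3) by (intro card_mono) auto
          then show ?thesis using cY1 L0 by (simp add: \<sigma>_def)
        qed
        then have "card Ja \<le> card (Z \<union> {j \<in> J. \<sigma> * real L < real (card (Y0 - nbrs E j))})"
          using Jsub finZ by (intro card_mono) auto
        also have "\<dots> \<le> card Z + card {j \<in> J. \<sigma> * real L < real (card (Y0 - nbrs E j))}" by (rule card_Un_le)
        finally have "real q \<le> real (card Z) + \<sigma> * real L" using badJ cJ(1) by linarith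
        then show ?thesis using q L elim(4) by (simp add: \<sigma>_def)
      qed
      have Zne: "Z \<noteq> {}"
      proof
        assume "Z = {}"
        then show False using cZ elim(4) by simp
      qed
      have "\<exists>y. y \<in> Y1 \<and> {z, y} \<in> E" if "z \<in> Z" for z
        using that by (auto simp: Z_def nbrs_def)
      then obtain f where f: "\<And>z. z \<in> Z \<Longrightarrow> f z \<in> Y1 \<and> {z, f z} \<in> E" by metis
      have bip: "\<forall>u v. {u, v} \<in> E2 \<longrightarrow> (u \<in> J0 \<longleftrightarrow> v \<notin> J0)"
        using disj01 by (auto simp: E2_def cut_def doubleton_eq_iff)
      have idx: "z \<in> Ja \<Longrightarrow> \<exists>t. z = P ! t \<and> a0 \<le> t \<and> t < a0 + q" for z by (auto simp: Ja_def)
      have JaJr: "Ja \<inter> Jr = {}"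
      proof -
        have "i = j" if "P ! i = P ! j" "i < m" "j < m" for i j
          using inj that by (auto simp: inj_on_def)
        then show ?thesis using a0 qL unfolding Ja_def Jr_def by fastforce
      qed
      have exit: "sprob E p (\<lambda>F. \<exists>z\<in>Z. {z, f z} \<in> F \<and> long_path V2 (f z) s F) \<ge> 1 - 2 * (e / 8) - exp (- p * (real (card Z) / 2))"
      proof (rule sprob_exit[where EY = E2])
        show "z \<notin> V2 \<and> f z \<in> V2 \<and> {z, f z} \<in> E" if z: "z \<in> Z" for z
        proof -
          have "z \<in> Ja" using z by (simp add: Z_def)
          then have "z \<notin> J0" "z \<notin> Y1" using JaJr sub Jsub disjoint by blast+
          then show ?thesis using f[OF z] by (simp add: V2_def)
        qed
        show "1 - e / 8 \<le> sprob E2 p (long_path V2 (f z) s)" if "z \<in> Z" for z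
          using elim(1) G2 bip deg2 a(2,3) s(1,3) f[OF that] unfolding V2_def by blast
        show "E2 \<subseteq> E" by (auto simp: E2_def cut_def)
        show "e' \<subseteq> V2" if "e' \<in> E2" for e' using that by (auto simp: E2_def cut_def V2_def)
      qed (use fin finZ Zne a in auto)
      have "exp (- p * (real (card Z) / 2)) \<le> exp (- (\<rho> * (\<mu> / 40)) * ln (real k))"
        by (rule exp_density_le[OF _ a(3,2)]) (use k cZ pos in auto)
      then have exit2: "sprob E p (\<lambda>F. \<exists>z\<in>Z. {z, f z} \<in> F \<and> long_path V2 (f z) s F) \<ge> 1 - e / 2"
        using exit elim(2) by linarith
      show "1 - e \<le> sprob E p (\<lambda>F. has_lpath V k (A \<union> F))"
      proof (rule sprob_reroute_dead_end[OF a(1,2,3) _ P(1) m_def[symmetric] mle P(2,4,5) d _ l(1) _ exit2 elim(3) V2V])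
        show "l \<le> m" using a0 by simp
        show "d \<notin> V2" using disjoint sub Jsub P(5) by (auto simp: V2_def U_def)
        fix z assume z: "z \<in> Z"
        then obtain t where t: "z = P ! t" "a0 \<le> t" "t < a0 + q" using idx[of z] by (auto simp: Z_def)
        have out: "V2 \<inter> set (take (t + 1) P) = {} \<and> V2 \<inter> set (drop (a0 + L) P) = {}"
        proof -
          have "x \<notin> set (take (t + 1) P) \<and> x \<notin> set (drop (a0 + L) P)" if x: "x \<in> V2" for x
          proof (cases "x \<in> Jr")
            case True
            then obtain i where i: "x = P ! i" "a0 + q \<le> i" "i < a0 + L" by (auto simp: Jr_def)
            then show ?thesis
              using nth_in_take_iff[OF dP, of i "t + 1"] nth_in_drop_iff[OF dP, of i "a0 + L"] t a0 by (auto simp: m_def)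
          next
            case False
            then have "x \<notin> set P" using x sub disjoint by (auto simp: V2_def U_def)
            then show ?thesis using set_take_subset[of "t + 1" P] set_drop_subset[of "a0 + L" P] by blast
          qed
          then show ?thesis by blast
        qed
        have "real k + 2 * real l + real L \<le> real m + real s"
          using l mge s mk L elim(4) by linarith
        then have "k + 2 * l + L \<le> m + s" by linarith
        then show "\<exists>t g. z = P ! t \<and> l \<le> t \<and> t < g \<and> g + l \<le> m \<and>
             V2 \<inter> set (take (t + 1) P) = {} \<and> V2 \<inter> set (drop g P) = {} \<and> k + 2 * l + g \<le> m + s + t"
          using t a0 qL out by (intro exI[of _ t] exI[of _ "a0 + L"]) auto
      qed (use k pos in auto)
    qed
  qed
qed

section \<open>Conclusion\<close>

text \<open>Without a near-clique, two rounds of density \<open>ln k / (2 * k)\<close> suffice;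
  their union has density at most \<open>ln k / k\<close>, below \<open>p\<close>. The search aims
  at \<open>k + 1\<close> vertices, so a path that ends in a dead end has at most
  \<open>k\<close>.\<close>

lemma eventually_has_lpath:
  fixes \<epsilon> e :: real
  assumes \<epsilon>: "0 < \<epsilon>" "\<epsilon> \<le> 1" and e: "0 < e"
  shows "\<forall>\<^sub>F k in sequentially. \<forall>(V :: 'a set) E p. simple_graph V E \<longrightarrow> V \<noteq> {} \<longrightarrow> (\<forall>v\<in>V. k \<le> card (nbrs E v)) \<longrightarrow>
     p \<in> {0..1} \<longrightarrow> (1 + \<epsilon>) * ln (real k) / real k \<le> p \<longrightarrow> sprob E p (has_lpath V k) \<ge> 1 - e"
proof -
  obtain \<gamma> where \<gamma>: "0 < \<gamma>" "\<gamma> \<le> 1 / 8"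
    and clique: "\<And>e. e > 0 \<Longrightarrow> \<forall>\<^sub>F k in sequentially. \<forall>(V :: 'a set) E p W. simple_graph V E \<longrightarrow>
     (\<forall>v\<in>V. k \<le> card (nbrs E v)) \<longrightarrow> W \<subseteq> V \<longrightarrow> W \<noteq> {} \<longrightarrow> card W \<le> k \<longrightarrow>
     (\<forall>w\<in>W. (1 - \<gamma>) * real k \<le> real (card (nbrs E w \<inter> W))) \<longrightarrow>
     p \<in> {0..1} \<longrightarrow> (1 + \<epsilon>) * ln (real k) / real k \<le> p \<longrightarrow> sprob E p (has_lpath V k) \<ge> 1 - e"
    using eventually_near_clique[OF \<epsilon>, where ?'a = 'a] by blast
  \<comment> \<open>The value of \<open>\<kappa>\<close> is dictated by
    \<open>eventually_reroute_dense\<close>. Then \<open>\<mu>\<close> has to be small against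
    \<open>\<gamma>\<close> and \<open>\<kappa>\<close>, and \<open>\<delta>\<close> against
    \<open>\<mu>\<close>, because losses of order \<open>\<delta> * k\<close> must be outweighed by
    gains of order \<open>\<mu> * k\<close> or \<open>\<kappa> * k\<close>.\<close>
  define \<kappa> where "\<kappa> = (1 / 6400 :: real)"
  define \<mu> where "\<mu> = \<gamma> * \<kappa> / 4"
  define \<delta> where "\<delta> = \<mu> / 1000"
  have par: "0 < \<kappa>" "\<kappa> \<le> 1" "0 < \<mu>" "\<mu> \<le> \<gamma> / 4" "\<mu> \<le> \<kappa> / 4" "\<mu> \<le> 1 / 100" "\<gamma> \<le> 1"
    "0 < \<delta>" "\<delta> \<le> \<gamma> / 1000" "\<delta> \<le> \<kappa> / 1000" "\<delta> \<le> \<mu> / 100" "4 * \<delta> \<le> 1"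
    using \<gamma> by (auto simp: \<kappa>_def \<mu>_def \<delta>_def)
  have half: "(1 / 2 :: real) > 0" "e / 2 > 0" using e by auto
  note ev1 = clique[OF e]
  note ev2 = eventually_dfs[OF half(1) par(8,12) order_refl half(2), where ?'a = 'a]
  note ev3 = eventually_reroute_sparse[OF half(1) \<gamma>(1) par(7,1,2,4,5,8-10) half(2), where ?'a = 'a]
  note ev4 = eventually_reroute_dense[OF half(1) par(3,6,8,11) half(2) \<kappa>_def, where ?'a = 'a]
  have ev5: "\<forall>\<^sub>F k in sequentially. ln (real k) / real k \<le> 1" by real_asymp
  show ?thesis
    using ev1 ev2 ev3 ev4 ev5 eventually_gt_at_top[of 1]
  proof eventually_elim
    case (elim k)
    show ?case
    proof (intro allI impI)
      fix V :: "'a set" and E p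
      assume a: "simple_graph V E" "V \<noteq> {}" "\<forall>v\<in>V. k \<le> card (nbrs E v)" "p \<in> {0..1}" "(1 + \<epsilon>) * ln (real k) / real k \<le> p"
      have finE: "finite E" using simple_graph_finite a(1) by auto
      show "1 - e \<le> sprob E p (has_lpath V k)"
      proof (cases "\<exists>W\<subseteq>V. W \<noteq> {} \<and> card W \<le> k \<and> (\<forall>w\<in>W. (1 - \<gamma>) * real k \<le> real (card (nbrs E w \<inter> W)))")
        case True
        then show ?thesis using elim(1) a by blast
      next
        case NC: False
        have k: "real k > 1" using elim(6) by simp
        have lnk: "ln (real k) > 0" using k by simp
        define q where "q = 1 / 2 * ln (real k) / real k"
        have q: "q \<in> {0..1}" "1 / 2 * ln (real k) / real k \<le> q" using elim(5) lnk k by (auto simp: q_def)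
        obtain y where y: "y \<in> V" using a(2) by blast
        define Q1 where "Q1 F \<longleftrightarrow> long_path V y (k + 1) F \<or> dead_end V E y (k + 1) (1 * real k - 3 * \<delta> * real k) F" for F
        have k2: "1 \<le> k + 1" "real (k + 1) \<le> 2 * real k" using k by auto
        have deg1: "\<forall>v\<in>V. 1 * real k \<le> real (card (nbrs E v))" using a(3) by simp
        have r1: "1 - e / 2 \<le> sprob E q Q1"
          unfolding Q1_def[abs_def] using elim(2) a(1) deg1 q y k2 by blast
        have r2: "1 - e / 2 \<le> sprob E q (\<lambda>F'. has_lpath V k (F \<union> F'))" if F: "F \<subseteq> E" "Q1 F" for F
        proof (cases "long_path V y (k + 1) F")
          case True
          then have "has_lpath V k (F \<union> F')" for F'
            unfolding long_path_def has_lpath_def by (blast intro: lpath_mono)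
          then show ?thesis using e by simp
        next
          case False
          then obtain P d where P: "lpath F P" "set P \<subseteq> V" "length P < k + 1" "d \<in> V" "d \<notin> set P"
            "1 * real k - 3 * \<delta> * real k \<le> real (card (nbrs E d \<inter> set P))"
            using F(2) unfolding Q1_def dead_end_def by blast
          have P': "length P \<le> k" "(1 - 3 * \<delta>) * real k \<le> real (card (nbrs E d \<inter> set P))"
            using P(3,6) by (auto simp: algebra_simps)
          show ?thesis
          proof (cases "real (card {y \<in> V - set P - {d}. (1 - \<kappa>) * real k \<le> real (card (nbrs E y \<inter> set P))}) < \<mu> * real k")
            case True
            then show ?thesis using elim(3) a(1,3) q P(1,2,4,5) P' NC by blast
          next
            case False
            then have "\<mu> * real k \<le> real (card {y \<in> V - set P - {d}. (1 - \<kappa>) * real k \<le> real (card (nbrs E y \<inter> set P))})" by simp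
            then show ?thesis using elim(4) a(1) q P(1,2,4,5) P' by blast
          qed
        qed
        have "1 - e / 2 - e / 2 \<le> sprob E (1 - (1 - q) * (1 - q)) (has_lpath V k)"
          by (rule sprob_sprinkle_ge[OF finE q(1) q(1) _ r1 r2]) (use e in auto)
        also have "\<dots> \<le> sprob E p (has_lpath V k)"
        proof (rule sprob_mono_p[OF finE])
          have "1 - (1 - q) * (1 - q) \<le> 2 * q" by (simp add: algebra_simps)
          also have "2 * q = 1 * ln (real k) / real k" by (simp add: q_def)
          also have "1 * ln (real k) / real k \<le> (1 + \<epsilon>) * ln (real k) / real k"
            using \<epsilon> lnk k by (intro divide_right_mono mult_right_mono) auto
          finally show "1 - (1 - q) * (1 - q) \<le> p" using a(5) by linarith
          show "0 \<le> 1 - (1 - q) * (1 - q)" using q by (simp add: mult_le_one)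
        qed (use a in \<open>auto intro: has_lpath_mono\<close>)
        finally show ?thesis by simp
      qed
    qed
  qed
qed

lemma has_path_of_length_if_has_lpath:
  assumes "has_lpath (verts G) k F"
  shows "has_path_of_length (G\<lparr>edges := F\<rparr>) k"
proof -
  obtain P where P: "lpath F P" "set P \<subseteq> verts G" "k + 1 \<le> length P" using assms by (auto simp: has_lpath_def)
  have "lpath F (take (k + 1) P)" using P(1) by (rule lpath_take)
  moreover have "set (take (k + 1) P) \<subseteq> verts G" by (rule order_trans[OF set_take_subset P(2)])
  moreover have "length (take (k + 1) P) = k + 1" "take (k + 1) P \<noteq> []" using P(3) by auto
  ultimately show ?thesis
    unfolding has_path_of_length_def is_path_def path_length_def lpath_def
    by (intro exI[of _ "take (k + 1) P"]) (simp del: take_eq_Nil)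
qed

lemma prob_random_subgraph:
  "measure_pmf.prob (random_subgraph G p) {H. Q H} = sprob (edges G) p (\<lambda>F. Q (G\<lparr>edges := F\<rparr>))"
proof -
  have "random_subgraph G p = map_pmf (\<lambda>F. G\<lparr>edges := F\<rparr>) (random_subset (edges G) p)"
    unfolding random_subgraph_def random_subset_def by (simp add: pmf.map_comp o_def)
  then show ?thesis by (simp only: sprob_def measure_map_pmf vimage_def mem_Collect_eq)
qed

theorem theorem1p2:
  fixes \<epsilon> :: real and G :: "nat \<Rightarrow> 'a ugraph" and p :: "nat \<Rightarrow> real"
  assumes "\<epsilon> > 0"
    and "\<And>k. finite_graph (G k)"
    and "\<And>k. min_degree (G k) \<ge> k"
    and "\<And>k. p k \<in> {0..1}"
    and "\<forall>\<^sub>F k in sequentially. p k \<ge> (1 + \<epsilon>) * ln (real k) / real k"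
  shows "asymptotically_almost_surely (\<lambda>k. random_subgraph (G k) (p k))
           (\<lambda>k H. has_path_of_length H k)"
proof -
  \<comment> \<open>The estimates above assume \<open>\<epsilon> \<le> 1\<close>; a larger
    \<open>\<epsilon>\<close> only raises the lower bound on \<open>p\<close>, as soon as
    \<open>ln k \<ge> 0\<close>.\<close>
  define \<epsilon>' where "\<epsilon>' = min \<epsilon> 1"
  have \<epsilon>': "0 < \<epsilon>'" "\<epsilon>' \<le> 1" "\<epsilon>' \<le> \<epsilon>" using assms(1) by (auto simp: \<epsilon>'_def)
  have simple: "simple_graph (verts (G k)) (edges (G k))" and ne: "verts (G k) \<noteq> {}" for k
    using assms(2)[of k] by (auto simp: finite_graph_def simple_graph_def)
  have deg: "k \<le> card (nbrs (edges (G k)) v)" if "v \<in> verts (G k)" for k v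
  proof -
    have "min_degree (G k) \<le> Defs.degree (G k) v"
      unfolding min_degree_def using that simple_graph_finite(1)[OF simple] by (intro Min_le) auto
    then show ?thesis using assms(3)[of k] card_nbrs[OF simple, of k v] by (simp add: Defs.degree_def)
  qed
  have "(\<lambda>k. measure_pmf.prob (random_subgraph (G k) (p k)) {H. has_path_of_length H k}) \<longlonglongrightarrow> 1"
  proof (rule LIMSEQ_I)
    fix r :: real assume r: "0 < r"
    then have "0 < r / 2" by simp
    from eventually_has_lpath[OF \<epsilon>'(1,2) this, where ?'a = 'a] assms(5) eventually_gt_at_top[of 1]
    have "\<forall>\<^sub>F k in sequentially. norm (measure_pmf.prob (random_subgraph (G k) (p k)) {H. has_path_of_length H k} - 1) < r"
    proof eventually_elim
      case (elim k)
      have "(1 + \<epsilon>') * ln (real k) / real k \<le> (1 + \<epsilon>) * ln (real k) / real k"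
        using \<epsilon>' elim(3) by (intro divide_right_mono mult_right_mono) auto
      then have "(1 + \<epsilon>') * ln (real k) / real k \<le> p k" using elim(2) by linarith
      then have "1 - r / 2 \<le> sprob (edges (G k)) (p k) (has_lpath (verts (G k)) k)"
        using elim(1) simple ne deg assms(4) by blast
      also have "\<dots> \<le> measure_pmf.prob (random_subgraph (G k) (p k)) {H. has_path_of_length H k}"
        unfolding prob_random_subgraph
        by (rule sprob_mono) (use simple_graph_finite(2)[OF simple] has_path_of_length_if_has_lpath in auto)
      finally have "1 - r / 2 \<le> measure_pmf.prob (random_subgraph (G k) (p k)) {H. has_path_of_length H k}" .
      moreover have "measure_pmf.prob (random_subgraph (G k) (p k)) {H. has_path_of_length H k} \<le> 1" by simp
      ultimately show ?case using r by simp
    qed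
    then show "\<exists>no. \<forall>k\<ge>no. norm (measure_pmf.prob (random_subgraph (G k) (p k)) {H. has_path_of_length H k} - 1) < r"
      by (simp add: eventually_sequentially)
  qed
  then show ?thesis by (simp add: asymptotically_almost_surely_def)
qed

end
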